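(* For every $n\in\mathbb{N}$, the word problem in the algebraic quantum symmetric group $\mathfrak{S}_n=\mathbb{C}\langle n^2\rangle/I_n$ is decidable; that is, there is an algorithm which, given two non-commutative polynomials $f,g\in\mathbb{C}\langle n^2\rangle$, always terminates and decides whether $f-g\in I_n$.
   Context: $\mathbb{C}\langle n^2\rangle=\mathbb{C}\langle u_{ij}\mid 1\le i,j\le n\rangle$ is the free associative unital algebra on $n^2$ symbols $u_{ij}$. $I_n$ is the two-sided ideal generated by $\sum_{\alpha=1}^n u_{i\alpha}-1$ and $\sum_{\alpha=1}^n u_{\alpha i}-1$ ($1\le i\le n$), $u_{ij}^2-u_{ij}$ ($1\le i,j\le n$), and $u_{ji}u_{ki}$ and $u_{ij}u_{ik}$ ($1\le i,j,k\le n$, $j\ne k$). The word problem in a quotient of a free associative algebra by a two-sided ideal is the problem of deciding whether two given polynomials are equivalent modulo the ideal. As usual, arithmetic and equality testing of the coefficients are taken to be available as basic operations. *)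

theory Defs
  imports
    Complex_Main
    "HOL-Library.Poly_Mapping"
    "HOL-Algebra.Ideal"
begin

section \<open>Free associative algebras\<close>

text \<open>
  Words over an alphabet form a monoid under concatenation, written additively because
  the monoid of exponents of a \<^typ>\<open>'m \<Rightarrow>\<^sub>0 'k\<close> is written additively. With these keys the
  convolution product of finitely supported functions is the product of
  non-commutative polynomials.
\<close>

datatype 'v ncword = NCWord (letters: "'v list")

instantiation ncword :: (type) monoid_add
begin

definition zero_ncword :: "'a ncword" where
  "0 = NCWord []"

definition plus_ncword :: "'a ncword \<Rightarrow> 'a ncword \<Rightarrow> 'a ncword" where
  "v + w = NCWord (letters v @ letters w)"

instance
  by standard (auto simp: zero_ncword_def plus_ncword_def)

end

type_synonym ('v, 'k) ncpoly = "'v ncword \<Rightarrow>\<^sub>0 'k"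

definition free_algebra :: "'v set \<Rightarrow> ('v, 'k :: field) ncpoly ring" where
  "free_algebra X =
     \<lparr>carrier = {f. \<forall>w \<in> Poly_Mapping.keys f. set (letters w) \<subseteq> X},
      mult = (*), one = 1, zero = 0, add = (+)\<rparr>"

lemma ring_free_algebra: "ring (free_algebra X :: ('v, 'k :: field) ncpoly ring)"
proof -
  have C: "carrier (free_algebra X) =
      {f :: ('v, 'k) ncpoly. \<forall>w \<in> Poly_Mapping.keys f. set (letters w) \<subseteq> X}"
    by (simp add: free_algebra_def)
  have ops: "mult (free_algebra X) = ((*) :: ('v, 'k) ncpoly \<Rightarrow> _)"
    "one (free_algebra X) = (1 :: ('v, 'k) ncpoly)"
    "zero (free_algebra X) = (0 :: ('v, 'k) ncpoly)"
    "add (free_algebra X) = ((+) :: ('v, 'k) ncpoly \<Rightarrow> _)"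
    by (simp_all add: free_algebra_def)
  have plus: "f + g \<in> carrier (free_algebra X)"
    if "f \<in> carrier (free_algebra X)" "g \<in> carrier (free_algebra X)"
    for f g :: "('v, 'k) ncpoly"
    using that Poly_Mapping.keys_add[of f g] unfolding C by blast
  have times: "f * g \<in> carrier (free_algebra X)"
    if "f \<in> carrier (free_algebra X)" "g \<in> carrier (free_algebra X)"
    for f g :: "('v, 'k) ncpoly"
  proof -
    have "set (letters w) \<subseteq> X" if "w \<in> Poly_Mapping.keys (f * g)" for w
    proof -
      from that keys_mult[of f g] obtain v v' where
        "v \<in> Poly_Mapping.keys f" "v' \<in> Poly_Mapping.keys g" "w = v + v'"
        by blast
      then show ?thesis
        using \<open>f \<in> _\<close> \<open>g \<in> _\<close> unfolding C by (simp add: plus_ncword_def)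
    qed
    then show ?thesis
      unfolding C by blast
  qed
  have one: "(1 :: ('v, 'k) ncpoly) \<in> carrier (free_algebra X)"
    unfolding C by (simp add: zero_ncword_def)
  have zero: "(0 :: ('v, 'k) ncpoly) \<in> carrier (free_algebra X)"
    unfolding C by simp
  have uminus: "\<exists>g \<in> carrier (free_algebra X). f + g = 0"
    if "f \<in> carrier (free_algebra X)" for f :: "('v, 'k) ncpoly"
    using that unfolding C by (intro bexI[of _ "- f"]) simp_all
  show ?thesis
  proof (rule ringI)
    show "abelian_group (free_algebra X :: ('v, 'k) ncpoly ring)"
      by (rule abelian_groupI; unfold ops) (simp_all add: plus zero uminus add.assoc add.commute)
    show "monoid (free_algebra X :: ('v, 'k) ncpoly ring)"
      by (rule monoidI; unfold ops) (simp_all add: times one mult.assoc)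
  qed (unfold ops, simp_all add: distrib_left distrib_right)
qed


section \<open>The ideal of the quantum symmetric group\<close>

abbreviation generators :: "nat \<Rightarrow> (nat \<times> nat) set" where
  "generators n \<equiv> {1..n} \<times> {1..n}"

definition u :: "nat \<Rightarrow> nat \<Rightarrow> (nat \<times> nat, complex) ncpoly" where
  "u i j = Poly_Mapping.single (NCWord [(i, j)]) 1"

definition qsym_relations :: "nat \<Rightarrow> (nat \<times> nat, complex) ncpoly set" where
  "qsym_relations n =
     {(\<Sum>\<alpha> = 1..n. u i \<alpha>) - 1 | i. i \<in> {1..n}} \<union>
     {(\<Sum>\<alpha> = 1..n. u \<alpha> i) - 1 | i. i \<in> {1..n}} \<union>
     {u i j ^ 2 - u i j | i j. i \<in> {1..n} \<and> j \<in> {1..n}} \<union>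
     {u j i * u k i | i j k. i \<in> {1..n} \<and> j \<in> {1..n} \<and> k \<in> {1..n} \<and> j \<noteq> k} \<union>
     {u i j * u i k | i j k. i \<in> {1..n} \<and> j \<in> {1..n} \<and> k \<in> {1..n} \<and> j \<noteq> k}"

definition qsym_ideal :: "nat \<Rightarrow> (nat \<times> nat, complex) ncpoly set" where
  "qsym_ideal n = genideal (free_algebra (generators n)) (qsym_relations n)"


section \<open>Algorithms over a field\<close>

text \<open>
  The model of computation is the WHILE language of N. Jones (Computability and Complexity
  from a Programming Perspective, 1997): imperative programs computing on finite binary
  trees. To make field arithmetic and equality testing basic operations, leaves may carry
  elements of the coefficient field. Programs contain no field constants other than 0 and 1,
  so they do not depend on the field and nothing can be coded into their coefficients.
\<close>

datatype 'k data = DNil | Scalar 'k | DPair "'k data" "'k data"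

datatype expr =
    Var nat
  | NilE
  | ConsE expr expr
  | HeadE expr
  | TailE expr
  | EqE expr expr
  | ZeroE
  | OneE
  | PlusE expr expr
  | MinusE expr expr
  | TimesE expr expr
  | DivideE expr expr

datatype com =
    Skip
  | Assign nat expr
  | Seq com com
  | Cond expr com com
  | While expr com

fun head :: "'k data \<Rightarrow> 'k data" where
  "head (DPair x y) = x"
| "head _ = DNil"

fun tail :: "'k data \<Rightarrow> 'k data" where
  "tail (DPair x y) = y"
| "tail _ = DNil"

fun lift_op :: "('k \<Rightarrow> 'k \<Rightarrow> 'k) \<Rightarrow> 'k data \<Rightarrow> 'k data \<Rightarrow> 'k data" where
  "lift_op h (Scalar a) (Scalar b) = Scalar (h a b)"
| "lift_op h _ _ = DNil"

definition truth :: "bool \<Rightarrow> 'k data" where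
  "truth b = (if b then DPair DNil DNil else DNil)"

type_synonym 'k store = "nat \<Rightarrow> 'k data"

text \<open>
  As in Jones's language, \<^const>\<open>EqE\<close> compares whole trees; this amounts to finitely many
  equality tests of coefficients.
\<close>

fun eval_expr :: "expr \<Rightarrow> 'k :: field store \<Rightarrow> 'k data" where
  "eval_expr (Var i) s = s i"
| "eval_expr NilE s = DNil"
| "eval_expr (ConsE e1 e2) s = DPair (eval_expr e1 s) (eval_expr e2 s)"
| "eval_expr (HeadE e) s = head (eval_expr e s)"
| "eval_expr (TailE e) s = tail (eval_expr e s)"
| "eval_expr (EqE e1 e2) s = truth (eval_expr e1 s = eval_expr e2 s)"
| "eval_expr ZeroE s = Scalar 0"
| "eval_expr OneE s = Scalar 1"
| "eval_expr (PlusE e1 e2) s = lift_op (+) (eval_expr e1 s) (eval_expr e2 s)"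
| "eval_expr (MinusE e1 e2) s = lift_op (-) (eval_expr e1 s) (eval_expr e2 s)"
| "eval_expr (TimesE e1 e2) s = lift_op (*) (eval_expr e1 s) (eval_expr e2 s)"
| "eval_expr (DivideE e1 e2) s = lift_op (/) (eval_expr e1 s) (eval_expr e2 s)"

inductive exec :: "com \<Rightarrow> 'k :: field store \<Rightarrow> 'k store \<Rightarrow> bool" where
  Skip: "exec Skip s s"
| Assign: "exec (Assign i e) s (s(i := eval_expr e s))"
| Seq: "exec c1 s t \<Longrightarrow> exec c2 t r \<Longrightarrow> exec (Seq c1 c2) s r"
| CondTrue: "eval_expr e s \<noteq> DNil \<Longrightarrow> exec c1 s t \<Longrightarrow> exec (Cond e c1 c2) s t"
| CondFalse: "eval_expr e s = DNil \<Longrightarrow> exec c2 s t \<Longrightarrow> exec (Cond e c1 c2) s t"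
| WhileTrue: "eval_expr e s \<noteq> DNil \<Longrightarrow> exec c s t \<Longrightarrow> exec (While e c) t r \<Longrightarrow>
    exec (While e c) s r"
| WhileFalse: "eval_expr e s = DNil \<Longrightarrow> exec (While e c) s s"

text \<open>
  Programs are deterministic, so the existence of a terminating run ending in a given
  store says that the program terminates and what its result is.
\<close>

inductive_cases exec_cases:
  "exec Skip s t" "exec (Assign i e) s t" "exec (Seq c1 c2) s t"
  "exec (Cond e c1 c2) s t" "exec (While e c) s t"

lemma exec_deterministic: "exec c s t \<Longrightarrow> exec c s t' \<Longrightarrow> t' = t"
  by (induction arbitrary: t' rule: exec.induct) (blast elim: exec_cases)+

definition computes :: "com \<Rightarrow> 'k :: field data \<Rightarrow> 'k data \<Rightarrow> bool" where
  "computes c x y \<longleftrightarrow> (\<exists>t. exec c ((\<lambda>_. DNil)(0 := x)) t \<and> t 0 = y)"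


section \<open>The word problem\<close>

text \<open>
  A polynomial is given to an algorithm as a list of terms. Like terms need not be
  collected, zero coefficients may occur, and the order of the terms is arbitrary.
\<close>

type_synonym ('v, 'k) terms = "('k \<times> 'v list) list"

definition poly_of_terms :: "('v, 'k :: field) terms \<Rightarrow> ('v, 'k) ncpoly" where
  "poly_of_terms ts = (\<Sum>(a, w) \<leftarrow> ts. Poly_Mapping.single (NCWord w) a)"

definition presents :: "'v set \<Rightarrow> ('v, 'k :: field) terms \<Rightarrow> ('v, 'k) ncpoly \<Rightarrow> bool" where
  "presents X ts f \<longleftrightarrow> (\<forall>(a, w) \<in> set ts. set w \<subseteq> X) \<and> poly_of_terms ts = f"

lemma presents_exists:
  assumes "f \<in> carrier (free_algebra X)"
  shows "\<exists>ts. presents X ts f"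
proof -
  obtain ws where ws: "set ws = Poly_Mapping.keys f" "distinct ws"
    using finite_distinct_list[OF finite_keys[of f]] by auto
  have "poly_of_terms (map (\<lambda>w. (Poly_Mapping.lookup f w, letters w)) ws) =
      sum_list (map (\<lambda>w. Poly_Mapping.single w (Poly_Mapping.lookup f w)) ws)"
    by (simp add: poly_of_terms_def comp_def)
  also have "\<dots> = (\<Sum>w \<in> Poly_Mapping.keys f.
      Poly_Mapping.single w (Poly_Mapping.lookup f w))"
    unfolding ws(1)[symmetric] by (rule sum_list_distinct_conv_sum_set[OF ws(2)])
  also have "\<dots> = f"
    by (rule poly_mapping_eqI)
       (simp add: lookup_sum lookup_single when_def not_in_keys_iff_lookup_eq_zero)
  finally show ?thesis
    using assms ws(1) unfolding presents_def free_algebra_def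
    by (intro exI[of _ "map (\<lambda>w. (Poly_Mapping.lookup f w, letters w)) ws"]) auto
qed

fun data_of_nat :: "nat \<Rightarrow> 'k data" where
  "data_of_nat 0 = DNil"
| "data_of_nat (Suc m) = DPair DNil (data_of_nat m)"

fun data_of_list :: "('a \<Rightarrow> 'k data) \<Rightarrow> 'a list \<Rightarrow> 'k data" where
  "data_of_list enc [] = DNil"
| "data_of_list enc (x # xs) = DPair (enc x) (data_of_list enc xs)"

definition data_of_word :: "(nat \<times> nat) list \<Rightarrow> 'k data" where
  "data_of_word = data_of_list (\<lambda>(i, j). DPair (data_of_nat i) (data_of_nat j))"

definition data_of_terms :: "(nat \<times> nat, 'k) terms \<Rightarrow> 'k data" where
  "data_of_terms = data_of_list (\<lambda>(a, w). DPair (Scalar a) (data_of_word w))"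

text \<open>
  The word problem in the quotient of the free algebra on the finite alphabet \<open>X\<close> by the
  two-sided ideal \<open>I\<close>.
\<close>

definition word_problem_decidable ::
    "(nat \<times> nat) set \<Rightarrow> (nat \<times> nat, 'k :: field) ncpoly set \<Rightarrow> bool" where
  "word_problem_decidable X I \<longleftrightarrow>
     (\<exists>c. \<forall>f \<in> carrier (free_algebra X). \<forall>g \<in> carrier (free_algebra X). \<forall>ts us.
        presents X ts f \<longrightarrow> presents X us g \<longrightarrow>
        computes c (DPair (data_of_terms ts) (data_of_terms us)) (truth (f - g \<in> I)))"

end

theory Submission
  imports Defs
begin

text \<open>
  Let \<open>s\<close> be the sum of the first row of generators. The homogeneous relations ``all row sums and
  all column sums agree, distinct entries of a row or of a column multiply to zero'' imply that
  \<open>s\<close> is central and that \<open>u\<^sub>i\<^sub>j\<^sup>2 = s u\<^sub>i\<^sub>j\<close>, so setting \<open>s = 1\<close> gives the quantum symmetric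
  group. Hence a polynomial lies in the ideal iff some homogenization of it (padding with
  powers of \<open>s\<close>) lies in the homogeneous ideal. Once \<open>s\<close> is known not to be a zero divisor
  modulo the homogeneous ideal, the homogenization may be taken in any degree \<open>k\<close> not below the
  degree of the polynomial, and membership becomes a question about the span of finitely many
  vectors, settled by Gaussian elimination.

  A word of length \<open>k\<close> in the generators is a pair of words \<open>I\<close>, \<open>J\<close> over \<open>{1..n}\<close>, so forms on
  words are matrices, and a matrix annihilates the degree \<open>k\<close> part of the homogeneous ideal iff it
  commutes with the operators \<open>e\<^sub>0, \<dots>, e\<^sub>2\<^sub>k\<^sub>-\<^sub>2\<close> that generate a Temperley-Lieb algebra: \<open>e\<^sub>2\<^sub>i\<close> sums
  over letter \<open>i\<close>, \<open>e\<^sub>2\<^sub>i\<^sub>+\<^sub>1\<close> projects onto the words whose letters \<open>i\<close> and \<open>i + 1\<close> agree. Suppose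
  \<open>s f\<close> lies in the homogeneous ideal and let \<open>t\<close> be the component of \<open>f\<close> orthogonal to the ideal
  in degree \<open>k\<close>; it commutes with the operators in degree \<open>k\<close>. For an orthonormal basis \<open>B\<close> of the
  span of the operator products in degree \<open>k + 1\<close>, the matrix \<open>\<Sum>b\<in>B. b (J \<otimes> cnj t) b\<^sup>*\<close>, \<open>J\<close> being the
  all-one matrix, commutes with all operators in degree \<open>k + 1\<close>. Since it annihilates \<open>s t\<close>, and
  \<open>e\<^sub>0 w e\<^sub>0\<close> is a multiple of some \<open>w' e\<^sub>0\<close> with \<open>w'\<close> acting on the remaining letters only, a sum of
  squares vanishes, which forces \<open>t = 0\<close>.
\<close>

section \<open>Orthonormal bases\<close>

text \<open>Gram-Schmidt by induction on the index set: the vectors vanishing at a new index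
  \<open>x\<close> are covered by the induction hypothesis, and at most one more basis vector is
  needed, since subtracting a multiple of it clears the coordinate \<open>x\<close>. Only the values
  on \<open>\<Omega>\<close> count, so \<open>V\<close> may consist of functions on an infinite
  type.\<close>

lemma orthonormal_basis_exists:
  fixes V :: "('i \<Rightarrow> complex) set"
  assumes "finite \<Omega>" "(\<lambda>_. 0) \<in> V" "\<And>f g c. f \<in> V \<Longrightarrow> g \<in> V \<Longrightarrow> (\<lambda>i. f i + c * g i) \<in> V"
  shows "\<exists>B \<subseteq> V. finite B \<and>
    (\<forall>b\<in>B. \<forall>b'\<in>B. (\<Sum>i\<in>\<Omega>. b i * cnj (b' i)) = (if b = b' then 1 else 0)) \<and>
    (\<forall>v\<in>V. \<forall>i\<in>\<Omega>. v i = (\<Sum>b\<in>B. (\<Sum>j\<in>\<Omega>. v j * cnj (b j)) * b i))"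
  using assms
proof (induction \<Omega> arbitrary: V rule: finite_induct)
  case empty
  then show ?case by (intro exI[of _ "{}"]) auto
next
  case (insert x \<Omega>)
  note closed = insert.prems(2)
  define V0 where "V0 = {v \<in> V. v x = 0}"
  have "\<exists>B \<subseteq> V0. finite B \<and>
    (\<forall>b\<in>B. \<forall>b'\<in>B. (\<Sum>i\<in>\<Omega>. b i * cnj (b' i)) = (if b = b' then 1 else 0)) \<and>
    (\<forall>v\<in>V0. \<forall>i\<in>\<Omega>. v i = (\<Sum>b\<in>B. (\<Sum>j\<in>\<Omega>. v j * cnj (b j)) * b i))"
    by (rule insert.IH) (auto simp: V0_def insert.prems)
  then obtain B where B: "B \<subseteq> V0" "finite B"
    and orth: "\<And>b b'. b \<in> B \<Longrightarrow> b' \<in> B \<Longrightarrow> (\<Sum>i\<in>\<Omega>. b i * cnj (b' i)) = (if b = b' then 1 else 0)"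
    and exp: "\<And>v i. v \<in> V0 \<Longrightarrow> i \<in> \<Omega> \<Longrightarrow> v i = (\<Sum>b\<in>B. (\<Sum>j\<in>\<Omega>. v j * cnj (b j)) * b i)"
    by blast
  define ip where "ip f g = (\<Sum>i\<in>insert x \<Omega>. f i * cnj (g i))" for f g :: "'i \<Rightarrow> complex"
  have ip0: "ip f b = (\<Sum>i\<in>\<Omega>. f i * cnj (b i))" if "b \<in> V0" for f b
    using insert.hyps that unfolding ip_def V0_def by simp
  have ip_lin: "ip (\<lambda>i. f i + c * g i) h = ip f h + c * ip g h" for f g h c
    unfolding ip_def by (simp add: distrib_right sum.distrib sum_distrib_left mult.assoc del: sum.insert)
  have ip_cnj: "ip f g = cnj (ip g f)" for f g
    unfolding ip_def by (simp add: mult.commute)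
  have Bx: "b x = 0" if "b \<in> B" for b using B that by (auto simp: V0_def)
  have expB: "v i = (\<Sum>b\<in>B. ip v b * b i)" if "v \<in> V0" "i \<in> insert x \<Omega>" for v i
  proof (cases "i = x")
    case True
    then show ?thesis using that Bx by (simp add: V0_def sum.neutral)
  next
    case False
    have "(\<Sum>b\<in>B. ip v b * b i) = (\<Sum>b\<in>B. (\<Sum>j\<in>\<Omega>. v j * cnj (b j)) * b i)"
      using B ip0 by (intro sum.cong) auto
    with exp[OF that(1), of i] that(2) False show ?thesis by (metis insertE)
  qed
  have orthB: "ip b b' = (if b = b' then 1 else 0)" if "b \<in> B" "b' \<in> B" for b b'
    using ip0[of b' b] B orth[of b b'] that by auto
  have subspace_sum: "(\<lambda>i. v i + (\<Sum>b\<in>A. c b * b i)) \<in> V" if "v \<in> V" "A \<subseteq> V" "finite A" for v A c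
    using that(3,2)
  proof (induction A rule: finite_induct)
    case (insert a A)
    then have "(\<lambda>i. (v i + (\<Sum>b\<in>A. c b * b i)) + c a * a i) \<in> V"
      by (intro closed) auto
    then show ?case using insert by (simp add: algebra_simps)
  qed (use that in simp)
  show ?case
  proof (cases "V = V0")
    case True
    show ?thesis
      unfolding ip_def[symmetric]
    proof (intro exI[of _ B] conjI ballI)
      fix v i assume "v \<in> V" and "i \<in> insert x \<Omega>"
      then show "v i = (\<Sum>b\<in>B. ip v b * b i)" using True by (intro expB) auto
    next
      fix b b' assume "b \<in> B" "b' \<in> B"
      then show "ip b b' = (if b = b' then 1 else 0)"
        by (rule orthB)
    qed (use B True in auto)
  next
    case False
    then obtain v where v: "v \<in> V" "v x \<noteq> 0" unfolding V0_def by auto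
    \<comment> \<open>The component of \<open>v\<close> orthogonal to \<open>B\<close>; its value at
      \<open>x\<close> is still that of \<open>v\<close>, because every element of \<open>B\<close>
      vanishes there.\<close>
    define w where "w = (\<lambda>i. v i + (\<Sum>b\<in>B. - ip v b * b i))"
    have wV: "w \<in> V" unfolding w_def
      by (rule subspace_sum) (use v B in \<open>auto simp: V0_def\<close>)
    have wx: "w x \<noteq> 0" using v Bx unfolding w_def by (simp add: sum.neutral)
    have ip_sum: "ip (\<lambda>i. f i + (\<Sum>b\<in>A. c b * b i)) g = ip f g + (\<Sum>b\<in>A. c b * ip b g)"
      if "finite A" for f g A c
      using that
    proof (induction A rule: finite_induct)
      case (insert a A)
      have "ip (\<lambda>i. f i + (\<Sum>b\<in>insert a A. c b * b i)) g =
        ip (\<lambda>i. (f i + (\<Sum>b\<in>A. c b * b i)) + c a * a i) g"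
        using insert by (simp add: algebra_simps)
      also have "\<dots> = ip f g + (\<Sum>b\<in>A. c b * ip b g) + c a * ip a g"
        by (simp only: ip_lin insert.IH)
      finally show ?case using insert by (simp add: algebra_simps)
    qed simp
    have w_orth: "ip w b = 0" if "b \<in> B" for b
    proof -
      have "ip w b = ip v b + (\<Sum>b'\<in>B. - ip v b' * ip b' b)"
        unfolding w_def by (rule ip_sum[OF B(2)])
      also have "(\<Sum>b'\<in>B. - ip v b' * ip b' b) = (\<Sum>b'\<in>B. if b' = b then - ip v b else 0)"
        by (intro sum.cong) (auto simp: orthB that)
      finally show ?thesis using that B by simp
    qed
    define r where "r = (\<Sum>i\<in>insert x \<Omega>. (cmod (w i))\<^sup>2)"
    have "r > 0"
    proof -
      have "(cmod (w x))\<^sup>2 \<le> r" unfolding r_def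
        by (rule member_le_sum) (use insert.hyps in auto)
      moreover have "(cmod (w x))\<^sup>2 > 0" using wx by simp
      ultimately show ?thesis by linarith
    qed
    have ipww: "ip w w = complex_of_real r"
      unfolding ip_def r_def of_real_sum by (intro sum.cong) (simp_all only: complex_norm_square)
    \<comment> \<open>The summand 0 gives \<open>e\<close> the shape of the closure assumption on
      \<open>V\<close>.\<close>
    define e where "e = (\<lambda>i. 0 + complex_of_real (1 / sqrt r) * w i)"
    have eV: "e \<in> V" unfolding e_def by (rule insert.prems(2)) (use insert.prems wV in auto)
    have ex: "e x \<noteq> 0" using wx \<open>r > 0\<close> unfolding e_def by simp
    have ip_e: "ip e g = complex_of_real (1 / sqrt r) * ip w g" for g
      unfolding e_def ip_lin by (simp add: ip_def)
    have ip_e': "ip g e = complex_of_real (1 / sqrt r) * ip g w" for g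
      by (subst ip_cnj, subst ip_e, subst ip_cnj[of w g]) simp
    have ee: "ip e e = 1"
    proof -
      have "ip e e = complex_of_real (1 / sqrt r * (1 / sqrt r) * r)"
        by (simp only: ip_e ip_e' ipww of_real_mult mult.assoc)
      also have "1 / sqrt r * (1 / sqrt r) * r = 1" using \<open>r > 0\<close> by (simp add: field_simps)
      finally show ?thesis by simp
    qed
    have eB: "ip e b = 0" "ip b e = 0" if "b \<in> B" for b
      using w_orth[OF that] ip_cnj[of b w] by (simp_all add: ip_e ip_e')
    have enB: "e \<notin> B" using ex Bx by auto
    show ?thesis
      unfolding ip_def[symmetric]
    proof (intro exI[of _ "insert e B"] conjI ballI)
      fix b b' assume "b \<in> insert e B" "b' \<in> insert e B"
      then show "ip b b' = (if b = b' then 1 else 0)"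
        using orthB ee eB enB by auto
    next
      fix u i assume u: "u \<in> V" and i: "i \<in> insert x \<Omega>"
      \<comment> \<open>The multiple of \<open>e\<close> that cancels \<open>u\<close> at
        \<open>x\<close>. The remainder \<open>z\<close> is a combination of \<open>B\<close>, hence
        orthogonal to \<open>e\<close>, which identifies \<open>q\<close> with the coefficient
        \<open>ip u e\<close>.\<close>
      define q where "q = u x / e x"
      define z where "z = (\<lambda>i. u i + (- q) * e i)"
      have z0: "z \<in> V0"
        using insert.prems(2)[OF u eV, of "- q"] ex unfolding V0_def z_def q_def by simp
      have zi: "z i = (\<Sum>b\<in>B. ip z b * b i)" by (rule expB[OF z0 i])
      have ipzb: "ip z b = ip u b" if "b \<in> B" for b
        unfolding z_def ip_lin using eB that by simp
      have ipze: "ip z e = ip u e - q" unfolding z_def ip_lin by (simp add: ee)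
      have "ip z e = (\<Sum>b\<in>B. ip z b * ip b e)"
      proof -
        have "ip z e = (\<Sum>i\<in>insert x \<Omega>. (0 + (\<Sum>b\<in>B. ip z b * b i)) * cnj (e i))"
          unfolding ip_def[of z e] by (rule sum.cong[OF refl], subst expB[OF z0]) simp_all
        also have "\<dots> = ip (\<lambda>i. 0 + (\<Sum>b\<in>B. ip z b * b i)) e" by (simp only: ip_def[of "\<lambda>i. 0 + (\<Sum>b\<in>B. ip z b * b i)" e])
        also have "\<dots> = ip (\<lambda>_. 0) e + (\<Sum>b\<in>B. ip z b * ip b e)"
          by (rule ip_sum[OF B(2)])
        finally show ?thesis by (simp add: ip_def[of "\<lambda>_. 0" e] del: sum.insert)
      qed
      also have "\<dots> = 0" using eB by simp
      finally have "ip u e = q" using ipze by simp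
      then show "u i = (\<Sum>b\<in>insert e B. ip u b * b i)"
        using zi ipzb enB B by (simp add: z_def diff_eq_eq add.commute)
    qed (use B eV in \<open>auto simp: V0_def\<close>)
  qed
qed

section \<open>Temperley-Lieb operators on words\<close>

definition words_over :: "nat \<Rightarrow> nat \<Rightarrow> nat list set" where
  "words_over n k = {I. length I = k \<and> set I \<subseteq> {1..n}}"

lemma words_over_0 [simp]: "words_over n 0 = {[]}"
  by (auto simp: words_over_def)

lemma Cons_words_over [simp]:
  "x # I \<in> words_over n (Suc k) \<longleftrightarrow> x \<in> {1..n} \<and> I \<in> words_over n k"
  by (auto simp: words_over_def)

lemma words_over_Suc: "words_over n (Suc k) = (\<lambda>(x, I). x # I) ` ({1..n} \<times> words_over n k)"
  by (auto simp: words_over_def length_Suc_conv image_iff)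

lemma finite_words_over [simp]: "finite (words_over n k)"
  by (induction k) (auto simp: words_over_Suc)

lemma sum_words_over_Suc:
  "(\<Sum>I\<in>words_over n (Suc k). F I) = (\<Sum>x=1..n. \<Sum>I\<in>words_over n k. F (x # I))"
  unfolding words_over_Suc
  by (subst sum.reindex) (auto simp: inj_on_def sum.cartesian_product intro!: sum.cong)

text \<open>
  Operators that would act beyond the end of the word are 0. The Temperley-Lieb relations
  then hold, up to a scalar that may depend on the length, on words of every length.
\<close>

fun tlop :: "nat \<Rightarrow> nat \<Rightarrow> (nat list \<Rightarrow> complex) \<Rightarrow> nat list \<Rightarrow> complex" where
  "tlop n i g [] = 0"
| "tlop n 0 g (x # I) = (\<Sum>z=1..n. g (z # I))"
| "tlop n (Suc 0) g [x] = 0"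
| "tlop n (Suc 0) g (x # y # I) = (if x = y then g (x # y # I) else 0)"
| "tlop n (Suc (Suc i)) g (x # I) = tlop n i (\<lambda>K. g (x # K)) I"

lemma tlop_linear: "tlop n i (\<lambda>K. f K + c * g K) I = tlop n i f I + c * tlop n i g I"
  by (induction n i f I arbitrary: g rule: tlop.induct)
     (simp_all add: sum.distrib sum_distrib_left)

lemma tlop_zero: "tlop n i (\<lambda>_. 0) I = 0"
  using tlop_linear[of n i "\<lambda>_. 0" "1" "\<lambda>_. 0" I] by simp

lemma tlop_sum: "finite A \<Longrightarrow> tlop n i (\<lambda>K. \<Sum>a\<in>A. c a * g a K) I = (\<Sum>a\<in>A. c a * tlop n i (g a) I)"
proof (induction A rule: finite_induct)
  case (insert a A)
  then show ?case
    using tlop_linear[of n i "\<lambda>K. \<Sum>a\<in>A. c a * g a K" "c a" "g a" I] by (simp add: add.commute)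
qed (simp add: tlop_zero)

lemma tlop_cnj: "tlop n i (\<lambda>K. cnj (g K)) I = cnj (tlop n i g I)"
  by (induction n i g I rule: tlop.induct) simp_all

lemma tlop_cong:
  "I \<in> words_over n k \<Longrightarrow> (\<And>K. K \<in> words_over n k \<Longrightarrow> f K = g K) \<Longrightarrow> tlop n i f I = tlop n i g I"
proof (induction n i f I arbitrary: g k rule: tlop.induct)
  case (2 n f x I)
  then show ?case by (cases k) (auto intro!: sum.cong simp: words_over_def)
next
  case (5 n i f x I)
  then show ?case by (cases k) (auto intro!: 5 simp: words_over_def)
qed auto

text \<open>Left and right multiplication of a matrix commute; here one operator acts on the row
  index and the other on the column index.\<close>

lemma tlop_tlop_commute_cross:
  "tlop n i (\<lambda>K. tlop n j (\<lambda>L. T K L) J) I = tlop n j (\<lambda>L. tlop n i (\<lambda>K. T K L) I) J"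
proof (induction i arbitrary: I T rule: induct_nat_012)
  case 0
  then show ?case
    by (cases I) (simp_all add: tlop_zero tlop_sum[where c = "\<lambda>_. 1", simplified])
next
  case 1
  consider "I = []" | x where "I = [x]" | x y I' where "I = x # y # I'"
    by (metis neq_Nil_conv)
  then show ?case by cases (auto simp: tlop_zero)
next
  case (ge2 i)
  then show ?case by (cases I) (simp_all add: tlop_zero)
qed

text \<open>The matrices are real and symmetric, so the pairing can be bilinear. For index 0 this
  amounts to exchanging the sums over the old and the new first letter; the operator of index 1 is
  diagonal.\<close>

lemma tlop_selfadjoint:
  "(\<Sum>I\<in>words_over n k. tlop n i g I * h I) = (\<Sum>I\<in>words_over n k. g I * tlop n i h I)"
proof (induction i arbitrary: k g h rule: induct_nat_012)
  case 0
  show ?case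
  proof (cases k)
    case (Suc k)
    have "(\<Sum>x=1..n. \<Sum>I\<in>words_over n k. (\<Sum>z=1..n. g (z # I)) * h (x # I))
        = (\<Sum>x=1..n. \<Sum>I\<in>words_over n k. \<Sum>z=1..n. g (z # I) * h (x # I))"
      by (simp add: sum_distrib_right)
    also have "\<dots> = (\<Sum>x=1..n. \<Sum>z=1..n. \<Sum>I\<in>words_over n k. g (z # I) * h (x # I))"
      by (intro sum.cong refl sum.swap)
    also have "\<dots> = (\<Sum>z=1..n. \<Sum>x=1..n. \<Sum>I\<in>words_over n k. g (z # I) * h (x # I))"
      by (rule sum.swap)
    also have "\<dots> = (\<Sum>z=1..n. \<Sum>I\<in>words_over n k. \<Sum>x=1..n. g (z # I) * h (x # I))"
      by (intro sum.cong refl sum.swap)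
    finally show ?thesis unfolding Suc sum_words_over_Suc by (simp add: sum_distrib_left)
  qed simp
next
  case 1
  have "tlop n 1 g I * h I = g I * tlop n 1 h I" for I
  proof -
    consider "I = []" | x where "I = [x]" | x y I' where "I = x # y # I'"
      by (metis neq_Nil_conv)
    then show ?thesis by cases auto
  qed
  then show ?case by simp
next
  case (ge2 i)
  show ?case
    by (cases k) (simp_all add: sum_words_over_Suc ge2)
qed

lemma tlop_idem: "I \<in> words_over n k \<Longrightarrow>
  tlop n i (tlop n i g) I = (if even i then of_nat n else 1) * tlop n i g I"
proof (induction i arbitrary: I k g rule: induct_nat_012)
  case 0
  then show ?case by (cases I) simp_all
next
  case 1
  consider "I = []" | x where "I = [x]" | x y I' where "I = x # y # I'"
    by (metis neq_Nil_conv)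
  then show ?case by cases auto
next
  case (ge2 i)
  show ?case
  proof (cases I)
    case (Cons x I')
    then have "I' \<in> words_over n (k - 1)" using ge2.prems by (auto simp: words_over_def)
    from ge2.IH(1)[OF this, of "\<lambda>K. g (x # K)"] show ?thesis by (simp add: Cons)
  qed simp
qed

text \<open>The constant can be 1 unless an operator reaches beyond the end of the word. For
  example, on words of length 1 the operator of index 1 is 0 while that of index 0 need not be,
  which forces the constant 0. Hence \<open>c\<close> may depend on \<open>k\<close>, but not on
  \<open>g\<close> or on the word.\<close>

lemma tlop_braid:
  "\<exists>c. \<forall>g. \<forall>I\<in>words_over n k. tlop n i (tlop n (Suc i) (tlop n i g)) I = c * tlop n i g I"
  "\<exists>c. \<forall>g. \<forall>I\<in>words_over n k.
     tlop n (Suc i) (tlop n i (tlop n (Suc i) g)) I = c * tlop n (Suc i) g I"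
proof (induction i arbitrary: k rule: induct_nat_012)
  case 0
  {
    case 1
    show ?case
    proof (cases "k \<ge> 2")
      case True
      have "tlop n 0 (tlop n (Suc 0) (tlop n 0 g)) I = tlop n 0 g I" if I: "I \<in> words_over n k" for g I
      proof -
        from True obtain k' where k: "k = Suc (Suc k')" by (metis Suc_le_D numeral_2_eq_2 Suc_le_mono)
        then obtain x y I' where "I = x # y # I'" using I by (auto simp: words_over_Suc)
        then show ?thesis using I by (auto simp: k)
      qed
      then show ?thesis by (intro exI[of _ 1]) auto
    next
      case False
      then have "tlop n 0 (tlop n (Suc 0) (tlop n 0 g)) I = 0" if "I \<in> words_over n k" for g I
        using that by (cases I rule: remdups_adj.cases) (auto simp: words_over_def)
      then show ?thesis by (intro exI[of _ 0]) auto
    qed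
  next
    case 2
    have "tlop n (Suc 0) (tlop n 0 (tlop n (Suc 0) g)) I = tlop n (Suc 0) g I"
      if "I \<in> words_over n k" for g I
      using that by (cases I rule: remdups_adj.cases) (auto simp: words_over_def)
    then show ?case by (intro exI[of _ 1]) auto
  }
next
  case 1
  {
    case 1
    show ?case
    proof (cases "k \<ge> 2")
      case True
      have "tlop n (Suc 0) (tlop n 2 (tlop n (Suc 0) g)) I = tlop n (Suc 0) g I"
        if "I \<in> words_over n k" for g I
        using that True by (cases I rule: remdups_adj.cases) (auto simp: words_over_def numeral_2_eq_2)
      then show ?thesis by (intro exI[of _ 1]) (auto simp: numeral_2_eq_2)
    next
      case False
      then have "tlop n (Suc 0) (tlop n 2 (tlop n (Suc 0) g)) I = 0" if "I \<in> words_over n k" for g I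
        using that by (cases I rule: remdups_adj.cases) (auto simp: words_over_def)
      then show ?thesis by (intro exI[of _ 0]) (auto simp: numeral_2_eq_2)
    qed
  next
    case 2
    show ?case
    proof (cases "k \<ge> 2")
      case True
      have "tlop n 2 (tlop n (Suc 0) (tlop n 2 g)) I = tlop n 2 g I" if I: "I \<in> words_over n k" for g I
      proof -
        from True obtain k' where k: "k = Suc (Suc k')" by (metis Suc_le_D numeral_2_eq_2 Suc_le_mono)
        then obtain x y I' where "I = x # y # I'" using I by (auto simp: words_over_Suc)
        then show ?thesis using I by (auto simp: k numeral_2_eq_2)
      qed
      then show ?thesis by (intro exI[of _ 1]) (auto simp: numeral_2_eq_2)
    next
      case False
      then have "tlop n 2 (tlop n (Suc 0) (tlop n 2 g)) I = 0" if "I \<in> words_over n k" for g I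
        using that by (cases I rule: remdups_adj.cases) (auto simp: words_over_def numeral_2_eq_2)
      then show ?thesis by (intro exI[of _ 0]) (auto simp: numeral_2_eq_2)
    qed
  }
next
  case (ge2 i)
  {
    case 1
    obtain c where c: "\<forall>g. \<forall>I\<in>words_over n (k - 1).
        tlop n i (tlop n (Suc i) (tlop n i g)) I = c * tlop n i g I"
      using ge2(1) by blast
    show ?case
    proof (intro exI[of _ c] allI ballI)
      fix g I assume "I \<in> words_over n k"
      then show "tlop n (Suc (Suc i)) (tlop n (Suc (Suc (Suc i))) (tlop n (Suc (Suc i)) g)) I
          = c * tlop n (Suc (Suc i)) g I"
        using c by (cases I) (auto simp: words_over_def)
    qed
  next
    case 2
    obtain c where c: "\<forall>g. \<forall>I\<in>words_over n (k - 1).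
        tlop n (Suc i) (tlop n i (tlop n (Suc i) g)) I = c * tlop n (Suc i) g I"
      using ge2(2) by blast
    show ?case
    proof (intro exI[of _ c] allI ballI)
      fix g I assume "I \<in> words_over n k"
      then show "tlop n (Suc (Suc (Suc i))) (tlop n (Suc (Suc i)) (tlop n (Suc (Suc (Suc i))) g)) I
          = c * tlop n (Suc (Suc (Suc i))) g I"
        using c by (cases I) (auto simp: words_over_def)
    qed
  }
qed

lemma tlop_far_commute:
  "i + 2 \<le> j \<Longrightarrow> tlop n i (tlop n j g) I = tlop n j (tlop n i g) I"
proof (induction i arbitrary: I g j rule: induct_nat_012)
  case 0
  then obtain j' where "j = Suc (Suc j')" by (metis add_2_eq_Suc' le_Suc_ex add_Suc add_0)
  then show ?case
    by (cases I) (simp_all add: tlop_sum[where c = "\<lambda>_. 1", simplified])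
next
  case 1
  then obtain j' where j: "j = Suc (Suc (Suc j'))"
    by (metis One_nat_def Suc_1 add_Suc le_Suc_ex plus_1_eq_Suc)
  show ?case
  proof (cases I rule: remdups_adj.cases)
    case (3 x y I')
    then show ?thesis
      by (cases j'; cases I') (auto simp: j tlop_zero)
  qed (auto simp: j)
next
  case (ge2 i)
  then obtain j' where j: "j = Suc (Suc j')" "i + 2 \<le> j'"
    by (metis add_Suc Suc_le_D Suc_le_mono)
  then show ?case by (cases I) (simp_all add: ge2)
qed

section \<open>Products of the operators and the relations between them\<close>

definition tlact :: "nat \<Rightarrow> nat list \<Rightarrow> (nat list \<Rightarrow> complex) \<Rightarrow> nat list \<Rightarrow> complex" where
  "tlact n = foldr (tlop n)"

lemma tlact_simps [simp]:
  "tlact n [] g = g" "tlact n (i # xs) g = tlop n i (tlact n xs g)"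
  "tlact n (xs @ ys) g = tlact n xs (tlact n ys g)"
  by (simp_all add: tlact_def)

lemma tlact_cong:
  "I \<in> words_over n k \<Longrightarrow> (\<And>K. K \<in> words_over n k \<Longrightarrow> f K = g K) \<Longrightarrow> tlact n xs f I = tlact n xs g I"
  by (induction xs arbitrary: I) (auto intro!: tlop_cong)

lemma tlact_linear: "tlact n xs (\<lambda>K. f K + c * g K) I = tlact n xs f I + c * tlact n xs g I"
proof (induction xs arbitrary: I)
  case (Cons i xs)
  have "tlact n xs (\<lambda>K. f K + c * g K) = (\<lambda>K. tlact n xs f K + c * tlact n xs g K)"
    using Cons by blast
  then show ?case by (simp add: tlop_linear)
qed simp

lemma tlact_zero: "tlact n xs (\<lambda>_. 0) I = 0"
  using tlact_linear[of n xs "\<lambda>_. 0" "1" "\<lambda>_. 0" I] by simp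

lemma tlact_cmult: "tlact n xs (\<lambda>K. c * g K) I = c * tlact n xs g I"
  using tlact_linear[of n xs "\<lambda>_. 0" c g I] by (simp add: tlact_zero)

lemma tlact_sum:
  "finite A \<Longrightarrow> tlact n xs (\<lambda>K. \<Sum>a\<in>A. c a * g a K) I = (\<Sum>a\<in>A. c a * tlact n xs (g a) I)"
proof (induction A rule: finite_induct)
  case (insert a A)
  then show ?case
    using tlact_linear[of n xs "\<lambda>K. \<Sum>a\<in>A. c a * g a K" "c a" "g a" I] by (simp add: add.commute)
qed (simp add: tlact_zero)

lemma tlact_selfadjoint:
  "(\<Sum>I\<in>words_over n k. tlact n xs g I * h I) = (\<Sum>I\<in>words_over n k. g I * tlact n (rev xs) h I)"
proof (induction xs arbitrary: g h)
  case (Cons i xs)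
  have "(\<Sum>I\<in>words_over n k. tlact n (i # xs) g I * h I)
      = (\<Sum>I\<in>words_over n k. tlact n xs g I * tlop n i h I)"
    by (simp add: tlop_selfadjoint)
  then show ?case by (simp add: Cons)
qed simp

text \<open>Rewriting of operator products up to a scalar factor. There is no symmetry rule: the
  scalar may be 0, so a product is a multiple of its rewritten form but not conversely.\<close>

inductive tlrel :: "nat list \<Rightarrow> nat list \<Rightarrow> bool" where
  tl_refl: "tlrel xs xs"
| tl_trans: "tlrel xs ys \<Longrightarrow> tlrel ys zs \<Longrightarrow> tlrel xs zs"
| tl_cong: "tlrel xs ys \<Longrightarrow> tlrel (us @ xs @ vs) (us @ ys @ vs)"
| tl_idem: "tlrel [i, i] [i]"
| tl_braid1: "tlrel [i, Suc i, i] [i]"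
| tl_braid2: "tlrel [Suc i, i, Suc i] [Suc i]"
| tl_comm: "i + 2 \<le> j \<Longrightarrow> tlrel [i, j] [j, i]"
| tl_comm': "i + 2 \<le> j \<Longrightarrow> tlrel [j, i] [i, j]"

lemma tlrel_sound:
  "tlrel xs ys \<Longrightarrow> \<exists>c. \<forall>g. \<forall>I\<in>words_over n k. tlact n xs g I = c * tlact n ys g I"
proof (induction rule: tlrel.induct)
  case (tl_trans xs ys zs)
  then obtain c d where
    "\<forall>g. \<forall>I\<in>words_over n k. tlact n xs g I = c * tlact n ys g I"
    "\<forall>g. \<forall>I\<in>words_over n k. tlact n ys g I = d * tlact n zs g I" by blast
  then show ?case by (intro exI[of _ "c * d"]) auto
next
  case (tl_cong xs ys us vs)
  then obtain c where
    c: "\<forall>g. \<forall>I\<in>words_over n k. tlact n xs g I = c * tlact n ys g I" by blast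
  show ?case
  proof (intro exI[of _ c] allI ballI)
    fix g I assume I: "I \<in> words_over n k"
    have "tlact n us (tlact n xs (tlact n vs g)) I = tlact n us (\<lambda>K. c * tlact n ys (tlact n vs g) K) I"
      by (rule tlact_cong[OF I]) (use c in auto)
    then show "tlact n (us @ xs @ vs) g I = c * tlact n (us @ ys @ vs) g I"
      by (simp add: tlact_cmult)
  qed
next
  case (tl_idem i)
  show ?case
    by (intro exI[of _ "if even i then of_nat n else 1"]) (simp add: tlop_idem)
next
  case (tl_braid1 i)
  then show ?case using tlop_braid(1)[where i = i] by simp
next
  case (tl_braid2 i)
  then show ?case using tlop_braid(2)[where i = i] by simp
next
  case (tl_comm i j)
  then show ?case by (intro exI[of _ 1]) (simp add: tlop_far_commute[of i j])
next
  case (tl_comm' i j)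
  then show ?case by (intro exI[of _ 1]) (simp add: tlop_far_commute[of i j])
qed (auto intro: exI[of _ 1])

lemma tlrel_congL: "tlrel xs ys \<Longrightarrow> tlrel (us @ xs) (us @ ys)"
  using tl_cong[of xs ys us "[]"] by simp

lemma tlrel_congR: "tlrel xs ys \<Longrightarrow> tlrel (xs @ vs) (ys @ vs)"
  using tl_cong[of xs ys "[]" vs] by simp

lemma tlrel_commute_far: "\<forall>x\<in>set xs. i + 2 \<le> x \<Longrightarrow> tlrel (i # xs) (xs @ [i])"
proof (induction xs)
  case (Cons x xs)
  have "tlrel ([i, x] @ xs) ([x, i] @ xs)"
    using Cons.prems by (intro tlrel_congR tl_comm) auto
  moreover have "tlrel ([x] @ i # xs) ([x] @ xs @ [i])"
    using Cons by (intro tlrel_congL) auto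
  ultimately show ?case by (simp, meson tl_trans)
qed (simp add: tl_refl)

text \<open>
  Jones's normal form: modulo the relations a word in the operators of index at least \<open>j\<close>
  contains the lowest operator \<open>j\<close> at most once.
\<close>

definition once :: "nat \<Rightarrow> nat list \<Rightarrow> bool" where
  "once j ys \<longleftrightarrow> (\<forall>y\<in>set ys. j < y) \<or>
     (\<exists>a b. ys = a @ [j] @ b \<and> (\<forall>y\<in>set a \<union> set b. j < y))"

lemma tlrel_commute_far': "\<forall>x\<in>set xs. i + 2 \<le> x \<Longrightarrow> tlrel (xs @ [i]) (i # xs)"
proof (induction xs)
  case (Cons x xs)
  have "tlrel ([x] @ xs @ [i]) ([x] @ i # xs)" using Cons by (intro tlrel_congL) auto
  moreover have "tlrel ([x, i] @ xs) ([i, x] @ xs)"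
    using Cons by (intro tlrel_congR tl_comm') auto
  ultimately show ?case by (simp, meson tl_trans)
qed (simp add: tl_refl)

text \<open>In the normal form \<open>a\<close> the index \<open>Suc j\<close> occurs at most once,
  and all other indices commute with \<open>j\<close>. The outer copies of \<open>j\<close> can thus
  be moved until they meet or enclose just \<open>Suc j\<close>; both \<open>[j, j]\<close> and
  \<open>[j, Suc j, j]\<close> collapse to a single \<open>j\<close>, which then moves to the right
  end.\<close>

lemma tlrel_sandwich:
  assumes "once (Suc j) a"
  shows "\<exists>b. tlrel (j # a @ [j]) (b @ [j]) \<and> (\<forall>y\<in>set b. Suc j < y) \<and> set b \<subseteq> set a"
proof -
  from assms consider "\<forall>y\<in>set a. Suc j < y"
    | c d where "a = c @ [Suc j] @ d" "\<forall>y\<in>set c \<union> set d. Suc j < y"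
    unfolding once_def by blast
  then show ?thesis
  proof cases
    case 1
    have "tlrel ((j # a) @ [j]) ((a @ [j]) @ [j])"
      using 1 by (intro tlrel_congR tlrel_commute_far) auto
    moreover have "tlrel (a @ [j, j]) (a @ [j])" by (intro tlrel_congL tl_idem)
    ultimately have "tlrel (j # a @ [j]) (a @ [j])" by (simp, meson tl_trans)
    with 1 show ?thesis by (intro exI[of _ a]) auto
  next
    case 2
    have c: "\<forall>y\<in>set c. j + 2 \<le> y" and d: "\<forall>y\<in>set d. j + 2 \<le> y"
      using 2(2) by (simp_all add: Suc_le_eq)
    have "tlrel ((j # c) @ [Suc j] @ d @ [j]) ((c @ [j]) @ [Suc j] @ d @ [j])"
      by (intro tlrel_congR tlrel_commute_far c)
    moreover have "tlrel ((c @ [j, Suc j]) @ d @ [j]) ((c @ [j, Suc j]) @ j # d)"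
      by (intro tlrel_congL tlrel_commute_far' d)
    moreover have "tlrel (c @ [j, Suc j, j] @ d) (c @ [j] @ d)"
      by (intro tl_cong tl_braid1)
    moreover have "tlrel (c @ j # d) (c @ d @ [j])"
      by (intro tlrel_congL tlrel_commute_far d)
    ultimately have "tlrel (j # a @ [j]) ((c @ d) @ [j])"
      unfolding 2 by (simp, meson tl_trans)
    with 2 show ?thesis by (intro exI[of _ "c @ d"]) auto
  qed
qed

text \<open>Outer induction on the number \<open>d\<close> of admissible indices, inner induction on
  the word. Putting \<open>j\<close> in front of a normal form \<open>a @ [j] @ b\<close> gives two
  copies of \<open>j\<close> around \<open>a\<close>; the outer hypothesis normalizes
  \<open>a\<close> with respect to \<open>Suc j\<close>, after which \<open>tlrel_sandwich\<close>
  removes one copy.\<close>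

lemma tlrel_once:
  "\<forall>x\<in>set xs. j \<le> x \<and> x < j + d \<Longrightarrow> \<exists>ys. tlrel xs ys \<and> once j ys \<and> set ys \<subseteq> set xs"
proof (induction d arbitrary: j xs)
  case 0
  then have "xs = []" by (cases xs) auto
  then show ?case by (intro exI[of _ "[]"]) (auto simp: once_def intro: tl_refl)
next
  case (Suc d)
  show ?case
    using Suc.prems
  proof (induction xs)
    case Nil
    then show ?case by (intro exI[of _ "[]"]) (auto simp: once_def intro: tl_refl)
  next
    case (Cons x xs)
    then obtain ys where ys: "tlrel xs ys" "once j ys" "set ys \<subseteq> set xs" by auto
    have *: "tlrel (x # xs) (x # ys)" using tlrel_congL[OF ys(1), of "[x]"] by simp
    consider "\<forall>y\<in>set ys. j < y" | a b where "ys = a @ [j] @ b" "\<forall>y\<in>set a \<union> set b. j < y"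
      using ys(2) unfolding once_def by blast
    then show ?case
    proof cases
      case 1
      have "once j (x # ys)"
      proof (cases "x = j")
        case True
        with 1 show ?thesis unfolding once_def by (intro disjI2 exI[of _ "[]"] exI[of _ ys]) auto
      next
        case False
        then show ?thesis using 1 Cons.prems unfolding once_def by auto
      qed
      then show ?thesis using * ys by (intro exI[of _ "x # ys"]) auto
    next
      case 2
      show ?thesis
      proof (cases "x = j")
        case True
        have "\<forall>x\<in>set a. Suc j \<le> x \<and> x < Suc j + d"
          using 2 Cons.prems ys(3) by (auto simp: Suc_le_eq)
        from Suc.IH[OF this] obtain a' where a': "tlrel a a'" "once (Suc j) a'" "set a' \<subseteq> set a"
          by blast
        from tlrel_sandwich[OF a'(2)] obtain c where
          c: "tlrel (j # a' @ [j]) (c @ [j])" "\<forall>y\<in>set c. Suc j < y" "set c \<subseteq> set a'" by blast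
        have "tlrel (x # ys) ((j # a' @ [j]) @ b)"
          using tl_cong[OF a'(1), of "[j]" "[j] @ b"] 2(1) True by simp
        from tl_trans[OF tl_trans[OF * this] tlrel_congR[OF c(1)]]
        have "tlrel (x # xs) (c @ [j] @ b)" by simp
        moreover have "once j (c @ [j] @ b)" using c(2) 2 unfolding once_def
          by (intro disjI2 exI[of _ c] exI[of _ b]) auto
        ultimately show ?thesis
          using c(3) a'(3) 2 ys(3) True by (intro exI[of _ "c @ [j] @ b"]) auto
      next
        case False
        then have "once j (x # ys)" using 2 Cons.prems unfolding once_def
          by (intro disjI2 exI[of _ "x # a"] exI[of _ b]) auto
        then show ?thesis using * ys by (intro exI[of _ "x # ys"]) auto
      qed
    qed
  qed
qed

text \<open>Normalizing \<open>xs\<close> leaves at most one inner \<open>0\<close>, which splits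
  the product into at most two sandwiches; each of them frees its left part of the indices 0 and 1.
  Indices from 2 on act behind the first letter, so shifting them down by 2 gives operators on the
  remaining letters.\<close>

lemma tlrel_compress:
  "\<exists>zs. tlrel (0 # xs @ [0]) (map (\<lambda>z. z + 2) zs @ [0])"
proof -
  have positive: "\<exists>b. tlrel (0 # a @ [0]) (b @ [0]) \<and> (\<forall>y\<in>set b. 1 < y)" if "\<forall>y\<in>set a. 0 < y" for a
  proof -
    \<comment> \<open>Any upper bound for the indices serves in \<open>tlrel_once\<close>; the sum
      of the list is one.\<close>
    have "\<forall>x\<in>set a. 1 \<le> x \<and> x < 1 + Suc (sum_list a)"
      using that by (auto simp: Suc_le_eq less_Suc_eq_le intro: le_SucI member_le_sum_list)
    from tlrel_once[OF this] obtain a' where a': "tlrel a a'" "once 1 a'" by blast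
    have "tlrel (0 # a @ [0]) (0 # a' @ [0])" using tl_cong[OF a'(1), of "[0]" "[0]"] by simp
    from tlrel_sandwich[of 0 a'] a'(2) obtain b
      where b: "tlrel (0 # a' @ [0]) (b @ [0])" "\<forall>y\<in>set b. 1 < y" by auto
    then show ?thesis
      using tl_trans[OF \<open>tlrel (0 # a @ [0]) (0 # a' @ [0])\<close> b(1)] by blast
  qed
  have "\<forall>x\<in>set xs. 0 \<le> x \<and> x < 0 + Suc (sum_list xs)"
    by (auto simp: less_Suc_eq_le intro: member_le_sum_list)
  from tlrel_once[OF this] obtain ys where ys: "tlrel xs ys" "once 0 ys" by blast
  have *: "tlrel (0 # xs @ [0]) (0 # ys @ [0])" using tl_cong[OF ys(1), of "[0]" "[0]"] by simp
  from ys(2) consider "\<forall>y\<in>set ys. 0 < y"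
    | a b where "ys = a @ [0] @ b" "\<forall>y\<in>set a \<union> set b. 0 < y"
    unfolding once_def by blast
  then have "\<exists>b. tlrel (0 # ys @ [0]) (b @ [0]) \<and> (\<forall>y\<in>set b. 1 < y)"
  proof cases
    case 1
    then show ?thesis by (rule positive)
  next
    case 2
    obtain a' where a': "tlrel (0 # a @ [0]) (a' @ [0])" "\<forall>y\<in>set a'. 1 < y"
      using positive[of a] 2 by auto
    obtain b' where b': "tlrel (0 # b @ [0]) (b' @ [0])" "\<forall>y\<in>set b'. 1 < y"
      using positive[of b] 2 by auto
    \<comment> \<open>The \<open>0\<close> at the end of the first compressed half is the left end
      of the second sandwich.\<close>
    have "tlrel (0 # ys @ [0]) (a' @ 0 # b @ [0])"
      using tlrel_congR[OF a'(1), of "b @ [0]"] 2(1) by simp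
    from tl_trans[OF this tlrel_congL[OF b'(1)]]
    have "tlrel (0 # ys @ [0]) ((a' @ b') @ [0])" by simp
    then show ?thesis using a'(2) b'(2) by (intro exI[of _ "a' @ b'"]) auto
  qed
  then obtain b where b: "tlrel (0 # ys @ [0]) (b @ [0])" "\<forall>y\<in>set b. 1 < y" by blast
  define b' where "b' = map (\<lambda>y. y - 2) b"
  have "map (\<lambda>z. z + 2) b' = map (\<lambda>y. y) b"
    unfolding b'_def map_map using b(2) by (intro map_cong) auto
  then have b': "map (\<lambda>z. z + 2) b' = b" by simp
  show ?thesis
    by (rule exI[of _ b'], subst b', rule tl_trans[OF * b(1)])
qed

lemma tlact_shift: "tlact n (map (\<lambda>z. z + 2) zs) g (x # I) = tlact n zs (\<lambda>K. g (x # K)) I"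
proof (induction zs arbitrary: I)
  case (Cons z zs)
  then have "(\<lambda>K. tlact n (map (\<lambda>z. z + 2) zs) g (x # K)) = tlact n zs (\<lambda>K. g (x # K))"
    by blast
  then show ?case by simp
qed simp

text \<open>On these basis vectors a product of operators shows its columns:
  \<open>tlact n xs (unit_at M) L\<close> is the matrix entry in row \<open>L\<close> and column
  \<open>M\<close>.\<close>

definition unit_at :: "nat list \<Rightarrow> nat list \<Rightarrow> complex" where
  "unit_at K I = (if I = K then 1 else 0)"

text \<open>Summing an entry over both first letters places the product between two copies of the
  operator of index 0, so \<open>tlrel_compress\<close> applies. This carries the span of the
  operator products from degree \<open>Suc k\<close> down to degree \<open>k\<close>.\<close>

lemma tlact_compress:
  "\<exists>c zs. \<forall>I\<in>words_over n k. \<forall>K\<in>words_over n k.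
     (\<Sum>x=1..n. \<Sum>z=1..n. tlact n xs (unit_at (z # K)) (x # I)) = c * tlact n zs (unit_at K) I"
proof (cases "n = 0")
  case True
  then show ?thesis by (intro exI[of _ 0]) auto
next
  case False
  obtain zs where zs: "tlrel (0 # xs @ [0]) (map (\<lambda>z. z + 2) zs @ [0])"
    using tlrel_compress by blast
  obtain c where c: "\<And>g I. I \<in> words_over n (Suc k) \<Longrightarrow>
      tlact n (0 # xs @ [0]) g I = c * tlact n (map (\<lambda>z. z + 2) zs @ [0]) g I"
    using tlrel_sound[OF zs] by blast
  show ?thesis
  proof (intro exI[of _ c] exI[of _ zs] ballI)
    fix I K assume IK: "I \<in> words_over n k" "K \<in> words_over n k"
    \<comment> \<open>Both sides equal \<open>unit_at K\<close> at the tail of \<open>L\<close>; the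
      letter 1 on the right is an arbitrary representative, available because \<open>n\<close> is
      not 0.\<close>
    have h: "(\<Sum>z=1..n. unit_at (z # K) L) = tlop n 0 (unit_at (1 # K)) L"
      if "L \<in> words_over n (Suc k)" for L
    proof -
      from that obtain x L' where L: "L = x # L'" "x \<in> {1..n}" by (auto simp: words_over_Suc)
      have "(\<Sum>z=1..n. unit_at (z # K) L) = (\<Sum>z=1..n. if z = x then unit_at K L' else 0)"
        by (intro sum.cong) (auto simp: unit_at_def L)
      moreover have "(\<Sum>z=1..n. unit_at (1 # K) (z # L')) = (\<Sum>z=1..n. if z = 1 then unit_at K L' else 0)"
        by (intro sum.cong) (auto simp: unit_at_def)
      ultimately show ?thesis using L False by simp
    qed
    have "(\<Sum>x=1..n. \<Sum>z=1..n. tlact n xs (unit_at (z # K)) (x # I))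
        = (\<Sum>x=1..n. tlact n xs (\<lambda>L. \<Sum>z=1..n. unit_at (z # K) L) (x # I))"
      by (simp add: tlact_sum[where c = "\<lambda>_. 1", simplified])
    also have "\<dots> = (\<Sum>x=1..n. tlact n xs (tlop n 0 (unit_at (1 # K))) (x # I))"
    proof (rule sum.cong[OF refl])
      fix x assume "x \<in> {1..n}"
      then have x: "x # I \<in> words_over n (Suc k)" using IK by simp
      show "tlact n xs (\<lambda>L. \<Sum>z=1..n. unit_at (z # K) L) (x # I)
          = tlact n xs (tlop n 0 (unit_at (1 # K))) (x # I)"
        by (rule tlact_cong[OF x h])
    qed
    also have "\<dots> = tlact n (0 # xs @ [0]) (unit_at (1 # K)) (1 # I)" by simp
    also have "\<dots> = c * tlact n (map (\<lambda>z. z + 2) zs @ [0]) (unit_at (1 # K)) (1 # I)"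
      using IK False by (intro c) auto
    also have "tlact n (map (\<lambda>z. z + 2) zs @ [0]) (unit_at (1 # K)) (1 # I)
        = tlact n zs (\<lambda>L. tlop n 0 (unit_at (1 # K)) (1 # L)) I"
      by (simp only: tlact_simps tlact_shift)
    also have "\<dots> = tlact n zs (unit_at K) I"
    proof (rule tlact_cong[OF IK(1)])
      fix L
      have "tlop n 0 (unit_at (1 # K)) (1 # L) = (\<Sum>z=1..n. if z = 1 then unit_at K L else 0)"
        unfolding tlop.simps by (intro sum.cong) (auto simp: unit_at_def)
      then show "tlop n 0 (unit_at (1 # K)) (1 # L) = unit_at K L" using False by simp
    qed
    finally show "(\<Sum>x=1..n. \<Sum>z=1..n. tlact n xs (unit_at (z # K)) (x # I))
        = c * tlact n zs (unit_at K) I" .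
  qed
qed

section \<open>The commutant of the Temperley-Lieb operators\<close>

text \<open>An element of the span of the operator products, listed by coefficients and products and
  read as a matrix with row \<open>L\<close> and column \<open>M\<close>.\<close>

definition tl_comb :: "nat \<Rightarrow> (complex \<times> nat list) list \<Rightarrow> nat list \<Rightarrow> nat list \<Rightarrow> complex" where
  "tl_comb n ms L M = (\<Sum>(c, xs)\<leftarrow>ms. c * tlact n xs (unit_at M) L)"

lemma tl_comb_simps [simp]:
  "tl_comb n [] L M = 0"
  "tl_comb n ((c, xs) # ms) L M = c * tlact n xs (unit_at M) L + tl_comb n ms L M"
  "tl_comb n (ms @ ms') L M = tl_comb n ms L M + tl_comb n ms' L M"
  by (simp_all add: tl_comb_def)

lemma tl_comb_scale: "tl_comb n (map (\<lambda>(c, xs). (d * c, xs)) ms) L M = d * tl_comb n ms L M"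
  by (induction ms) (auto simp: algebra_simps)

lemma tlop_tl_comb:
  "tlop n i (\<lambda>K. tl_comb n ms K M) L = tl_comb n (map (\<lambda>(c, xs). (c, i # xs)) ms) L M"
proof (induction ms)
  case (Cons a ms)
  obtain c xs where a: "a = (c, xs)" by force
  show ?case
    using tlop_linear[of n i "\<lambda>K. tl_comb n ms K M" c "tlact n xs (unit_at M)" L] Cons
    by (simp add: a add.commute)
qed (simp add: tlop_zero)

lemma tl_comb_compress:
  "\<exists>ms'. \<forall>I\<in>words_over n k. \<forall>K\<in>words_over n k.
     (\<Sum>x=1..n. \<Sum>z=1..n. tl_comb n ms (x # I) (z # K)) = tl_comb n ms' I K"
proof (induction ms)
  case Nil
  show ?case by (intro exI[of _ "[]"]) simp
next
  case (Cons a ms)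
  obtain d xs where a: "a = (d, xs)" by force
  from Cons obtain ms' where ms': "\<forall>I\<in>words_over n k. \<forall>K\<in>words_over n k.
     (\<Sum>x=1..n. \<Sum>z=1..n. tl_comb n ms (x # I) (z # K)) = tl_comb n ms' I K" by blast
  obtain c zs where "\<forall>I\<in>words_over n k. \<forall>K\<in>words_over n k.
     (\<Sum>x=1..n. \<Sum>z=1..n. tlact n xs (unit_at (z # K)) (x # I)) = c * tlact n zs (unit_at K) I"
    using tlact_compress by blast
  with ms' show ?case
    by (intro exI[of _ "(d * c, zs) # ms'"])
       (simp add: a sum.distrib mult.assoc flip: sum_distrib_left)
qed

text \<open>Since the operators are symmetric matrices, multiplying \<open>t\<close> by one of them
  on the right means applying it to the column index. Indices beyond the length of the words give 0
  on both sides, so \<open>i\<close> may range over all numbers.\<close>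

definition tl_commutes :: "nat \<Rightarrow> nat \<Rightarrow> (nat list \<Rightarrow> nat list \<Rightarrow> complex) \<Rightarrow> bool" where
  "tl_commutes n k t \<longleftrightarrow> (\<forall>i. \<forall>I\<in>words_over n k. \<forall>J\<in>words_over n k.
     tlop n i (\<lambda>K. t K J) I = tlop n i (\<lambda>K. t I K) J)"

lemma tlact_tlop_commute_cross:
  "tlop n i (\<lambda>M. tlact n xs (\<lambda>L. t L M) K) J = tlact n xs (\<lambda>L. tlop n i (\<lambda>M. t L M) J) K"
proof (induction xs arbitrary: K)
  case (Cons j xs)
  have "tlop n i (\<lambda>M. tlop n j (\<lambda>K. tlact n xs (\<lambda>L. t L M) K) K) J
      = tlop n j (\<lambda>K. tlop n i (\<lambda>M. tlact n xs (\<lambda>L. t L M) K) J) K"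
    by (rule tlop_tlop_commute_cross)
  then show ?case by (simp add: Cons)
qed simp

text \<open>The operators cross \<open>t\<close> one at a time, which reverses their order.\<close>

lemma tl_commutes_tlact:
  assumes "tl_commutes n k t" "J \<in> words_over n k" "K \<in> words_over n k"
  shows "tlact n (rev xs) (\<lambda>I. t I J) K = tlact n xs (t K) J"
  using assms(2,3)
proof (induction xs arbitrary: J)
  case (Cons i xs)
  have "tlact n (i # xs) (t K) J = tlop n i (\<lambda>M. tlact n (rev xs) (\<lambda>I. t I M) K) J"
    using Cons by (auto intro!: tlop_cong[OF Cons.prems(1)])
  also have "\<dots> = tlact n (rev xs) (\<lambda>I. tlop n i (t I) J) K"
    by (rule tlact_tlop_commute_cross)
  also have "\<dots> = tlact n (rev xs) (tlop n i (\<lambda>I. t I J)) K"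
    by (rule tlact_cong[OF Cons.prems(2)])
       (use assms(1) Cons.prems in \<open>auto simp: tl_commutes_def\<close>)
  finally show ?case by simp
qed simp

text \<open>Transposing a product of symmetric operators reverses it, so \<open>t\<close> also
  commutes with transposes of combinations; the order of the indices in the two sums is that of the
  transpose.\<close>

lemma tl_commutes_tl_comb:
  assumes "tl_commutes n k t" "J \<in> words_over n k" "K \<in> words_over n k"
  shows "(\<Sum>I\<in>words_over n k. tl_comb n ms I K * t I J) = (\<Sum>I\<in>words_over n k. t K I * tl_comb n ms J I)"
proof (induction ms)
  case (Cons a ms)
  obtain c xs where a: "a = (c, xs)" by force
  have "(\<Sum>I\<in>words_over n k. tlact n xs (unit_at K) I * t I J)
      = (\<Sum>I\<in>words_over n k. unit_at K I * tlact n (rev xs) (\<lambda>I. t I J) I)"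
    by (rule tlact_selfadjoint)
  also have "\<dots> = (\<Sum>I\<in>words_over n k. if I = K then tlact n (rev xs) (\<lambda>I. t I J) K else 0)"
    by (intro sum.cong) (auto simp: unit_at_def)
  also have "\<dots> = tlact n xs (t K) J" using assms by (simp add: tl_commutes_tlact)
  also have "\<dots> = tlact n xs (\<lambda>L. \<Sum>I\<in>words_over n k. t K I * unit_at I L) J"
  proof (rule tlact_cong[OF assms(2)])
    fix L assume L: "L \<in> words_over n k"
    have "(\<Sum>I\<in>words_over n k. t K I * unit_at I L) = (\<Sum>I\<in>words_over n k. if I = L then t K L else 0)"
      by (intro sum.cong) (auto simp: unit_at_def)
    then show "t K L = (\<Sum>I\<in>words_over n k. t K I * unit_at I L)" using L by simp
  qed
  also have "\<dots> = (\<Sum>I\<in>words_over n k. t K I * tlact n xs (unit_at I) J)"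
    by (rule tlact_sum) simp
  finally have "(\<Sum>I\<in>words_over n k. c * tlact n xs (unit_at K) I * t I J)
      = (\<Sum>I\<in>words_over n k. t K I * (c * tlact n xs (unit_at I) J))"
    by (simp add: mult.left_commute mult.assoc flip: sum_distrib_left)
  with Cons show ?case by (simp add: a sum.distrib distrib_left distrib_right)
qed simp

lemma tl_commutes_cnj: "tl_commutes n k t \<Longrightarrow> tl_commutes n k (\<lambda>I J. cnj (t I J))"
  unfolding tl_commutes_def by (simp add: tlop_cnj)

text \<open>
  The operators are self-adjoint and preserve the span of \<open>B\<close>, so expanding \<open>e b\<close> in the
  orthonormal basis moves \<open>e\<close> from the left factor to the right one.
\<close>

lemma tl_averaging:
  assumes "finite B" and B: "\<And>b. b \<in> B \<Longrightarrow> \<exists>ms. b = (\<lambda>(L, M). tl_comb n ms L M)"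
  and orth: "\<And>b b'. b \<in> B \<Longrightarrow> b' \<in> B \<Longrightarrow>
    (\<Sum>(L, M)\<in>words_over n k \<times> words_over n k. b (L, M) * cnj (b' (L, M))) = (if b = b' then 1 else 0)"
  and span: "\<And>ms L M. L \<in> words_over n k \<Longrightarrow> M \<in> words_over n k \<Longrightarrow> tl_comb n ms L M =
    (\<Sum>b\<in>B. (\<Sum>(L, M)\<in>words_over n k \<times> words_over n k. tl_comb n ms L M * cnj (b (L, M))) * b (L, M))"
  shows "tl_commutes n k (\<lambda>L M. \<Sum>b\<in>B. \<Sum>L'\<in>words_over n k. \<Sum>M'\<in>words_over n k.
           b (L, L') * \<tau> L' M' * cnj (b (M, M')))"
proof -
  define W where "W = words_over n k"
  have fW [simp]: "finite W" by (simp add: W_def)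
  \<comment> \<open>The matrix product of \<open>b\<close>, \<open>\<tau>\<close> and the adjoint of
    \<open>b'\<close>; the average is the sum of the cases \<open>b = b'\<close>.\<close>
  define S where "S b b' L M = (\<Sum>L'\<in>W. \<Sum>M'\<in>W. b (L, L') * \<tau> L' M' * cnj (b' (M, M')))"
    for b b' :: "nat list \<times> nat list \<Rightarrow> complex" and L M
  define ip where "ip f g = (\<Sum>(L, M)\<in>W \<times> W. f (L, M) * cnj (g (L, M)))"
    for f g :: "nat list \<times> nat list \<Rightarrow> complex"
  define e where "e i b = (\<lambda>(L, M). tlop n i (\<lambda>K. b (K, M)) L)"
    for i and b :: "nat list \<times> nat list \<Rightarrow> complex"
  have ip_e: "ip (e i f) g = ip f (e i g)" for i f g
  proof -
    have "ip (e i f) g = (\<Sum>M\<in>W. \<Sum>L\<in>W. tlop n i (\<lambda>K. f (K, M)) L * cnj (g (L, M)))"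
      unfolding ip_def sum.cartesian_product[symmetric] e_def by (subst sum.swap) simp
    also have "\<dots> = (\<Sum>M\<in>W. \<Sum>L\<in>W. f (L, M) * tlop n i (\<lambda>K. cnj (g (K, M))) L)"
      unfolding W_def by (simp add: tlop_selfadjoint)
    also have "\<dots> = ip f (e i g)"
      unfolding ip_def sum.cartesian_product[symmetric] e_def
      by (subst (2) sum.swap) (simp add: tlop_cnj)
    finally show ?thesis .
  qed
  \<comment> \<open>Multiplying a combination by an operator prepends its index to every product, so
    the result stays in the span of \<open>B\<close>.\<close>
  have e_exp: "e i b (L, M) = (\<Sum>b'\<in>B. ip (e i b) b' * b' (L, M))"
    if b: "b \<in> B" and LM: "L \<in> W" "M \<in> W" for i b L M
  proof -
    obtain ms where ms: "b = (\<lambda>(L, M). tl_comb n ms L M)" using B[OF b] by blast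
    have "e i b = (\<lambda>(L, M). tl_comb n (map (\<lambda>(c, xs). (c, i # xs)) ms) L M)"
      unfolding e_def ms by (simp add: tlop_tl_comb)
    then show ?thesis using span[of L M "map (\<lambda>(c, xs). (c, i # xs)) ms"] LM
      unfolding ip_def W_def by simp
  qed
  have ip_cnj: "cnj (ip f g) = ip g f" for f g
    unfolding ip_def by (auto simp: mult.commute intro!: sum.cong)
  have "tlop n i (\<lambda>K. \<Sum>b\<in>B. S b b K M) L = tlop n i (\<lambda>K. \<Sum>b\<in>B. S b b L K) M"
    if L: "L \<in> W" and M: "M \<in> W" for i L M
  proof -
    have left: "tlop n i (\<lambda>K. S b b K M) L = (\<Sum>b'\<in>B. ip (e i b) b' * S b' b L M)" if b: "b \<in> B" for b
    proof -
      have "tlop n i (\<lambda>K. S b b K M) L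
          = tlop n i (\<lambda>K. \<Sum>L'\<in>W. (\<Sum>M'\<in>W. \<tau> L' M' * cnj (b (M, M'))) * b (K, L')) L"
        unfolding S_def by (simp add: sum_distrib_left sum_distrib_right mult_ac)
      also have "\<dots> = (\<Sum>L'\<in>W. (\<Sum>M'\<in>W. \<tau> L' M' * cnj (b (M, M'))) * e i b (L, L'))"
        by (simp add: tlop_sum e_def)
      also have "\<dots> = (\<Sum>L'\<in>W. (\<Sum>M'\<in>W. \<tau> L' M' * cnj (b (M, M'))) * (\<Sum>b'\<in>B. ip (e i b) b' * b' (L, L')))"
        using e_exp b L by (intro sum.cong) auto
      also have "\<dots> = (\<Sum>L'\<in>W. \<Sum>b'\<in>B. ip (e i b) b' * (\<Sum>M'\<in>W. b' (L, L') * \<tau> L' M' * cnj (b (M, M'))))"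
        by (simp add: sum_distrib_left sum_distrib_right mult_ac)
      also have "\<dots> = (\<Sum>b'\<in>B. \<Sum>L'\<in>W. ip (e i b) b' * (\<Sum>M'\<in>W. b' (L, L') * \<tau> L' M' * cnj (b (M, M'))))"
        by (rule sum.swap)
      finally show ?thesis unfolding S_def by (simp add: sum_distrib_left)
    qed
    have right: "tlop n i (\<lambda>K. S b b L K) M = (\<Sum>b'\<in>B. cnj (ip (e i b) b') * S b b' L M)" if b: "b \<in> B" for b
    proof -
      have "tlop n i (\<lambda>K. S b b L K) M
          = tlop n i (\<lambda>K. \<Sum>M'\<in>W. (\<Sum>L'\<in>W. b (L, L') * \<tau> L' M') * cnj (b (K, M'))) M"
        unfolding S_def by (subst sum.swap) (simp add: sum_distrib_left sum_distrib_right mult_ac)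
      also have "\<dots> = (\<Sum>M'\<in>W. (\<Sum>L'\<in>W. b (L, L') * \<tau> L' M') * cnj (e i b (M, M')))"
        by (simp add: tlop_sum e_def tlop_cnj)
      also have "\<dots> = (\<Sum>M'\<in>W. (\<Sum>L'\<in>W. b (L, L') * \<tau> L' M') * cnj (\<Sum>b'\<in>B. ip (e i b) b' * b' (M, M')))"
        using e_exp b M by (intro sum.cong) auto
      also have "\<dots> = (\<Sum>M'\<in>W. \<Sum>b'\<in>B. cnj (ip (e i b) b') * (\<Sum>L'\<in>W. b (L, L') * \<tau> L' M' * cnj (b' (M, M'))))"
        by (simp add: sum_distrib_left sum_distrib_right mult_ac)
      also have "\<dots> = (\<Sum>b'\<in>B. \<Sum>M'\<in>W. cnj (ip (e i b) b') * (\<Sum>L'\<in>W. b (L, L') * \<tau> L' M' * cnj (b' (M, M'))))"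
        by (rule sum.swap)
      also have "\<dots> = (\<Sum>b'\<in>B. cnj (ip (e i b) b') * (\<Sum>M'\<in>W. \<Sum>L'\<in>W. b (L, L') * \<tau> L' M' * cnj (b' (M, M'))))"
        by (simp add: sum_distrib_left)
      finally show ?thesis unfolding S_def by (subst sum.swap)
    qed
    have "tlop n i (\<lambda>K. \<Sum>b\<in>B. S b b K M) L = (\<Sum>b\<in>B. \<Sum>b'\<in>B. ip (e i b) b' * S b' b L M)"
      using tlop_sum[OF \<open>finite B\<close>, of n i "\<lambda>_. 1" "\<lambda>b K. S b b K M" L] by (simp add: left)
    also have "\<dots> = (\<Sum>b'\<in>B. \<Sum>b\<in>B. ip (e i b) b' * S b' b L M)" by (rule sum.swap)
    \<comment> \<open>Self-adjointness makes the coefficient matrix \<open>ip (e i b) b'\<close>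
      Hermitian, which turns the double sum of the left action into that of the right
      action.\<close>
    also have "\<dots> = (\<Sum>b'\<in>B. \<Sum>b\<in>B. cnj (ip (e i b') b) * S b' b L M)"
      by (simp add: ip_cnj ip_e)
    also have "\<dots> = tlop n i (\<lambda>K. \<Sum>b\<in>B. S b b L K) M"
      using tlop_sum[OF \<open>finite B\<close>, of n i "\<lambda>_. 1" "\<lambda>b K. S b b L K" M] by (simp add: right)
    finally show ?thesis .
  qed
  then show ?thesis unfolding tl_commutes_def S_def W_def by blast
qed

text \<open>Used below to carry the sums over first letters into the two outer factors of the
  average.\<close>

lemma sum_separate_bilinear:
  fixes \<tau> :: "'c \<Rightarrow> 'd \<Rightarrow> complex"
  shows "(\<Sum>x\<in>A. \<Sum>y\<in>B. \<Sum>K\<in>C. \<Sum>L\<in>D. f x K * \<tau> K L * g y L)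
    = (\<Sum>K\<in>C. \<Sum>L\<in>D. (\<Sum>x\<in>A. f x K) * \<tau> K L * (\<Sum>y\<in>B. g y L))"
proof -
  have "(\<Sum>x\<in>A. \<Sum>y\<in>B. \<Sum>K\<in>C. \<Sum>L\<in>D. f x K * \<tau> K L * g y L)
      = (\<Sum>(x, y)\<in>A \<times> B. \<Sum>(K, L)\<in>C \<times> D. f x K * \<tau> K L * g y L)"
    by (simp flip: sum.cartesian_product)
  also have "\<dots> = (\<Sum>(K, L)\<in>C \<times> D. \<Sum>(x, y)\<in>A \<times> B. f x K * \<tau> K L * g y L)"
    unfolding case_prod_unfold by (rule sum.swap)
  also have "\<dots> = (\<Sum>(K, L)\<in>C \<times> D. (\<Sum>x\<in>A. f x K) * \<tau> K L * (\<Sum>y\<in>B. g y L))"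
    by (simp add: sum_distrib_left sum_distrib_right flip: sum.cartesian_product)
       (simp add: sum.swap[of _ B A])
  finally show ?thesis by (simp add: sum.cartesian_product)
qed

text \<open>By \<open>ann\<close>, the tensor product of the all-one matrix in the first letter with
  \<open>t\<close> pairs to 0 with every matrix commuting in degree \<open>Suc k\<close>. Testing
  this on a single average built from \<open>cnj t\<close> leaves a sum of squared moduli.\<close>

lemma tl_commutes_vanish:
  assumes n: "n \<ge> 1" and t: "tl_commutes n k t"
  and ann: "\<And>C. tl_commutes n (Suc k) C \<Longrightarrow>
    (\<Sum>I\<in>words_over n k. \<Sum>J\<in>words_over n k. t I J * (\<Sum>x=1..n. \<Sum>y=1..n. C (x # I) (y # J))) = 0"
  and JK: "K \<in> words_over n k" "J \<in> words_over n k"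
  shows "t K J = 0"
proof -
  define W where "W = words_over n k"
  define W' where "W' = words_over n (Suc k)"
  have fW [simp]: "finite W" "finite W'" by (simp_all add: W_def W'_def)
  define V where "V = {X. \<exists>ms. X = (\<lambda>(L, M). tl_comb n ms L M)}"
  have "(\<lambda>_. 0) \<in> V" unfolding V_def by (auto intro!: exI[of _ "[]"])
  moreover have "(\<lambda>i. f i + c * g i) \<in> V" if "f \<in> V" "g \<in> V" for f g c
  proof -
    from that obtain ms ms' where
      "f = (\<lambda>(L, M). tl_comb n ms L M)" "g = (\<lambda>(L, M). tl_comb n ms' L M)"
      unfolding V_def by auto
    then show ?thesis unfolding V_def
      by (auto simp: fun_eq_iff tl_comb_scale intro!: exI[of _ "ms @ map (\<lambda>(d, xs). (c * d, xs)) ms'"])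
  qed
  ultimately obtain B where B: "B \<subseteq> V" "finite B"
    and orth: "\<forall>b\<in>B. \<forall>b'\<in>B. (\<Sum>i\<in>W' \<times> W'. b i * cnj (b' i)) = (if b = b' then 1 else 0)"
    and span: "\<forall>v\<in>V. \<forall>i\<in>W' \<times> W'. v i = (\<Sum>b\<in>B. (\<Sum>j\<in>W' \<times> W'. v j * cnj (b j)) * b i)"
    using orthonormal_basis_exists[of "W' \<times> W'" V] by auto
  \<comment> \<open>The average of the all-one matrix tensor \<open>cnj t\<close>: dropping first
    letters by \<open>tl\<close> makes the middle factor constant in them.\<close>
  define C where "C L M = (\<Sum>b\<in>B. \<Sum>L'\<in>W'. \<Sum>M'\<in>W'.
      b (L, L') * cnj (t (tl L') (tl M')) * cnj (b (M, M')))" for L M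
  have C: "tl_commutes n (Suc k) C"
    unfolding C_def W'_def
  proof (rule tl_averaging[OF B(2)])
    show "\<exists>ms. b = (\<lambda>(L, M). tl_comb n ms L M)" if "b \<in> B" for b
      using B(1) that unfolding V_def by blast
    show "(\<Sum>(L, M)\<in>words_over n (Suc k) \<times> words_over n (Suc k). b (L, M) * cnj (b' (L, M)))
        = (if b = b' then 1 else 0)" if "b \<in> B" "b' \<in> B" for b b'
      using orth that unfolding W'_def by (simp add: case_prod_beta')
    show "tl_comb n ms L M = (\<Sum>b\<in>B. (\<Sum>(L, M)\<in>words_over n (Suc k) \<times> words_over n (Suc k).
        tl_comb n ms L M * cnj (b (L, M))) * b (L, M))"
      if "L \<in> words_over n (Suc k)" "M \<in> words_over n (Suc k)" for ms L M
    proof -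
      have "(\<lambda>(L, M). tl_comb n ms L M) \<in> V" unfolding V_def by blast
      from bspec[OF bspec[OF span this], of "(L, M)"] that show ?thesis
        unfolding W'_def by (simp add: case_prod_beta')
    qed
  qed
  \<comment> \<open>The compression of \<open>b\<close> to degree \<open>k\<close>. By
    \<open>tl_comb_compress\<close> it is again a combination of operator products, which lets
    \<open>slide\<close> move it past \<open>t\<close>.\<close>
  define y where "y b I K = (\<Sum>x=1..n. \<Sum>z=1..n. b (x # I, z # K))"
    for b :: "nat list \<times> nat list \<Rightarrow> complex" and I K
  define Z where "Z b J K = (\<Sum>I\<in>W. t K I * y b J I)" for b J K
  have C_compress: "(\<Sum>x=1..n. \<Sum>y=1..n. C (x # I) (y # J))
      = (\<Sum>b\<in>B. \<Sum>K\<in>W. \<Sum>L\<in>W. y b I K * cnj (t K L) * cnj (y b J L))" for I J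
  proof -
    define A where "A b L K = (\<Sum>z=1..n. b (L, z # K))"
      for b :: "nat list \<times> nat list \<Rightarrow> complex" and L K
    have "C L M = (\<Sum>b\<in>B. \<Sum>z=1..n. \<Sum>w=1..n. \<Sum>K\<in>W. \<Sum>N\<in>W.
        b (L, z # K) * cnj (t K N) * cnj (b (M, w # N)))" for L M
      unfolding C_def W'_def W_def sum_words_over_Suc
      by (intro sum.cong refl) (simp add: sum.swap[of _ "{1..n}" "words_over n k"] del: One_nat_def)
    then have C: "C L M = (\<Sum>b\<in>B. \<Sum>K\<in>W. \<Sum>N\<in>W. A b L K * cnj (t K N) * cnj (A b M N))" for L M
      by (simp add: sum_separate_bilinear A_def)
    have "(\<Sum>x=1..n. \<Sum>y=1..n. C (x # I) (y # J))
      = (\<Sum>b\<in>B. \<Sum>x=1..n. \<Sum>y=1..n. \<Sum>K\<in>W. \<Sum>N\<in>W. A b (x # I) K * cnj (t K N) * cnj (A b (y # J) N))"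
      unfolding C by (simp add: sum.swap[of _ "{1..n}" B] del: One_nat_def)
    then show ?thesis by (simp add: sum_separate_bilinear A_def y_def)
  qed
  have slide: "(\<Sum>I\<in>W. y b I K * t I J) = Z b J K" if b: "b \<in> B" and JK: "J \<in> W" "K \<in> W" for b J K
  proof -
    obtain ms where "b = (\<lambda>(L, M). tl_comb n ms L M)" using B(1) b unfolding V_def by blast
    then obtain ms' where ms': "\<forall>I\<in>W. \<forall>K\<in>W. y b I K = tl_comb n ms' I K"
      using tl_comb_compress[of n k ms] unfolding y_def W_def by auto
    then show ?thesis
      using tl_commutes_tl_comb[OF t, of J K ms'] JK unfolding W_def Z_def by simp
  qed
  \<comment> \<open>The factor \<open>t\<close> slides past \<open>y b\<close> and gives
    \<open>Z b\<close>; the factors \<open>cnj t\<close> and \<open>cnj (y b)\<close> give the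
    conjugate of the same \<open>Z b\<close>.\<close>
  have "(\<Sum>I\<in>W. \<Sum>J\<in>W. t I J * (\<Sum>b\<in>B. \<Sum>K\<in>W. \<Sum>L\<in>W. y b I K * cnj (t K L) * cnj (y b J L)))
      = (\<Sum>b\<in>B. \<Sum>J\<in>W. \<Sum>K\<in>W. Z b J K * cnj (Z b J K))"
  proof -
    have "(\<Sum>I\<in>W. \<Sum>J\<in>W. t I J * (\<Sum>b\<in>B. \<Sum>K\<in>W. \<Sum>L\<in>W. y b I K * cnj (t K L) * cnj (y b J L)))
        = (\<Sum>I\<in>W. \<Sum>J\<in>W. \<Sum>b\<in>B. \<Sum>K\<in>W. (y b I K * t I J) * cnj (Z b J K))"
      unfolding Z_def by (simp add: sum_distrib_left mult_ac)
    also have "\<dots> = (\<Sum>b\<in>B. \<Sum>I\<in>W. \<Sum>J\<in>W. \<Sum>K\<in>W. (y b I K * t I J) * cnj (Z b J K))"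
      by (simp only: sum.swap[of _ W B])
    also have "\<dots> = (\<Sum>b\<in>B. \<Sum>J\<in>W. \<Sum>I\<in>W. \<Sum>K\<in>W. (y b I K * t I J) * cnj (Z b J K))"
      by (intro sum.cong refl sum.swap)
    also have "\<dots> = (\<Sum>b\<in>B. \<Sum>J\<in>W. \<Sum>K\<in>W. \<Sum>I\<in>W. (y b I K * t I J) * cnj (Z b J K))"
      by (intro sum.cong refl sum.swap)
    also have "\<dots> = (\<Sum>b\<in>B. \<Sum>J\<in>W. \<Sum>K\<in>W. Z b J K * cnj (Z b J K))"
      by (intro sum.cong refl) (simp add: slide flip: sum_distrib_right)
    finally show ?thesis .
  qed
  with ann[OF C] have "(\<Sum>b\<in>B. \<Sum>J\<in>W. \<Sum>K\<in>W. Z b J K * cnj (Z b J K)) = 0"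
    unfolding C_compress W_def by simp
  then have "complex_of_real (\<Sum>b\<in>B. \<Sum>J\<in>W. \<Sum>K\<in>W. (cmod (Z b J K))\<^sup>2) = 0"
    by (simp only: of_real_sum complex_norm_square)
  then have *: "(\<Sum>b\<in>B. \<Sum>J\<in>W. \<Sum>K\<in>W. (cmod (Z b J K))\<^sup>2) = 0" by (simp only: of_real_eq_0_iff)
  have Z0: "Z b J K = 0" if "b \<in> B" "J \<in> W" "K \<in> W" for b J K
  proof -
    have "(\<Sum>J\<in>W. \<Sum>K\<in>W. (cmod (Z b J K))\<^sup>2) = 0"
      using * that(1) B(2) by (simp add: sum_nonneg_eq_0_iff sum_nonneg)
    then have "(\<Sum>K\<in>W. (cmod (Z b J K))\<^sup>2) = 0"
      using that(2) by (simp add: sum_nonneg_eq_0_iff sum_nonneg)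
    then show ?thesis using that(3) by (simp add: sum_nonneg_eq_0_iff)
  qed
  \<comment> \<open>The identity matrix is the empty product and lies in \<open>V\<close>. Its
    compression is \<open>n\<close> times the identity, while expanding it in \<open>B\<close>
    produces a combination of the vanishing \<open>Z b\<close>.\<close>
  have "of_nat n * t K J = (\<Sum>I\<in>W. t K I * (\<Sum>x=1..n. \<Sum>z=1..n. unit_at (z # I) (x # J)))"
  proof -
    have "(\<Sum>x=1..n. \<Sum>z=1..n. unit_at (z # I) (x # J)) = of_nat n * unit_at I J" for I
    proof -
      have "(\<Sum>z=1..n. unit_at (z # I) (x # J)) = (\<Sum>z=1..n. if z = x then unit_at I J else 0)" for x
        by (intro sum.cong) (auto simp: unit_at_def)
      then show ?thesis by simp
    qed
    moreover have "(\<Sum>I\<in>W. t K I * (of_nat n * unit_at I J)) = (\<Sum>I\<in>W. if I = J then of_nat n * t K J else 0)"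
      by (intro sum.cong) (auto simp: unit_at_def)
    ultimately show ?thesis using JK by (simp add: W_def)
  qed
  also have "\<dots> = (\<Sum>I\<in>W. t K I * (\<Sum>b\<in>B.
      (\<Sum>j\<in>W' \<times> W'. (\<lambda>(L, M). tl_comb n [(1, [])] L M) j * cnj (b j)) * y b J I))"
  proof (rule sum.cong[OF refl])
    fix I assume "I \<in> W"
    have unit: "unit_at (z # I) (x # J) = (\<Sum>b\<in>B.
      (\<Sum>j\<in>W' \<times> W'. (\<lambda>(L, M). tl_comb n [(1, [])] L M) j * cnj (b j)) * b (x # J, z # I))"
      if "x \<in> {1..n}" "z \<in> {1..n}" for x z
    proof -
      have "(\<lambda>(L, M). tl_comb n [(1, [])] L M) \<in> V" unfolding V_def by blast
      from bspec[OF bspec[OF span this], of "(x # J, z # I)"] that \<open>I \<in> W\<close> JK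
      show ?thesis unfolding W'_def W_def by simp
    qed
    then have "(\<Sum>x=1..n. \<Sum>z=1..n. unit_at (z # I) (x # J)) = (\<Sum>x=1..n. \<Sum>z=1..n. \<Sum>b\<in>B.
      (\<Sum>j\<in>W' \<times> W'. (\<lambda>(L, M). tl_comb n [(1, [])] L M) j * cnj (b j)) * b (x # J, z # I))"
      by (intro sum.cong refl) (simp only: unit)
    also have "\<dots> = (\<Sum>b\<in>B. (\<Sum>j\<in>W' \<times> W'. (\<lambda>(L, M). tl_comb n [(1, [])] L M) j * cnj (b j)) * y b J I)"
      unfolding y_def sum_distrib_left sum.swap[of _ "{1..n}" B] by (rule refl)
    finally show "t K I * (\<Sum>x=1..n. \<Sum>z=1..n. unit_at (z # I) (x # J)) = t K I * (\<Sum>b\<in>B.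
      (\<Sum>j\<in>W' \<times> W'. (\<lambda>(L, M). tl_comb n [(1, [])] L M) j * cnj (b j)) * y b J I)" by simp
  qed
  also have "\<dots> = (\<Sum>b\<in>B. (\<Sum>j\<in>W' \<times> W'. (\<lambda>(L, M). tl_comb n [(1, [])] L M) j * cnj (b j)) * Z b J K)"
    unfolding Z_def sum_distrib_left sum.swap[of _ W B] by (intro sum.cong refl) (simp only: mult_ac)
  also have "\<dots> = 0" using Z0 JK by (simp add: W_def)
  finally show ?thesis using n by simp
qed

section \<open>The homogeneous relations\<close>

definition gen_list :: "nat \<Rightarrow> (nat \<times> nat) list" where
  "gen_list n = List.product [1..<Suc n] [1..<Suc n]"

lemma set_gen_list [simp]: "set (gen_list n) = generators n"
  by (auto simp: gen_list_def)

definition linear_rel :: "nat \<Rightarrow> nat \<Rightarrow> nat \<Rightarrow> (nat \<times> nat, 'k :: field) terms" where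
  "linear_rel n i j = map (\<lambda>a. (1, [(a, j)])) [1..<Suc n] @ map (\<lambda>b. (- 1, [(i, b)])) [1..<Suc n]"

definition linear_rels :: "nat \<Rightarrow> (nat \<times> nat, 'k :: field) terms list" where
  "linear_rels n = map (\<lambda>(i, j). linear_rel n i j) (gen_list n)"

text \<open>Exactly one coordinate agrees: two different entries of a common row or of a common
  column.\<close>

definition quadratic_rels :: "nat \<Rightarrow> (nat \<times> nat, 'k :: field) terms list" where
  "quadratic_rels n = map (\<lambda>(x, y). [(1, [x, y])])
     (filter (\<lambda>(x, y). (fst x = fst y) \<noteq> (snd x = snd y)) (List.product (gen_list n) (gen_list n)))"

fun level_words :: "nat \<Rightarrow> nat \<Rightarrow> (nat \<times> nat) list list" where
  "level_words n 0 = [[]]"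
| "level_words n (Suc k) = concat (map (\<lambda>w. map (\<lambda>x. x # w) (gen_list n)) (level_words n k))"

text \<open>For \<open>k = 0\<close> there are no words at all, since degree 1 contains no quadratic
  relations.\<close>

definition prev_words :: "nat \<Rightarrow> nat \<Rightarrow> (nat \<times> nat) list list" where
  "prev_words n k = (case k of 0 \<Rightarrow> [] | Suc k \<Rightarrow> level_words n k)"

text \<open>A list spanning the degree \<open>k\<close> part of the homogeneous ideal. Each relation
  gets its right factor at once and its left factor letter by letter in the recursion. It is an
  explicit list because the program has to generate it.\<close>

fun level_rels :: "nat \<Rightarrow> nat \<Rightarrow> (nat \<times> nat, 'k :: field) terms list" where
  "level_rels n 0 = []"
| "level_rels n (Suc k) =
     concat (map (\<lambda>g. map (\<lambda>x. map (\<lambda>(a, w). (a, x # w)) g) (gen_list n)) (level_rels n k)) @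
     concat (map (\<lambda>w. map (map (\<lambda>(a, v). (a, v @ w))) (linear_rels n)) (level_words n k)) @
     concat (map (\<lambda>w. map (map (\<lambda>(a, v). (a, v @ w))) (quadratic_rels n)) (prev_words n k))"

definition functional :: "('v list \<Rightarrow> 'k) \<Rightarrow> ('v, 'k :: field) terms \<Rightarrow> 'k" where
  "functional T ts = (\<Sum>(a, w)\<leftarrow>ts. a * T w)"

section \<open>Linear forms on words as matrices\<close>

lemma set_level_words: "set (level_words n k) = {w. length w = k \<and> set w \<subseteq> generators n}"
proof (induction k)
  case (Suc k)
  then show ?case
    by (auto simp: length_Suc_conv image_iff)
qed auto

lemma set_level_words_zip:
  "set (level_words n k) = (\<lambda>(I, J). zip I J) ` (words_over n k \<times> words_over n k)"
proof (induction k)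
  case (Suc k)
  show ?case
  proof (intro equalityI subsetI)
    fix w assume "w \<in> set (level_words n (Suc k))"
    then obtain x v where w: "w = x # v" "x \<in> generators n" "v \<in> set (level_words n k)" by auto
    then obtain I J where "I \<in> words_over n k" "J \<in> words_over n k" "v = zip I J"
      using Suc by auto
    then have "w = zip (fst x # I) (snd x # J)" "fst x # I \<in> words_over n (Suc k)"
        "snd x # J \<in> words_over n (Suc k)"
      using w by auto
    then show "w \<in> (\<lambda>(I, J). zip I J) ` (words_over n (Suc k) \<times> words_over n (Suc k))" by blast
  next
    fix w assume "w \<in> (\<lambda>(I, J). zip I J) ` (words_over n (Suc k) \<times> words_over n (Suc k))"
    then show "w \<in> set (level_words n (Suc k))"
      using Suc by (force simp: words_over_Suc)
  qed
qed simp

lemma level_words_ball: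
  "(\<forall>w\<in>set (level_words n k). P w) \<longleftrightarrow> (\<forall>I\<in>words_over n k. \<forall>J\<in>words_over n k. P (zip I J))"
  unfolding set_level_words_zip by auto

lemma sum_level_words:
  "(\<Sum>w\<in>set (level_words n k). F w) = (\<Sum>I\<in>words_over n k. \<Sum>J\<in>words_over n k. F (zip I J))"
  unfolding set_level_words_zip
proof (subst sum.reindex)
  show "inj_on (\<lambda>(I, J). zip I J) (words_over n k \<times> words_over n k)"
    by (auto simp: inj_on_def words_over_def) (metis map_fst_zip map_snd_zip)+
qed (simp add: sum.cartesian_product case_prod_beta')

lemma functional_simps [simp]:
  "functional T [] = 0"
  "functional T ((a, w) # ts) = a * T w + functional T ts"
  "functional T (ts @ us) = functional T ts + functional T us"
  by (simp_all add: functional_def)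

lemma functional_Cons: "functional T (map (\<lambda>(a, w). (a, x # w)) g) = functional (\<lambda>w. T (x # w)) g"
  by (induction g) auto

lemma functional_linear_rel:
  "functional T (map (\<lambda>(a, v). (a, v @ w)) (linear_rel n i j)) =
   (\<Sum>a = 1..n. T ((a, j) # w)) - (\<Sum>b = 1..n. T ((i, b) # w))"
  by (simp add: linear_rel_def functional_def comp_def case_prod_beta' sum_list_distinct_conv_sum_set
      atLeastLessThanSuc_atLeastAtMost sum_negf del: upt_Suc)

definition kills :: "nat \<Rightarrow> nat \<Rightarrow> ((nat \<times> nat) list \<Rightarrow> complex) \<Rightarrow> bool" where
  "kills n k T \<longleftrightarrow> (\<forall>g\<in>set (level_rels n k). functional T g = 0)"

lemma ball_rotate:
  "(\<forall>z\<in>C. \<forall>x\<in>A. \<forall>y\<in>B. P x y z) \<longleftrightarrow> (\<forall>x\<in>A. \<forall>y\<in>B. \<forall>z\<in>C. P x y z)"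
  by blast

lemma ball_swap_inner:
  "(\<forall>x\<in>A. \<forall>y\<in>B. \<forall>z\<in>C. \<forall>w\<in>D. P x y z w) \<longleftrightarrow>
   (\<forall>x\<in>A. \<forall>z\<in>C. \<forall>y\<in>B. \<forall>w\<in>D. P x y z w)"
  by blast

lemma ball_quadratic_rels:
  "(\<forall>g\<in>set (quadratic_rels n). P g) \<longleftrightarrow> (\<forall>x\<in>generators n. \<forall>y\<in>generators n.
     (fst x = fst y) \<noteq> (snd x = snd y) \<longrightarrow> P [(1, [x, y])])" (is "?L \<longleftrightarrow> ?R")
proof
  assume L: ?L
  show ?R
  proof (intro ballI impI)
    fix x y assume "x \<in> generators n" "y \<in> generators n" "(fst x = fst y) \<noteq> (snd x = snd y)"
    then have "[(1, [x, y])] \<in> (\<lambda>(x, y). [(1, [x, y])]) `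
        {p \<in> generators n \<times> generators n. case p of (x, y) \<Rightarrow> (fst x = fst y) \<noteq> (snd x = snd y)}"
      by (intro image_eqI[of _ _ "(x, y)"]) auto
    then have "[(1, [x, y])] \<in> set (quadratic_rels n)"
      unfolding quadratic_rels_def set_map set_filter set_product set_gen_list .
    with L show "P [(1, [x, y])]" by blast
  qed
next
  assume ?R
  then show ?L unfolding quadratic_rels_def by auto
qed

text \<open>The conjuncts come from the three lists in \<open>level_rels\<close>;
  \<open>tl_commutes_Suc\<close> has the same shape, so that the two recursions can be compared part
  by part.\<close>

lemma kills_Suc:
  "kills n (Suc k) T \<longleftrightarrow>
     (\<forall>x\<in>generators n. kills n k (\<lambda>w. T (x # w))) \<and>
     (\<forall>(i, j)\<in>generators n. \<forall>w\<in>set (level_words n k).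
        (\<Sum>a=1..n. T ((a, j) # w)) = (\<Sum>b=1..n. T ((i, b) # w))) \<and>
     (\<forall>x\<in>generators n. \<forall>y\<in>generators n. \<forall>w\<in>set (prev_words n k).
        (fst x = fst y) \<noteq> (snd x = snd y) \<longrightarrow> T (x # y # w) = 0)"
proof -
  have 1: "(\<forall>g\<in>set (concat (map (\<lambda>g. map (\<lambda>x. map (\<lambda>(a, w). (a, x # w)) g) (gen_list n)) (level_rels n k))).
      functional T g = 0) \<longleftrightarrow> (\<forall>x\<in>generators n. kills n k (\<lambda>w. T (x # w)))"
    unfolding kills_def by (auto simp: functional_Cons)
  have 2: "(\<forall>g\<in>set (concat (map (\<lambda>w. map (map (\<lambda>(a, v). (a, v @ w))) (linear_rels n)) (level_words n k))).
      functional T g = 0) \<longleftrightarrow> (\<forall>(i, j)\<in>generators n. \<forall>w\<in>set (level_words n k).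
        (\<Sum>a=1..n. T ((a, j) # w)) = (\<Sum>b=1..n. T ((i, b) # w)))"
    unfolding linear_rels_def set_concat set_map set_gen_list ball_simps UN_ball_bex_simps
      split_paired_Ball_Sigma case_prod_conv functional_linear_rel right_minus_eq
    by (rule ball_rotate)
  have 3: "(\<forall>g\<in>set (concat (map (\<lambda>w. map (map (\<lambda>(a, v). (a, v @ w))) (quadratic_rels n)) (prev_words n k))).
      functional T g = 0) \<longleftrightarrow> (\<forall>x\<in>generators n. \<forall>y\<in>generators n. \<forall>w\<in>set (prev_words n k).
        (fst x = fst y) \<noteq> (snd x = snd y) \<longrightarrow> T (x # y # w) = 0)"
    by (subst ball_rotate[symmetric])
      (simp only: set_concat set_map UN_ball_bex_simps ball_simps(9) ball_quadratic_rels list.map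
        case_prod_conv append_Cons append_Nil functional_simps mult_1 add_0_right)
  show ?thesis
    unfolding kills_def[of n "Suc k"] level_rels.simps set_append ball_Un 1 2 3 by (rule refl)
qed

lemma words_over_Suc_ball:
  "(\<forall>I\<in>words_over n (Suc k). P I) \<longleftrightarrow> (\<forall>x\<in>{1..n}. \<forall>I\<in>words_over n k. P (x # I))"
  by (auto simp: words_over_Suc)

text \<open>Operators from index 2 on act behind the first letter and give the first conjunct; index
  0 gives the linear relations and index 1 the quadratic ones.\<close>

lemma tl_commutes_Suc:
  "tl_commutes n (Suc k) t \<longleftrightarrow>
     (\<forall>x\<in>{1..n}. \<forall>y\<in>{1..n}. tl_commutes n k (\<lambda>I J. t (x # I) (y # J))) \<and>
     (\<forall>x\<in>{1..n}. \<forall>y\<in>{1..n}. \<forall>I\<in>words_over n k. \<forall>J\<in>words_over n k.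
        (\<Sum>z=1..n. t (z # I) (y # J)) = (\<Sum>z=1..n. t (x # I) (z # J))) \<and>
     (\<forall>x\<in>{1..n}. \<forall>y\<in>{1..n}. \<forall>I\<in>words_over n k. \<forall>J\<in>words_over n k.
        tlop n 1 (\<lambda>K. t K (y # J)) (x # I) = tlop n 1 (t (x # I)) (y # J))"
proof -
  have "tl_commutes n (Suc k) t \<longleftrightarrow> (\<forall>i. \<forall>x\<in>{1..n}. \<forall>y\<in>{1..n}. \<forall>I\<in>words_over n k. \<forall>J\<in>words_over n k.
      tlop n i (\<lambda>K. t K (y # J)) (x # I) = tlop n i (t (x # I)) (y # J))"
    unfolding tl_commutes_def words_over_Suc_ball by (subst ball_swap_inner) (rule refl)
  also have "\<dots> \<longleftrightarrow> (\<forall>i. \<forall>x\<in>{1..n}. \<forall>y\<in>{1..n}. \<forall>I\<in>words_over n k. \<forall>J\<in>words_over n k.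
      tlop n (Suc (Suc i)) (\<lambda>K. t K (y # J)) (x # I) = tlop n (Suc (Suc i)) (t (x # I)) (y # J)) \<and>
     (\<forall>x\<in>{1..n}. \<forall>y\<in>{1..n}. \<forall>I\<in>words_over n k. \<forall>J\<in>words_over n k.
      tlop n 0 (\<lambda>K. t K (y # J)) (x # I) = tlop n 0 (t (x # I)) (y # J)) \<and>
     (\<forall>x\<in>{1..n}. \<forall>y\<in>{1..n}. \<forall>I\<in>words_over n k. \<forall>J\<in>words_over n k.
      tlop n 1 (\<lambda>K. t K (y # J)) (x # I) = tlop n 1 (t (x # I)) (y # J))"
    (is "(\<forall>i. ?P i) \<longleftrightarrow> (\<forall>i. ?P (Suc (Suc i))) \<and> ?P 0 \<and> ?P 1")
  proof -
    have "(\<forall>i. P i) \<longleftrightarrow> (\<forall>i. P (Suc (Suc i))) \<and> P 0 \<and> P 1" for P :: "nat \<Rightarrow> bool"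
      by (metis One_nat_def not0_implies_Suc)
    then show ?thesis .
  qed
  finally show ?thesis unfolding tlop.simps(5) tlop.simps(2) tl_commutes_def[of n k] by blast
qed

lemma kills_iff_tl_commutes: "kills n k T \<longleftrightarrow> tl_commutes n k (\<lambda>I J. T (zip I J))"
proof (induction k arbitrary: T)
  case 0
  show ?case by (simp add: kills_def tl_commutes_def)
next
  case (Suc k)
  have "(\<forall>x\<in>generators n. \<forall>y\<in>generators n. \<forall>w\<in>set (prev_words n k).
        (fst x = fst y) \<noteq> (snd x = snd y) \<longrightarrow> T (x # y # w) = 0) \<longleftrightarrow>
    (\<forall>x\<in>{1..n}. \<forall>y\<in>{1..n}. \<forall>I\<in>words_over n k. \<forall>J\<in>words_over n k.
        tlop n 1 (\<lambda>K. T (zip K (y # J))) (x # I) = tlop n 1 (\<lambda>K. T (zip (x # I) K)) (y # J))"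
  proof (cases k)
    case (Suc k')
    \<comment> \<open>The operator of index 1 multiplies by 1 or 0 according to whether the first
      two letters agree, so the sides can differ only if exactly one of the two pairs
      agrees.\<close>
    have eq: "tlop n 1 (\<lambda>K. T (zip K (y # y' # J))) (x # x' # I) =
        tlop n 1 (\<lambda>K. T (zip (x # x' # I) K)) (y # y' # J) \<longleftrightarrow>
        ((x = x') \<noteq> (y = y') \<longrightarrow> T ((x, y) # (x', y') # zip I J) = 0)" for x y x' y' I J
      by auto
    show ?thesis
      unfolding Suc prev_words_def nat.case level_words_ball words_over_Suc_ball
        split_paired_Ball_Sigma fst_conv snd_conv eq by blast
  qed (auto simp: prev_words_def)
  then show ?case
    unfolding kills_Suc tl_commutes_Suc level_words_ball Suc split_paired_Ball_Sigma
      zip_Cons_Cons case_prod_conv by blast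
qed

section \<open>The free algebra as a vector space spanned by words\<close>

definition scl :: "'k :: field \<Rightarrow> ('v, 'k) ncpoly \<Rightarrow> ('v, 'k) ncpoly" where
  "scl c f = Poly_Mapping.single 0 c * f"

definition wpoly :: "'v list \<Rightarrow> ('v, 'k :: field) ncpoly" where
  "wpoly w = Poly_Mapping.single (NCWord w) 1"

lemma scl_map: "scl c f = Poly_Mapping.map ((*) c) f"
  by (simp add: scl_def mult_map_scale_conv_mult)

lemma lookup_scl [simp]: "Poly_Mapping.lookup (scl c f) w = c * Poly_Mapping.lookup f w"
  by (simp add: scl_map map.rep_eq when_def)

interpretation nc: vector_space "scl :: 'k :: field \<Rightarrow> ('v, 'k) ncpoly \<Rightarrow> _"
  by standard (auto intro!: poly_mapping_eqI simp: lookup_add algebra_simps)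

lemma scl_mult_left [simp]: "scl c f * g = scl c (f * g)"
  by (simp add: scl_def mult.assoc)

lemma single_commute_const:
  "f * Poly_Mapping.single 0 c = Poly_Mapping.single 0 c * (f :: ('v, 'k :: field) ncpoly)"
proof (induction f rule: update_induct)
  case (update f a b)
  have "Poly_Mapping.update a b f = f + Poly_Mapping.single a b"
    using update by (intro poly_mapping_eqI)
      (auto simp: lookup_update lookup_add lookup_single when_def not_in_keys_iff_lookup_eq_zero)
  then show ?case using update
    by (simp add: distrib_left distrib_right mult_single mult.commute)
qed simp

lemma scl_mult_right [simp]: "f * scl c g = scl c (f * g)"
  by (metis scl_def mult.assoc single_commute_const)

lemma wpoly_Nil [simp]: "wpoly [] = 1"
  by (simp add: wpoly_def flip: zero_ncword_def)

lemma wpoly_append: "wpoly (v @ w) = wpoly v * wpoly w"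
  by (simp add: wpoly_def mult_single plus_ncword_def)

lemma wpoly_Cons: "wpoly (x # w) = wpoly [x] * wpoly w"
  using wpoly_append[of "[x]" w] by simp

lemma lookup_wpoly: "Poly_Mapping.lookup (wpoly v) (NCWord w) = (if v = w then 1 else 0)"
  by (simp add: wpoly_def lookup_single)

lemma scl_wpoly: "scl a (wpoly w) = Poly_Mapping.single (NCWord w) a"
  by (simp add: scl_def wpoly_def mult_single)

lemma poly_of_terms_simps [simp]:
  "poly_of_terms [] = 0"
  "poly_of_terms ((a, w) # ts) = scl a (wpoly w) + poly_of_terms ts"
  "poly_of_terms (ts @ us) = poly_of_terms ts + poly_of_terms us"
  by (simp_all add: poly_of_terms_def scl_wpoly)

lemma poly_of_terms_left_mult: "poly_of_terms (map (\<lambda>(a, w). (a, v @ w)) ts) = wpoly v * poly_of_terms ts"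
  by (induction ts) (auto simp: wpoly_append distrib_left)

lemma poly_of_terms_Cons_mult: "poly_of_terms (map (\<lambda>(a, w). (a, x # w)) ts) = wpoly [x] * poly_of_terms ts"
  using poly_of_terms_left_mult[of "[x]" ts] by simp

lemma poly_of_terms_right_mult: "poly_of_terms (map (\<lambda>(a, w). (a, w @ v)) ts) = poly_of_terms ts * wpoly v"
  by (induction ts) (auto simp: wpoly_append distrib_right)

lemma poly_of_terms_scale: "poly_of_terms (map (\<lambda>(a, w). (c * a, w)) ts) = scl c (poly_of_terms ts)"
  by (induction ts) (auto simp: nc.scale_right_distrib)

text \<open>By induction over the span. Linearity enters as two equations, so that maps such as
  multiplication by a letter fit directly.\<close>

lemma span_linear_image:
  assumes "h \<in> nc.span S" "\<And>g. g \<in> S \<Longrightarrow> F g \<in> nc.span S'"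
    and "\<And>f g. F (f + g) = F f + F g" "\<And>c f. F (scl c f) = scl c (F f)"
  shows "F h \<in> nc.span S'"
  using assms(1)
proof (induction rule: nc.span_induct_alt)
  case base
  have "F 0 = 0" using assms(4)[of 0 0] by simp
  then show ?case by (simp add: nc.span_zero)
next
  case (step c x y)
  then show ?case by (simp add: assms nc.span_add nc.span_scale)
qed

section \<open>The graded pieces of the homogeneous ideal\<close>

definition hideal :: "nat \<Rightarrow> nat \<Rightarrow> (nat \<times> nat, complex) ncpoly set" where
  "hideal n k = nc.span (poly_of_terms ` set (level_rels n k))"

text \<open>\<open>rowsum n 1\<close> is the element \<open>s\<close> used for
  homogenization.\<close>

definition rowsum :: "nat \<Rightarrow> nat \<Rightarrow> (nat \<times> nat, complex) ncpoly" where
  "rowsum n i = (\<Sum>b = 1..n. u i b)"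

definition colsum :: "nat \<Rightarrow> nat \<Rightarrow> (nat \<times> nat, complex) ncpoly" where
  "colsum n j = (\<Sum>a = 1..n. u a j)"

lemma u_eq_wpoly: "u i j = wpoly [(i, j)]"
  by (simp add: u_def wpoly_def)

lemma poly_of_linear_rel: "poly_of_terms (linear_rel n i j) = colsum n j - rowsum n i"
  by (simp add: linear_rel_def poly_of_terms_def comp_def colsum_def rowsum_def u_def sum_negf
      sum_list_distinct_conv_sum_set atLeastLessThanSuc_atLeastAtMost single_uminus del: upt_Suc)

lemma hideal_zero: "0 \<in> hideal n k"
  and hideal_add: "f \<in> hideal n k \<Longrightarrow> g \<in> hideal n k \<Longrightarrow> f + g \<in> hideal n k"
  and hideal_diff: "f \<in> hideal n k \<Longrightarrow> g \<in> hideal n k \<Longrightarrow> f - g \<in> hideal n k"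
  and hideal_scl: "f \<in> hideal n k \<Longrightarrow> scl c f \<in> hideal n k"
  and hideal_sum: "(\<And>x. x \<in> A \<Longrightarrow> F x \<in> hideal n k) \<Longrightarrow> sum F A \<in> hideal n k"
  by (auto simp: hideal_def nc.span_zero nc.span_add nc.span_diff nc.span_scale nc.span_sum
      simp del: level_rels.simps)

lemma hideal_left_letter: "x \<in> generators n \<Longrightarrow> h \<in> hideal n k \<Longrightarrow> wpoly [x] * h \<in> hideal n (Suc k)"
  unfolding hideal_def
proof (erule span_linear_image)
  fix g assume x: "x \<in> generators n" and "g \<in> poly_of_terms ` set (level_rels n k)"
  then obtain ts where ts: "ts \<in> set (level_rels n k)" "g = poly_of_terms ts" by blast
  have "map (\<lambda>(a, w). (a, x # w)) ts \<in> set (level_rels n (Suc k))"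
    using ts(1) x by auto
  then show "wpoly [x] * g \<in> nc.span (poly_of_terms ` set (level_rels n (Suc k)))"
    unfolding ts(2) poly_of_terms_Cons_mult[symmetric] by (intro nc.span_base imageI)
qed (simp_all add: distrib_left)

lemma in_concat_map: "w \<in> set ws \<Longrightarrow> y \<in> set (f w) \<Longrightarrow> y \<in> set (concat (map f ws))"
  by auto

lemma hideal_linear_rel:
  assumes "i \<in> {1..n}" "j \<in> {1..n}" "w \<in> set (level_words n k)"
  shows "(colsum n j - rowsum n i) * wpoly w \<in> hideal n (Suc k)"
proof -
  have "map (\<lambda>(a, v). (a, v @ w)) (linear_rel n i j) \<in> set (level_rels n (Suc k))"
  proof -
    have rel: "linear_rel n i j \<in> set (linear_rels n)"
      using assms(1,2) unfolding linear_rels_def by force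
    show ?thesis
      unfolding level_rels.simps set_append
      by (rule UnI2, rule UnI1, rule in_concat_map[OF assms(3)]) (simp add: rel)
  qed
  then show ?thesis
    unfolding hideal_def poly_of_linear_rel[symmetric] poly_of_terms_right_mult[symmetric]
    by (intro nc.span_base imageI)
qed

lemma hideal_quadratic_rel:
  assumes "x \<in> generators n" "y \<in> generators n" "(fst x = fst y) \<noteq> (snd x = snd y)"
    "w \<in> set (level_words n k)"
  shows "wpoly [x, y] * wpoly w \<in> hideal n (Suc (Suc k))"
proof -
  have rel: "[(1, [x, y])] \<in> set (quadratic_rels n)"
    using ball_quadratic_rels[of n "\<lambda>g. g \<in> set (quadratic_rels n)"] assms by blast
  have "map (\<lambda>(a, v). (a, v @ w)) [(1, [x, y])] \<in> set (level_rels n (Suc (Suc k)))"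
    unfolding level_rels.simps(2)[of n "Suc k"] prev_words_def nat.case set_append
    by (rule UnI2, rule UnI2, rule in_concat_map[OF assms(4)], unfold set_map, rule imageI, rule rel)
  then have "poly_of_terms (map (\<lambda>(a, v). (a, v @ w)) [(1, [x, y])]) \<in> hideal n (Suc (Suc k))"
    unfolding hideal_def by (intro nc.span_base imageI)
  then show ?thesis unfolding poly_of_terms_right_mult by simp
qed

lemma in_concat_mapE:
  "y \<in> set (concat (map (\<lambda>w. map (f w) rs) ws)) \<Longrightarrow> \<exists>w\<in>set ws. \<exists>r\<in>set rs. y = f w r"
  by auto

lemma level_rels_cases:
  fixes g :: "(complex \<times> (nat \<times> nat) list) list"
  assumes "g \<in> set (level_rels n (Suc k))"
  obtains (letter) x h where "x \<in> generators n" "h \<in> set (level_rels n k)" "poly_of_terms g = wpoly [x] * poly_of_terms h"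
  | (linear) i j w where "i \<in> {1..n}" "j \<in> {1..n}" "w \<in> set (level_words n k)"
      "poly_of_terms g = (colsum n j - rowsum n i) * wpoly w"
  | (quadratic) x y w k' where "x \<in> generators n" "y \<in> generators n" "(fst x = fst y) \<noteq> (snd x = snd y)"
      "k = Suc k'" "w \<in> set (level_words n k')" "poly_of_terms g = wpoly [x, y] * wpoly w"
proof -
  from assms consider
    (1) h x where "h \<in> set (level_rels n k)" "x \<in> generators n" "g = map (\<lambda>(a, w). (a, x # w)) h"
  | (2) w r where "w \<in> set (level_words n k)" "r \<in> set (linear_rels n)" "g = map (\<lambda>(a, v). (a, v @ w)) r"
  | (3) w r where "w \<in> set (prev_words n k)" "r \<in> set (quadratic_rels n)" "g = map (\<lambda>(a, v). (a, v @ w)) r"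
    unfolding level_rels.simps set_append
    by (elim UnE) (drule in_concat_mapE; metis set_gen_list)+
  then show ?thesis
  proof cases
    case 1
    then show ?thesis using letter by (simp add: poly_of_terms_Cons_mult)
  next
    case 2
    from 2(2) obtain i j where "i \<in> {1..n}" "j \<in> {1..n}" "r = linear_rel n i j"
      unfolding linear_rels_def by auto
    then show ?thesis using linear 2 by (simp add: poly_of_terms_right_mult poly_of_linear_rel)
  next
    case 3
    from 3(2) obtain x y where "x \<in> generators n" "y \<in> generators n"
      "(fst x = fst y) \<noteq> (snd x = snd y)" "r = [(1, [x, y])]"
      unfolding quadratic_rels_def by auto
    moreover from 3(1) obtain k' where "k = Suc k'" "w \<in> set (level_words n k')"
      by (cases k) (auto simp: prev_words_def)
    ultimately show ?thesis using quadratic 3(3)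
      by (simp add: poly_of_terms_right_mult del: map_append list.map)
  qed
qed

text \<open>The recursion of \<open>level_rels\<close> adds letters on the left only, so closure on
  the right needs an induction: linear and quadratic relations absorb the new letter into their
  right factor \<open>w\<close>, and a left letter is passed by the induction hypothesis.\<close>

lemma hideal_right_letter: "x \<in> generators n \<Longrightarrow> h \<in> hideal n k \<Longrightarrow> h * wpoly [x] \<in> hideal n (Suc k)"
proof (induction k arbitrary: h)
  case 0
  then show ?case by (simp add: hideal_def nc.span_zero)
next
  case (Suc k)
  have "poly_of_terms g * wpoly [x] \<in> hideal n (Suc (Suc k))" if "g \<in> set (level_rels n (Suc k))" for g
    using that
  proof (cases rule: level_rels_cases)
    case (letter y h)
    have "poly_of_terms h * wpoly [x] \<in> hideal n (Suc k)"
      using letter Suc unfolding hideal_def[of n k] by (simp add: nc.span_base)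
    then show ?thesis using letter by (simp add: hideal_left_letter mult.assoc)
  next
    case (linear i j w)
    have "w @ [x] \<in> set (level_words n (Suc k))"
      using linear(3) Suc.prems(1) unfolding set_level_words by auto
    from hideal_linear_rel[OF linear(1,2) this] linear(4) show ?thesis
      by (simp add: wpoly_append mult.assoc)
  next
    case (quadratic y z w k')
    have "w @ [x] \<in> set (level_words n (Suc k'))"
      using quadratic(5) Suc.prems(1) unfolding set_level_words by auto
    from hideal_quadratic_rel[OF quadratic(1,2,3) this] quadratic(4,6) show ?thesis
      by (simp add: wpoly_append mult.assoc)
  qed
  then have *: "g * wpoly [x] \<in> hideal n (Suc (Suc k))"
    if "g \<in> poly_of_terms ` set (level_rels n (Suc k))" for g
    using that by (metis imageE)
  show ?case
    unfolding hideal_def[of n "Suc (Suc k)"]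
  proof (rule span_linear_image[where F = "\<lambda>h. h * wpoly [x]"])
    show "h \<in> nc.span (poly_of_terms ` set (level_rels n (Suc k)))"
      using Suc.prems(2) by (simp only: hideal_def)
  qed (simp_all only: *[unfolded hideal_def] distrib_right scl_mult_left)
qed

lemma hideal_right_wpoly:
  "w \<in> set (level_words n m) \<Longrightarrow> h \<in> hideal n k \<Longrightarrow> h * wpoly w \<in> hideal n (k + m)"
proof (induction m arbitrary: w h k)
  case (Suc m)
  then obtain x v where w: "w = x # v" "x \<in> generators n" "v \<in> set (level_words n m)" by auto
  have "(h * wpoly [x]) * wpoly v \<in> hideal n (Suc k + m)"
    using Suc w by (intro Suc.IH hideal_right_letter)
  then show ?case by (simp add: w wpoly_Cons[of x v] mult.assoc)
qed simp

section \<open>Centrality of the row sum modulo the homogeneous ideal\<close>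

lemma hideal_left_rowsum: "i \<in> {1..n} \<Longrightarrow> h \<in> hideal n k \<Longrightarrow> rowsum n i * h \<in> hideal n (Suc k)"
  unfolding rowsum_def sum_distrib_right u_eq_wpoly by (intro hideal_sum hideal_left_letter) auto

lemma hideal_right_rowsum: "i \<in> {1..n} \<Longrightarrow> h \<in> hideal n k \<Longrightarrow> h * rowsum n i \<in> hideal n (Suc k)"
  unfolding rowsum_def sum_distrib_left u_eq_wpoly by (intro hideal_sum hideal_right_letter) auto

lemma hideal_left_power: "n \<ge> 1 \<Longrightarrow> h \<in> hideal n k \<Longrightarrow> rowsum n 1 ^ m * h \<in> hideal n (k + m)"
  by (induction m) (simp_all add: mult.assoc hideal_left_rowsum)

lemma rowsum_diff: "i \<in> {1..n} \<Longrightarrow> j \<in> {1..n} \<Longrightarrow> rowsum n i - rowsum n j \<in> hideal n 1"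
  using hideal_diff[OF hideal_linear_rel[of j n 1 "[]" 0] hideal_linear_rel[of i n 1 "[]" 0]]
  by simp

lemma colsum_rowsum_diff: "i \<in> {1..n} \<Longrightarrow> j \<in> {1..n} \<Longrightarrow> colsum n i - rowsum n j \<in> hideal n 1"
  using hideal_linear_rel[of j n i "[]" 0] by simp

text \<open>In the expanded product every summand except the square is a quadratic relation.\<close>

lemma hideal_row_square:
  assumes "i \<in> {1..n}" "j \<in> {1..n}"
  shows "rowsum n i * u i j - u i j * u i j \<in> hideal n 2" "u i j * rowsum n i - u i j * u i j \<in> hideal n 2"
proof -
  have split: "{1..n} = insert j ({1..n} - {j})" using assms by auto
  have "rowsum n i * u i j - u i j * u i j = (\<Sum>b\<in>{1..n} - {j}. wpoly [(i, b), (i, j)])"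
    unfolding rowsum_def sum_distrib_right using assms(2)
    by (simp add: sum.remove[of "{1..n}" j] u_eq_wpoly wpoly_Cons[of _ "[_]"] del: One_nat_def)
  also have "\<dots> \<in> hideal n 2"
    using assms hideal_quadratic_rel[of _ n _ "[]" 0]
    by (intro hideal_sum) (auto simp: numeral_2_eq_2)
  finally show "rowsum n i * u i j - u i j * u i j \<in> hideal n 2" .
  have "u i j * rowsum n i - u i j * u i j = (\<Sum>b\<in>{1..n} - {j}. wpoly [(i, j), (i, b)])"
    unfolding rowsum_def sum_distrib_left using assms(2)
    by (simp add: sum.remove[of "{1..n}" j] u_eq_wpoly wpoly_Cons[of _ "[_]"] del: One_nat_def)
  also have "\<dots> \<in> hideal n 2"
    using assms hideal_quadratic_rel[of _ n _ "[]" 0]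
    by (intro hideal_sum) (auto simp: numeral_2_eq_2)
  finally show "u i j * rowsum n i - u i j * u i j \<in> hideal n 2" .
qed

text \<open>Modulo the linear relations the sum of row \<open>i\<close> may be replaced by that of
  row 1, and both products with \<open>u i j\<close> then reduce to its square.\<close>

lemma rowsum_square:
  assumes "n \<ge> 1" "i \<in> {1..n}" "j \<in> {1..n}"
  shows "u i j * u i j - rowsum n 1 * u i j \<in> hideal n 2"
    "rowsum n 1 * u i j - u i j * rowsum n 1 \<in> hideal n 2"
proof -
  have gen: "(i, j) \<in> generators n" using assms by auto
  have a: "(rowsum n i - rowsum n 1) * u i j \<in> hideal n 2"
    using hideal_right_letter[OF gen rowsum_diff[of i n 1]] assms by (simp add: u_eq_wpoly numeral_2_eq_2)
  have b: "u i j * (rowsum n i - rowsum n 1) \<in> hideal n 2"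
    using hideal_left_letter[OF gen rowsum_diff[of i n 1]] assms by (simp add: u_eq_wpoly numeral_2_eq_2)
  note sq = hideal_row_square[OF assms(2,3)]
  show 1: "u i j * u i j - rowsum n 1 * u i j \<in> hideal n 2"
    using hideal_diff[OF a sq(1)] by (simp add: algebra_simps)
  have "u i j * u i j - u i j * rowsum n 1 \<in> hideal n 2"
    using hideal_diff[OF b sq(2)] by (simp add: algebra_simps)
  from hideal_diff[OF this 1]
  show "rowsum n 1 * u i j - u i j * rowsum n 1 \<in> hideal n 2" by simp
qed

text \<open>One factor crosses the letter at a time; the remaining factors are multiplied on from
  the left or from the right, which stays inside the ideal.\<close>

lemma rowsum_power_central:
  assumes n: "n \<ge> 1" and x: "x \<in> generators n"
  shows "rowsum n 1 ^ m * wpoly [x] - wpoly [x] * rowsum n 1 ^ m \<in> hideal n (Suc m)"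
proof (induction m)
  case 0
  then show ?case by (simp add: hideal_zero)
next
  case (Suc m)
  obtain i j where ij: "x = (i, j)" "i \<in> {1..n}" "j \<in> {1..n}" using x by auto
  have "rowsum n 1 * (rowsum n 1 ^ m * wpoly [x] - wpoly [x] * rowsum n 1 ^ m) \<in> hideal n (Suc (Suc m))"
    using Suc n by (intro hideal_left_rowsum) auto
  moreover have "(rowsum n 1 * wpoly [x] - wpoly [x] * rowsum n 1) * rowsum n 1 ^ m \<in> hideal n (Suc (Suc m))"
  proof -
    have "h * rowsum n 1 ^ m \<in> hideal n (k + m)" if "h \<in> hideal n k" for h k
      using that
    proof (induction m arbitrary: h k)
      case (Suc m)
      have "h * rowsum n 1 * rowsum n 1 ^ m \<in> hideal n (Suc k + m)"
        using Suc n by (intro Suc.IH hideal_right_rowsum) auto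
      then show ?case by (simp add: mult.assoc)
    qed simp
    from this[OF rowsum_square(2)[OF n ij(2,3)]] show ?thesis by (simp add: ij u_eq_wpoly)
  qed
  ultimately show ?case using hideal_add by (fastforce simp: algebra_simps)
qed

section \<open>The row sum is not a zero divisor\<close>

declare level_rels.simps [simp del]

section \<open>Homogeneous polynomials and their pairing with linear forms\<close>

definition level_polys :: "nat \<Rightarrow> nat \<Rightarrow> (nat \<times> nat, complex) ncpoly set" where
  "level_polys n k = nc.span (wpoly ` set (level_words n k))"

lemma level_polys_induct [consumes 1, case_names zero step]:
  assumes "f \<in> level_polys n k" "P 0"
    "\<And>c w f. w \<in> set (level_words n k) \<Longrightarrow> P f \<Longrightarrow> P (scl c (wpoly w) + f)"
  shows "P f"
  using assms(1) unfolding level_polys_def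
  by (induction rule: nc.span_induct_alt) (auto intro: assms)

lemma level_polys_closed:
  "0 \<in> level_polys n k"
  "f \<in> level_polys n k \<Longrightarrow> g \<in> level_polys n k \<Longrightarrow> f + g \<in> level_polys n k"
  "f \<in> level_polys n k \<Longrightarrow> g \<in> level_polys n k \<Longrightarrow> f - g \<in> level_polys n k"
  "f \<in> level_polys n k \<Longrightarrow> scl c f \<in> level_polys n k"
  "(\<And>x. x \<in> A \<Longrightarrow> F x \<in> level_polys n k) \<Longrightarrow> sum F A \<in> level_polys n k"
  by (auto simp: level_polys_def nc.span_zero nc.span_add nc.span_diff nc.span_scale nc.span_sum)

lemma wpoly_level_polys: "w \<in> set (level_words n k) \<Longrightarrow> wpoly w \<in> level_polys n k"
  by (simp add: level_polys_def nc.span_base)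

text \<open>Only coefficients of words of length \<open>k\<close> are read, which loses nothing on
  \<open>level_polys n k\<close>.\<close>

definition pairing :: "nat \<Rightarrow> nat \<Rightarrow> ((nat \<times> nat) list \<Rightarrow> complex) \<Rightarrow> (nat \<times> nat, complex) ncpoly \<Rightarrow> complex" where
  "pairing n k T f = (\<Sum>w\<in>set (level_words n k). Poly_Mapping.lookup f (NCWord w) * T w)"

lemma pairing_simps [simp]:
  "pairing n k T 0 = 0"
  "pairing n k T (f + g) = pairing n k T f + pairing n k T g"
  "pairing n k T (scl c f) = c * pairing n k T f"
  by (simp_all add: pairing_def lookup_add distrib_right sum.distrib sum_distrib_left mult.assoc)

lemma pairing_sum: "pairing n k T (sum F A) = (\<Sum>a\<in>A. pairing n k T (F a))"
  by (induction A rule: infinite_finite_induct) auto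

lemma pairing_wpoly: "w \<in> set (level_words n k) \<Longrightarrow> pairing n k T (wpoly w) = T w"
proof -
  assume w: "w \<in> set (level_words n k)"
  have "pairing n k T (wpoly w) = (\<Sum>v\<in>set (level_words n k). if v = w then T w else 0)"
    unfolding pairing_def by (intro sum.cong) (auto simp: lookup_wpoly)
  then show ?thesis using w by simp
qed

lemma pairing_Cons:
  assumes x: "x \<in> generators n" and f: "f \<in> level_polys n k"
  shows "pairing n (Suc k) T (wpoly [x] * f) = pairing n k (\<lambda>w. T (x # w)) f"
  using f
proof (induction rule: level_polys_induct)
  case (step c w f)
  have "x # w \<in> set (level_words n (Suc k))" using x step by auto
  then show ?case using step
    by (simp add: distrib_left pairing_wpoly flip: wpoly_Cons del: level_words.simps)
qed simp

lemma pairing_terms: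
  "\<forall>(a, w)\<in>set ts. w \<in> set (level_words n k) \<Longrightarrow> pairing n k T (poly_of_terms ts) = functional T ts"
  by (induction ts) (auto simp: pairing_wpoly)

lemma level_polys_eqI:
  assumes "f \<in> level_polys n k" "\<And>w. w \<in> set (level_words n k) \<Longrightarrow> Poly_Mapping.lookup f (NCWord w) = 0"
  shows "f = 0"
proof -
  have "Poly_Mapping.lookup f (NCWord w) = 0" if "w \<notin> set (level_words n k)" for w
    using assms(1)
  proof (induction rule: level_polys_induct)
    case (step c v f)
    then show ?case using that by (auto simp: lookup_add lookup_wpoly)
  qed simp
  then have "Poly_Mapping.lookup f v = 0" for v
    using assms(2) by (cases v) blast
  then show ?thesis by (intro poly_mapping_eqI) simp
qed

lemma level_words_append:
  "v \<in> set (level_words n k) \<Longrightarrow> w \<in> set (level_words n m) \<Longrightarrow> v @ w \<in> set (level_words n (k + m))"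
  by (auto simp: set_level_words)

lemma level_polys_letter: "f \<in> level_polys n k \<Longrightarrow> x \<in> generators n \<Longrightarrow> wpoly [x] * f \<in> level_polys n (Suc k)"
proof (induction rule: level_polys_induct)
  case (step c w f)
  then have "wpoly (x # w) \<in> level_polys n (Suc k)" by (intro wpoly_level_polys) auto
  then show ?case using step by (simp add: distrib_left level_polys_closed flip: wpoly_Cons)
qed (simp add: level_polys_closed)

lemma level_polys_rowsum: "n \<ge> 1 \<Longrightarrow> f \<in> level_polys n k \<Longrightarrow> rowsum n 1 * f \<in> level_polys n (Suc k)"
  unfolding rowsum_def sum_distrib_right u_eq_wpoly
  by (intro level_polys_closed level_polys_letter) auto

lemma linear_rels_words: "r \<in> set (linear_rels n) \<Longrightarrow> (a, v) \<in> set r \<Longrightarrow> v \<in> set (level_words n 1)"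
  by (auto simp: linear_rels_def linear_rel_def set_level_words)

lemma quadratic_rels_words: "r \<in> set (quadratic_rels n) \<Longrightarrow> (a, v) \<in> set r \<Longrightarrow> v \<in> set (level_words n 2)"
  by (auto simp: quadratic_rels_def set_level_words)

lemma level_rels_words:
  "g \<in> set (level_rels n k) \<Longrightarrow> (a, w) \<in> set g \<Longrightarrow> w \<in> set (level_words n k)"
proof (induction k arbitrary: g a w)
  case (Suc k)
  from Suc.prems(1) consider
    (1) h x where "h \<in> set (level_rels n k)" "x \<in> generators n" "g = map (\<lambda>(a, w). (a, x # w)) h"
  | (2) w r where "w \<in> set (level_words n k)" "r \<in> set (linear_rels n)" "g = map (\<lambda>(a, v). (a, v @ w)) r"
  | (3) w r where "w \<in> set (prev_words n k)" "r \<in> set (quadratic_rels n)" "g = map (\<lambda>(a, v). (a, v @ w)) r"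
    unfolding level_rels.simps set_append
    by (elim UnE) (drule in_concat_mapE; metis set_gen_list)+
  then show ?case
  proof cases
    case 1
    from 1(3) Suc.prems(2) obtain v where "w = x # v" "(a, v) \<in> set h" by auto
    then show ?thesis using 1 Suc.IH by auto
  next
    case (2 w' r)
    from 2(3) Suc.prems(2) obtain v where "w = v @ w'" "(a, v) \<in> set r" by auto
    then show ?thesis using level_words_append[OF linear_rels_words[OF 2(2)] 2(1)]
      by (simp del: level_words.simps)
  next
    case (3 w' r)
    from 3(1) obtain k' where k': "k = Suc k'" "w' \<in> set (level_words n k')"
      by (cases k) (auto simp: prev_words_def)
    from 3(3) Suc.prems(2) obtain v where "w = v @ w'" "(a, v) \<in> set r" by auto
    then show ?thesis using level_words_append[OF quadratic_rels_words[OF 3(2)] k'(2)] k'(1)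
      by (simp del: level_words.simps)
  qed
qed (simp add: level_rels.simps)

lemma poly_of_terms_level:
  "\<forall>(a, w)\<in>set ts. w \<in> set (level_words n k) \<Longrightarrow> poly_of_terms ts \<in> level_polys n k"
  by (induction ts) (auto simp: level_polys_closed wpoly_level_polys)

lemma hideal_induct [consumes 1, case_names zero step]:
  assumes "f \<in> hideal n k" "P 0"
    "\<And>c g f. g \<in> set (level_rels n k) \<Longrightarrow> P f \<Longrightarrow> P (scl c (poly_of_terms g) + f)"
  shows "P f"
  using assms(1) unfolding hideal_def
  by (induction rule: nc.span_induct_alt) (auto intro: assms)

lemma hideal_level_polys: "f \<in> hideal n k \<Longrightarrow> f \<in> level_polys n k"
proof (induction rule: hideal_induct)
  case (step c g f)
  have "poly_of_terms g \<in> level_polys n k"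
    using level_rels_words[OF step(1)] by (intro poly_of_terms_level) auto
  then show ?case using step by (simp add: level_polys_closed)
qed (simp add: level_polys_closed)

lemma kills_iff_pairing:
  "kills n k T \<longleftrightarrow> (\<forall>f\<in>hideal n k. pairing n k T f = 0)"
proof
  assume K: "kills n k T"
  show "\<forall>f\<in>hideal n k. pairing n k T f = 0"
  proof
    fix f assume "f \<in> hideal n k"
    then show "pairing n k T f = 0"
    proof (induction rule: hideal_induct)
      case (step c g f)
      have "pairing n k T (poly_of_terms g) = functional T g"
        using level_rels_words[OF step(1)] by (intro pairing_terms) auto
      then show ?case using K step unfolding kills_def by auto
    qed simp
  qed
next
  assume L: "\<forall>f\<in>hideal n k. pairing n k T f = 0"
  show "kills n k T"
    unfolding kills_def
  proof
    fix g :: "(complex \<times> (nat \<times> nat) list) list" assume g: "g \<in> set (level_rels n k)"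
    then have "poly_of_terms g \<in> hideal n k" unfolding hideal_def by (intro nc.span_base imageI)
    moreover have "pairing n k T (poly_of_terms g) = functional T g"
      using level_rels_words[OF g] by (intro pairing_terms) auto
    ultimately show "functional T g = 0" using L by auto
  qed
qed

lemma tl_commutes_cong:
  assumes "\<And>I J. I \<in> words_over n k \<Longrightarrow> J \<in> words_over n k \<Longrightarrow> t I J = t' I J"
  shows "tl_commutes n k t \<longleftrightarrow> tl_commutes n k t'"
proof -
  have "tlop n i (\<lambda>K. t K J) I = tlop n i (\<lambda>K. t' K J) I" "tlop n i (\<lambda>K. t I K) J = tlop n i (\<lambda>K. t' I K) J"
    if "I \<in> words_over n k" "J \<in> words_over n k" for i I J
    using that assms by (auto intro!: tlop_cong)
  then show ?thesis unfolding tl_commutes_def by auto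
qed

text \<open>\<open>f\<close> is split into its orthogonal projection \<open>h\<close> onto the ideal
  and a rest \<open>t\<close>. The product of \<open>s\<close> with the rest still lies in the
  ideal, and being orthogonal to the ideal, the rest commutes with the operators, so
  \<open>tl_commutes_vanish\<close> shows that it is 0.\<close>

lemma rowsum_regular:
  assumes n: "n \<ge> 1" and f: "f \<in> level_polys n k" and sf: "rowsum n 1 * f \<in> hideal n (Suc k)"
  shows "f \<in> hideal n k"
proof -
  define \<Omega> where "\<Omega> = set (level_words n k)"
  define L where "L h w = Poly_Mapping.lookup h (NCWord w)"
    for h :: "(nat \<times> nat, complex) ncpoly" and w
  define ip where "ip v w = (\<Sum>i\<in>\<Omega>. v i * cnj (w i))" for v w :: "(nat \<times> nat) list \<Rightarrow> complex"
  have "\<exists>B\<subseteq>L ` hideal n k. finite B \<and>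
      (\<forall>b\<in>B. \<forall>b'\<in>B. (\<Sum>i\<in>\<Omega>. b i * cnj (b' i)) = (if b = b' then 1 else 0)) \<and>
      (\<forall>v\<in>L ` hideal n k. \<forall>i\<in>\<Omega>. v i = (\<Sum>b\<in>B. (\<Sum>j\<in>\<Omega>. v j * cnj (b j)) * b i))"
  proof (rule orthonormal_basis_exists)
    show "finite \<Omega>" by (simp add: \<Omega>_def)
    show "(\<lambda>_. 0) \<in> L ` hideal n k" using hideal_zero by (intro image_eqI[of _ _ 0]) (auto simp: L_def)
    show "(\<lambda>i. v i + c * w i) \<in> L ` hideal n k" if vw: "v \<in> L ` hideal n k" "w \<in> L ` hideal n k" for v w c
    proof -
      from vw obtain g h where "v = L g" "w = L h" "g \<in> hideal n k" "h \<in> hideal n k" by blast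
      then show ?thesis
        by (intro image_eqI[of _ _ "g + scl c h"]) (auto simp: L_def lookup_add hideal_add hideal_scl)
    qed
  qed
  then obtain B where B: "B \<subseteq> L ` hideal n k" "finite B"
    and orth: "\<And>b b'. b \<in> B \<Longrightarrow> b' \<in> B \<Longrightarrow> ip b b' = (if b = b' then 1 else 0)"
    and span: "\<And>v i. v \<in> L ` hideal n k \<Longrightarrow> i \<in> \<Omega> \<Longrightarrow> v i = (\<Sum>b\<in>B. ip v b * b i)"
    unfolding ip_def by blast
  have "\<forall>b\<in>B. \<exists>h. h \<in> hideal n k \<and> b = L h" using B(1) by auto
  from bchoice[OF this] obtain H where H: "\<forall>b\<in>B. H b \<in> hideal n k \<and> b = L (H b)" by (rule exE)
  define h where "h = (\<Sum>b\<in>B. scl (ip (L f) b) (H b))"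
  have h: "h \<in> hideal n k" unfolding h_def using H by (intro hideal_sum hideal_scl) auto
  define t where "t = L (f - h)"
  have t_eq: "t w = L f w + (\<Sum>b\<in>B. - ip (L f) b * b w)" for w
  proof -
    have "L h w = (\<Sum>b\<in>B. ip (L f) b * b w)"
    proof -
      have "Poly_Mapping.lookup (H b) (NCWord w) = b w" if "b \<in> B" for b
        using H that unfolding L_def by metis
      then show ?thesis unfolding h_def L_def lookup_sum by (intro sum.cong) auto
    qed
    then show ?thesis by (simp add: t_def L_def lookup_minus sum_negf)
  qed
  have tb: "ip t b = 0" if b: "b \<in> B" for b
  proof -
    have "ip t b = ip (L f) b + (\<Sum>b'\<in>B. - ip (L f) b' * ip b' b)"
      unfolding ip_def t_eq distrib_right sum.distrib sum_distrib_right sum_distrib_left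
      by (simp add: sum.swap[of _ \<Omega> B] mult.assoc)
    also have "(\<Sum>b'\<in>B. - ip (L f) b' * ip b' b) = (\<Sum>b'\<in>B. if b' = b then - ip (L f) b else 0)"
      using b by (intro sum.cong) (auto simp: orth)
    finally show ?thesis using b B(2) by simp
  qed
  \<comment> \<open>Pairing with \<open>cnj t\<close> is the inner product with \<open>t\<close>, so
    orthogonality to \<open>B\<close> gives 0 on the whole ideal.\<close>
  have "pairing n k (\<lambda>w. cnj (t w)) g = 0" if g: "g \<in> hideal n k" for g
  proof -
    have "pairing n k (\<lambda>w. cnj (t w)) g = (\<Sum>w\<in>\<Omega>. (\<Sum>b\<in>B. ip (L g) b * b w) * cnj (t w))"
      unfolding pairing_def \<Omega>_def[symmetric]
      using span[of "L g"] g by (intro sum.cong) (auto simp: L_def)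
    also have "\<dots> = (\<Sum>b\<in>B. ip (L g) b * cnj (ip t b))"
      by (simp add: sum_distrib_left sum_distrib_right ip_def[of t] sum.swap[of _ B \<Omega>] mult_ac)
    finally show ?thesis using tb by simp
  qed
  then have "kills n k (\<lambda>w. cnj (t w))" by (simp add: kills_iff_pairing)
  then have "tl_commutes n k (\<lambda>I J. t (zip I J))"
    unfolding kills_iff_tl_commutes using tl_commutes_cnj by fastforce
  moreover have "(\<Sum>I\<in>words_over n k. \<Sum>J\<in>words_over n k. t (zip I J) *
      (\<Sum>x=1..n. \<Sum>y=1..n. C (x # I) (y # J))) = 0" if C: "tl_commutes n (Suc k) C" for C
  proof -
    \<comment> \<open>A form on words obtained from the matrix \<open>C\<close> by unzipping; on
      zipped words of equal length it is \<open>C\<close> again.\<close>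
    define T where "T w = C (map fst w) (map snd w)" for w
    have "tl_commutes n (Suc k) (\<lambda>I J. T (zip I J)) \<longleftrightarrow> tl_commutes n (Suc k) C"
      by (rule tl_commutes_cong) (auto simp: T_def words_over_def)
    then have "kills n (Suc k) T" using C by (simp add: kills_iff_tl_commutes)
    moreover have "rowsum n 1 * (f - h) \<in> hideal n (Suc k)"
      using hideal_diff[OF sf hideal_left_rowsum[OF _ h]] n by (simp add: right_diff_distrib)
    ultimately have "pairing n (Suc k) T (rowsum n 1 * (f - h)) = 0"
      unfolding kills_iff_pairing by blast
    moreover have "pairing n (Suc k) T (rowsum n 1 * (f - h))
        = (\<Sum>b=1..n. pairing n k (\<lambda>w. T ((1, b) # w)) (f - h))"
      unfolding rowsum_def sum_distrib_right pairing_sum u_eq_wpoly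
      using n f h by (intro sum.cong refl pairing_Cons) (auto intro: level_polys_closed hideal_level_polys)
    moreover have "\<dots> = (\<Sum>w\<in>\<Omega>. t w * (\<Sum>b=1..n. T ((1, b) # w)))"
      unfolding pairing_def \<Omega>_def[symmetric] t_def L_def sum_distrib_left by (rule sum.swap)
    moreover have "\<dots> = (\<Sum>I\<in>words_over n k. \<Sum>J\<in>words_over n k. t (zip I J) * (\<Sum>b=1..n. C (1 # I) (b # J)))"
      unfolding \<Omega>_def sum_level_words
      by (intro sum.cong refl) (auto simp: T_def words_over_def)
    \<comment> \<open>As \<open>C\<close> commutes with the operator of index 0, its row sums over
      the first letter are all equal. Multiplication by \<open>s\<close> only produces the sum over
      row 1, which therefore determines the full sum.\<close>
    moreover have "(\<Sum>x=1..n. \<Sum>y=1..n. C (x # I) (y # J)) = of_nat n * (\<Sum>b=1..n. C (1 # I) (b # J))"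
      if "I \<in> words_over n k" "J \<in> words_over n k" for I J
    proof -
      have row: "(\<Sum>z=1..n. C (z # I) (1 # J)) = (\<Sum>z=1..n. C (x # I) (z # J))" if "x \<in> {1..n}" for x
        using C that \<open>I \<in> _\<close> \<open>J \<in> _\<close> n unfolding tl_commutes_Suc by auto
      have "(\<Sum>x=1..n. \<Sum>y=1..n. C (x # I) (y # J)) = (\<Sum>x=1..n. \<Sum>b=1..n. C (1 # I) (b # J))"
      proof (rule sum.cong[OF refl])
        fix x assume x: "x \<in> {1..n}"
        have "1 \<in> {1..n}" using n by simp
        from trans[OF row[OF x, symmetric] row[OF this]]
        show "(\<Sum>y=1..n. C (x # I) (y # J)) = (\<Sum>b=1..n. C (1 # I) (b # J))" .
      qed
      then show ?thesis by simp
    qed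
    ultimately show ?thesis by (simp add: mult.left_commute flip: sum_distrib_left)
  qed
  ultimately have "t (zip I J) = 0" if "I \<in> words_over n k" "J \<in> words_over n k" for I J
    using tl_commutes_vanish[OF n, of k "\<lambda>I J. t (zip I J)" I J] that by blast
  then have "L (f - h) w = 0" if "w \<in> set (level_words n k)" for w
    using that unfolding t_def[symmetric] set_level_words_zip by auto
  then have "f - h = 0"
    using f h unfolding L_def by (intro level_polys_eqI[of _ n k]) (auto intro: level_polys_closed hideal_level_polys)
  then show ?thesis using h by simp
qed

section \<open>Homogenization of the ideal\<close>

text \<open>Serves to show that homogenization, defined on term lists, depends only on the
  polynomial presented.\<close>

definition lin_ext :: "('v list \<Rightarrow> ('w, 'k :: field) ncpoly) \<Rightarrow> ('v, 'k) ncpoly \<Rightarrow> ('w, 'k) ncpoly" where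
  "lin_ext \<phi> f = (\<Sum>w\<in>Poly_Mapping.keys f. scl (Poly_Mapping.lookup f w) (\<phi> (letters w)))"

lemma lin_ext_superset:
  "finite A \<Longrightarrow> Poly_Mapping.keys f \<subseteq> A \<Longrightarrow>
    lin_ext \<phi> f = (\<Sum>w\<in>A. scl (Poly_Mapping.lookup f w) (\<phi> (letters w)))"
  unfolding lin_ext_def
  by (rule sum.mono_neutral_left) (auto simp: not_in_keys_iff_lookup_eq_zero)

lemma lin_ext_add: "lin_ext \<phi> (f + g) = lin_ext \<phi> f + lin_ext \<phi> g"
proof -
  define A where "A = Poly_Mapping.keys f \<union> Poly_Mapping.keys g"
  have "finite A" "Poly_Mapping.keys (f + g) \<subseteq> A" "Poly_Mapping.keys f \<subseteq> A" "Poly_Mapping.keys g \<subseteq> A"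
    using Poly_Mapping.keys_add[of f g] by (auto simp: A_def)
  then show ?thesis
    by (simp add: lin_ext_superset[of A] lookup_add nc.scale_left_distrib sum.distrib)
qed

lemma lin_ext_wpoly: "lin_ext \<phi> (scl a (wpoly w)) = scl a (\<phi> w)"
  unfolding scl_wpoly by (simp add: lin_ext_superset[of "{NCWord w}"] lookup_single)

lemma lin_ext_terms: "lin_ext \<phi> (poly_of_terms ts) = (\<Sum>(a, w)\<leftarrow>ts. scl a (\<phi> w))"
proof (induction ts)
  case Nil
  show ?case by (simp add: lin_ext_def)
next
  case (Cons t ts)
  then show ?case by (cases t) (simp add: lin_ext_add lin_ext_wpoly)
qed

text \<open>Truncated subtraction leaves a word longer than \<open>k\<close> as it is, so
  homogeneity of degree \<open>k\<close> needs words of length at most \<open>k\<close>.\<close>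

definition padded :: "nat \<Rightarrow> nat \<Rightarrow> (nat \<times> nat) list \<Rightarrow> (nat \<times> nat, complex) ncpoly" where
  "padded n k w = rowsum n 1 ^ (k - length w) * wpoly w"

definition hom_terms :: "nat \<Rightarrow> nat \<Rightarrow> (nat \<times> nat, complex) terms \<Rightarrow> (nat \<times> nat, complex) ncpoly" where
  "hom_terms n k ts = (\<Sum>(a, w)\<leftarrow>ts. scl a (padded n k w))"

lemma hom_terms_simps [simp]:
  "hom_terms n k [] = 0"
  "hom_terms n k ((a, w) # ts) = scl a (padded n k w) + hom_terms n k ts"
  "hom_terms n k (ts @ us) = hom_terms n k ts + hom_terms n k us"
  by (simp_all add: hom_terms_def)

lemma hom_terms_unique: "poly_of_terms ts = poly_of_terms us \<Longrightarrow> hom_terms n k ts = hom_terms n k us"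
  unfolding hom_terms_def by (metis lin_ext_terms)

lemma hom_terms_scale: "hom_terms n k (map (\<lambda>(a, w). (c * a, w)) ts) = scl c (hom_terms n k ts)"
  by (induction ts) (auto simp: nc.scale_right_distrib)

lemma padded_level:
  assumes "n \<ge> 1" "set w \<subseteq> generators n" "length w \<le> k"
  shows "padded n k w \<in> level_polys n k"
proof -
  have "rowsum n 1 ^ m * wpoly w \<in> level_polys n (length w + m)" for m
  proof (induction m)
    case 0
    show ?case using assms(2) by (simp add: wpoly_level_polys set_level_words)
  next
    case (Suc m)
    then show ?case using level_polys_rowsum[OF assms(1) Suc] by (simp add: mult.assoc)
  qed
  from this[of "k - length w"] assms(3) show ?thesis by (simp add: padded_def)
qed

lemma hom_terms_level:
  assumes "n \<ge> 1" "\<forall>(a, w)\<in>set ts. set w \<subseteq> generators n \<and> length w \<le> k"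
  shows "hom_terms n k ts \<in> level_polys n k"
  using assms(2) by (induction ts) (auto simp: level_polys_closed padded_level[OF assms(1)])

lemma hom_terms_Suc:
  assumes "\<forall>(a, w)\<in>set ts. length w \<le> k"
  shows "hom_terms n (Suc k) ts = rowsum n 1 * hom_terms n k ts"
  using assms by (induction ts) (auto simp: padded_def Suc_diff_le distrib_left mult.assoc)

text \<open>All large degrees are required instead of one, so that two polynomials can be added in a
  common degree. By \<open>hom_terms_unique\<close> the choice of \<open>ts\<close> does not
  matter.\<close>

definition in_hideal_eventually :: "nat \<Rightarrow> (nat \<times> nat, complex) ncpoly \<Rightarrow> bool" where
  "in_hideal_eventually n f \<longleftrightarrow> (\<exists>ts. presents (generators n) ts f \<and>
     (\<exists>k0. \<forall>k\<ge>k0. hom_terms n k ts \<in> hideal n k))"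

lemma in_hideal_eventually_add:
  assumes "in_hideal_eventually n f" "in_hideal_eventually n g"
  shows "in_hideal_eventually n (f + g)"
proof -
  from assms obtain ts us k l where
    "presents (generators n) ts f" "\<forall>m\<ge>k. hom_terms n m ts \<in> hideal n m"
    "presents (generators n) us g" "\<forall>m\<ge>l. hom_terms n m us \<in> hideal n m"
    unfolding in_hideal_eventually_def by blast
  then show ?thesis unfolding in_hideal_eventually_def presents_def
    by (intro exI[of _ "ts @ us"] conjI exI[of _ "max k l"]) (auto simp: hideal_add)
qed

lemma in_hideal_eventually_scl:
  assumes "in_hideal_eventually n f"
  shows "in_hideal_eventually n (scl c f)"
proof -
  from assms obtain ts k where "presents (generators n) ts f" "\<forall>m\<ge>k. hom_terms n m ts \<in> hideal n m"
    unfolding in_hideal_eventually_def by blast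
  then show ?thesis unfolding in_hideal_eventually_def presents_def
    by (intro exI[of _ "map (\<lambda>(a, w). (c * a, w)) ts"] conjI exI[of _ k])
       (auto simp: poly_of_terms_scale hom_terms_scale hideal_scl)
qed

lemma in_hideal_eventually_zero: "in_hideal_eventually n 0"
  unfolding in_hideal_eventually_def presents_def
  by (intro exI[of _ "[]"]) (simp add: hideal_zero)

lemma terms_length_bound: "\<exists>d. \<forall>(a, w)\<in>set ts. length w \<le> (d :: nat)"
proof (induction ts)
  case (Cons t ts)
  then obtain d where "\<forall>(a, w)\<in>set ts. length w \<le> d" by blast
  then show ?case by (intro exI[of _ "max d (length (snd t))"]) (auto simp: le_max_iff_disj)
qed simp

lemma presents_left_letter:
  "presents X ts f \<Longrightarrow> x \<in> X \<Longrightarrow> presents X (map (\<lambda>(a, w). (a, x # w)) ts) (wpoly [x] * f)"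
  unfolding presents_def by (fastforce simp: poly_of_terms_Cons_mult)

lemma presents_right_letter:
  "presents X ts f \<Longrightarrow> x \<in> X \<Longrightarrow> presents X (map (\<lambda>(a, w). (a, w @ [x])) ts) (f * wpoly [x])"
  unfolding presents_def by (fastforce simp: poly_of_terms_right_mult)

text \<open>Padding puts the power of \<open>s\<close> to the left of the word, so a new left letter
  must be carried across it by \<open>rowsum_power_central\<close>; a right letter meets no such
  obstacle.\<close>

lemma in_hideal_eventually_left_letter:
  assumes n: "n \<ge> 1" and x: "x \<in> generators n" and f: "in_hideal_eventually n f"
  shows "in_hideal_eventually n (wpoly [x] * f)"
proof -
  from f obtain ts k where ts: "presents (generators n) ts f" "\<forall>m\<ge>k. hom_terms n m ts \<in> hideal n m"
    unfolding in_hideal_eventually_def by blast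
  \<comment> \<open>From degree \<open>d\<close> on, no subtraction in \<open>padded\<close> is
    truncated.\<close>
  obtain d where d: "\<forall>(a, w)\<in>set ts. length w \<le> d" using terms_length_bound[of ts] by (rule exE)
  define us where "us = map (\<lambda>(a, w). (a, x # w)) ts"
  have W: "\<forall>(a, w)\<in>set ts. set w \<subseteq> generators n" using ts(1) by (simp add: presents_def)
  have diff: "hom_terms n (Suc m) us - wpoly [x] * hom_terms n m ts \<in> hideal n (Suc m)" if "m \<ge> d" for m
    using d W unfolding us_def
  proof (induction ts)
    case (Cons t ts)
    obtain a w where t: "t = (a, w)" by force
    define s where "s = rowsum n 1 ^ (m - length w)"
    have "(s * wpoly [x] - wpoly [x] * s) * wpoly w \<in> hideal n (Suc (m - length w) + length w)"
      unfolding s_def using Cons.prems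
      by (intro hideal_right_wpoly rowsum_power_central[OF n x]) (auto simp: t set_level_words)
    moreover have "Suc (m - length w) + length w = Suc m" using Cons.prems that by (auto simp: t)
    ultimately have "(s * wpoly [x] - wpoly [x] * s) * wpoly w \<in> hideal n (Suc m)" by simp
    then have "scl a (padded n (Suc m) (x # w) - wpoly [x] * padded n m w) \<in> hideal n (Suc m)"
      by (intro hideal_scl) (simp add: padded_def s_def wpoly_Cons[of x w] left_diff_distrib mult.assoc)
    moreover have "hom_terms n (Suc m) (map (\<lambda>(a, w). (a, x # w)) ts) - wpoly [x] * hom_terms n m ts
        \<in> hideal n (Suc m)"
      using Cons by auto
    ultimately have "scl a (padded n (Suc m) (x # w) - wpoly [x] * padded n m w) +
      (hom_terms n (Suc m) (map (\<lambda>(a, w). (a, x # w)) ts) - wpoly [x] * hom_terms n m ts)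
        \<in> hideal n (Suc m)" by (rule hideal_add)
    then show ?case by (simp add: t distrib_left nc.scale_right_diff_distrib add_diff_add)
  qed (simp add: hideal_zero)
  have "hom_terms n m us \<in> hideal n m" if "m \<ge> Suc (max d k)" for m
  proof -
    from that obtain m' where m: "m = Suc m'" "m' \<ge> max d k" by (cases m) auto
    have "wpoly [x] * hom_terms n m' ts \<in> hideal n m"
      unfolding m using ts(2) m by (intro hideal_left_letter x) auto
    moreover have "hom_terms n m us - wpoly [x] * hom_terms n m' ts \<in> hideal n m"
      unfolding m using m by (intro diff) auto
    ultimately show ?thesis using hideal_add by fastforce
  qed
  moreover have "presents (generators n) us (wpoly [x] * f)"
    unfolding us_def by (rule presents_left_letter[OF ts(1) x])
  ultimately show ?thesis unfolding in_hideal_eventually_def by blast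
qed

lemma in_hideal_eventually_right_letter:
  assumes x: "x \<in> generators n" and f: "in_hideal_eventually n f"
  shows "in_hideal_eventually n (f * wpoly [x])"
proof -
  from f obtain ts k where ts: "presents (generators n) ts f" "\<forall>m\<ge>k. hom_terms n m ts \<in> hideal n m"
    unfolding in_hideal_eventually_def by blast
  define us where "us = map (\<lambda>(a, w). (a, w @ [x])) ts"
  have eq: "hom_terms n (Suc m) us = hom_terms n m ts * wpoly [x]" for m
    unfolding us_def by (induction ts) (auto simp: padded_def wpoly_append distrib_right mult.assoc)
  have "hom_terms n m us \<in> hideal n m" if "m \<ge> Suc k" for m
  proof -
    from that obtain m' where m: "m = Suc m'" "m' \<ge> k" by (cases m) auto
    show ?thesis unfolding m eq using ts(2) m by (intro hideal_right_letter x) auto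
  qed
  moreover have "presents (generators n) us (f * wpoly [x])"
    unfolding us_def by (rule presents_right_letter[OF ts(1) x])
  ultimately show ?thesis unfolding in_hideal_eventually_def by blast
qed

lemma free_algebra_ops [simp]:
  "mult (free_algebra X) = (*)" "one (free_algebra X) = 1" "zero (free_algebra X) = 0" "add (free_algebra X) = (+)"
  by (simp_all add: free_algebra_def)

lemma presents_carrier: "presents X ts f \<Longrightarrow> f \<in> carrier (free_algebra X)"
proof -
  interpret ring "free_algebra X :: ('a, 'b) ncpoly ring" by (rule ring_free_algebra)
  have "poly_of_terms ts \<in> carrier (free_algebra X)" if "\<forall>(a, w)\<in>set ts. set w \<subseteq> X"
    for ts :: "('a, 'b) terms"
    using that
  proof (induction ts)
    case Nil
    then show ?case using zero_closed by simp
  next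
    case (Cons t ts)
    obtain a w where t: "t = (a, w)" by force
    have "scl a (wpoly w) \<in> carrier (free_algebra X)"
      using Cons.prems unfolding scl_wpoly free_algebra_def by (simp add: t)
    moreover have "poly_of_terms ts \<in> carrier (free_algebra X)" using Cons by auto
    ultimately show ?case using a_closed[of "scl a (wpoly w)" "poly_of_terms ts"] by (simp add: t)
  qed
  then show "presents X ts f \<Longrightarrow> f \<in> carrier (free_algebra X)" by (auto simp: presents_def)
qed

lemma in_hideal_eventually_mult:
  assumes n: "n \<ge> 1" and f: "in_hideal_eventually n f" and g: "g \<in> carrier (free_algebra (generators n))"
  shows "in_hideal_eventually n (g * f)" "in_hideal_eventually n (f * g)"
proof -
  obtain ts where "\<forall>(a, w)\<in>set ts. set w \<subseteq> generators n" "g = poly_of_terms ts"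
    using presents_exists[OF g] unfolding presents_def by auto
  have left: "in_hideal_eventually n (wpoly w * f)" if "set w \<subseteq> generators n" for w
    using that
  proof (induction w)
    case (Cons x w)
    then show ?case using in_hideal_eventually_left_letter[OF n, of x "wpoly w * f"]
      by (simp add: wpoly_Cons[of x w] mult.assoc)
  qed (simp add: f)
  have right: "in_hideal_eventually n (f * wpoly w)" if "set w \<subseteq> generators n" for w
    using that
  proof (induction w rule: rev_induct)
    case (snoc x w)
    then show ?case using in_hideal_eventually_right_letter[of x n "f * wpoly w"]
      by (simp add: wpoly_append mult.assoc)
  qed (simp add: f)
  have "in_hideal_eventually n (poly_of_terms ts * f) \<and> in_hideal_eventually n (f * poly_of_terms ts)"
    using \<open>\<forall>(a, w)\<in>set ts. set w \<subseteq> generators n\<close>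
  proof (induction ts)
    case Nil
    then show ?case by (simp add: in_hideal_eventually_zero)
  next
    case (Cons t ts)
    obtain a w where t: "t = (a, w)" by force
    have w: "set w \<subseteq> generators n" and "\<forall>(a, w)\<in>set ts. set w \<subseteq> generators n"
      using Cons.prems by (simp_all add: t)
    then have "in_hideal_eventually n (poly_of_terms ts * f)" "in_hideal_eventually n (f * poly_of_terms ts)"
      using Cons.IH by blast+
    then show ?case
      using in_hideal_eventually_scl[OF left[OF w], of a] in_hideal_eventually_scl[OF right[OF w], of a]
      by (simp add: t distrib_left distrib_right in_hideal_eventually_add)
  qed
  then show "in_hideal_eventually n (g * f)" "in_hideal_eventually n (f * g)"
    using \<open>g = poly_of_terms ts\<close> by auto
qed

text \<open>Prepares the use of minimality of the generated ideal in
  \<open>qsym_ideal_eventually\<close>.\<close>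

lemma ideal_in_hideal_eventually:
  assumes "n \<ge> 1"
  shows "ideal {f. in_hideal_eventually n f} (free_algebra (generators n))"
proof (rule idealI)
  show "ring (free_algebra (generators n) :: (nat \<times> nat, complex) ncpoly ring)" by (rule ring_free_algebra)
  interpret ring "free_algebra (generators n) :: (nat \<times> nat, complex) ncpoly ring" by (rule ring_free_algebra)
  have carrier: "f \<in> carrier (free_algebra (generators n))" if "in_hideal_eventually n f" for f
    using that presents_carrier unfolding in_hideal_eventually_def by blast
  show "subgroup {f. in_hideal_eventually n f} (add_monoid (free_algebra (generators n)))"
  proof (rule add.subgroupI)
    show "{f. in_hideal_eventually n f} \<noteq> {}" using in_hideal_eventually_zero by blast
    fix f assume f: "f \<in> {f. in_hideal_eventually n f}"
    have "scl (- 1) f + f = 0" by (simp add: nc.scale_minus_left)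
    then have "\<ominus>\<^bsub>free_algebra (generators n)\<^esub> f = scl (- 1) f"
      using f carrier in_hideal_eventually_scl[of n f "- 1"] by (intro minus_equality) auto
    then show "\<ominus>\<^bsub>free_algebra (generators n)\<^esub> f \<in> {f. in_hideal_eventually n f}"
      using in_hideal_eventually_scl[of n f "- 1"] f by simp
  qed (use carrier in_hideal_eventually_add in auto)
qed (use in_hideal_eventually_mult[OF assms] in auto)

section \<open>Homogenizing the defining relations\<close>

lemma hom_terms_sum: "hom_terms n k (map (\<lambda>a. (1, F a)) [1..<Suc n]) = (\<Sum>a=1..n. padded n k (F a))"
  by (simp add: hom_terms_def comp_def sum_list_distinct_conv_sum_set atLeastLessThanSuc_atLeastAtMost
      del: upt_Suc)

lemma poly_of_terms_sum: "poly_of_terms (map (\<lambda>a. (1, F a)) [1..<Suc n]) = (\<Sum>a=1..n. wpoly (F a))"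
  by (simp add: poly_of_terms_def comp_def sum_list_distinct_conv_sum_set atLeastLessThanSuc_atLeastAtMost
      wpoly_def del: upt_Suc)

text \<open>Covers rows and columns at once through \<open>F\<close>. The constant 1 is padded to a
  full power of \<open>s\<close>, so the homogenization is a power of \<open>s\<close> times the
  element in \<open>diff\<close>.\<close>

lemma linear_relation_eventually:
  assumes F: "\<And>a. a \<in> {1..n} \<Longrightarrow> F a \<in> generators n" and n: "n \<ge> 1"
    and diff: "(\<Sum>a=1..n. wpoly [F a]) - rowsum n 1 \<in> hideal n 1"
  shows "in_hideal_eventually n ((\<Sum>a=1..n. wpoly [F a]) - 1)"
  unfolding in_hideal_eventually_def
proof (intro exI conjI allI impI)
  let ?ts = "map (\<lambda>a. (1, [F a])) [1..<Suc n] @ [(- 1, [])]"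
  show "presents (generators n) ?ts ((\<Sum>a=1..n. wpoly [F a]) - 1)"
    unfolding presents_def poly_of_terms_simps poly_of_terms_sum
    using F by (auto simp: nc.scale_minus_left)
  fix k :: nat assume "1 \<le> k"
  then obtain m where k: "k = Suc m" by (cases k) auto
  have "hom_terms n k ?ts = rowsum n 1 ^ m * ((\<Sum>a=1..n. wpoly [F a]) - rowsum n 1)"
    unfolding hom_terms_simps hom_terms_sum k padded_def
    by (simp add: nc.scale_minus_left right_diff_distrib sum_distrib_left power_commutes)
  then show "hom_terms n k ?ts \<in> hideal n k"
    using hideal_left_power[OF n diff, of m] k by simp
qed

lemma quadratic_relation_eventually:
  assumes "x \<in> generators n" "y \<in> generators n" "(fst x = fst y) \<noteq> (snd x = snd y)" and n: "n \<ge> 1"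
  shows "in_hideal_eventually n (wpoly [x] * wpoly [y])"
  unfolding in_hideal_eventually_def
proof (intro exI conjI allI impI)
  show "presents (generators n) [(1, [x, y])] (wpoly [x] * wpoly [y])"
    using assms(1,2) by (simp add: presents_def flip: wpoly_append)
  have rel: "wpoly [x, y] \<in> hideal n 2"
    using hideal_quadratic_rel[OF assms(1-3), of "[]" 0] by (simp add: numeral_2_eq_2)
  fix k :: nat assume "2 \<le> k"
  then obtain m where k: "k = 2 + m" by (metis le_Suc_ex)
  then show "hom_terms n k [(1, [x, y])] \<in> hideal n k"
    using hideal_left_power[OF n rel, of m] by (simp add: padded_def)
qed

text \<open>The homogenization is a power of \<open>s\<close> times the difference of the square and
  \<open>s\<close> times the letter, which \<open>rowsum_square\<close> places in the ideal.\<close>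

lemma square_relation_eventually:
  assumes "x \<in> generators n" and n: "n \<ge> 1"
  shows "in_hideal_eventually n (wpoly [x] * wpoly [x] - wpoly [x])"
  unfolding in_hideal_eventually_def
proof (intro exI conjI allI impI)
  obtain i j where x: "x = (i, j)" "i \<in> {1..n}" "j \<in> {1..n}" using assms(1) by auto
  show "presents (generators n) [(1, [x, x]), (- 1, [x])] (wpoly [x] * wpoly [x] - wpoly [x])"
    using assms(1) by (simp add: presents_def nc.scale_minus_left flip: wpoly_append)
  have rel: "wpoly [x] * wpoly [x] - rowsum n 1 * wpoly [x] \<in> hideal n 2"
    using rowsum_square(1)[OF n x(2,3)] by (simp add: x u_eq_wpoly)
  fix k :: nat assume "2 \<le> k"
  then obtain m where k: "k = 2 + m" by (metis le_Suc_ex)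
  have "hom_terms n k [(1, [x, x]), (- 1, [x])] = rowsum n 1 ^ m * (wpoly [x] * wpoly [x] - rowsum n 1 * wpoly [x])"
    by (simp add: k padded_def nc.scale_minus_left right_diff_distrib wpoly_Cons[of x "[x]"] mult.assoc power_commutes)
       (simp add: power_commutes flip: mult.assoc)
  then show "hom_terms n k [(1, [x, x]), (- 1, [x])] \<in> hideal n k"
    using hideal_left_power[OF n rel, of m] k by simp
qed

lemma qsym_relations_eventually:
  assumes n: "n \<ge> 1" and r: "r \<in> qsym_relations n"
  shows "in_hideal_eventually n r"
proof -
  from r consider
    (row) i where "i \<in> {1..n}" "r = (\<Sum>\<alpha> = 1..n. u i \<alpha>) - 1"
  | (col) i where "i \<in> {1..n}" "r = (\<Sum>\<alpha> = 1..n. u \<alpha> i) - 1"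
  | (sq) i j where "i \<in> {1..n}" "j \<in> {1..n}" "r = u i j ^ 2 - u i j"
  | (qc) i j k where "i \<in> {1..n}" "j \<in> {1..n}" "k \<in> {1..n}" "j \<noteq> k" "r = u j i * u k i"
  | (qr) i j k where "i \<in> {1..n}" "j \<in> {1..n}" "k \<in> {1..n}" "j \<noteq> k" "r = u i j * u i k"
    unfolding qsym_relations_def by blast
  then show ?thesis
  proof cases
    case row
    have "rowsum n i - rowsum n 1 \<in> hideal n 1" using row n by (intro rowsum_diff) auto
    then show ?thesis using linear_relation_eventually[of n "\<lambda>a. (i, a)"] row n
      by (simp add: u_eq_wpoly rowsum_def[of n i])
  next
    case col
    have "colsum n i - rowsum n 1 \<in> hideal n 1" using col n by (intro colsum_rowsum_diff) auto
    then show ?thesis using linear_relation_eventually[of n "\<lambda>a. (a, i)"] col n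
      by (simp add: u_eq_wpoly colsum_def)
  next
    case sq
    then show ?thesis using square_relation_eventually[of "(i, j)" n] n
      by (simp add: u_eq_wpoly power2_eq_square)
  next
    case qc
    then show ?thesis using quadratic_relation_eventually[of "(j, i)" n "(k, i)"] n
      by (simp add: u_eq_wpoly)
  next
    case qr
    then show ?thesis using quadratic_relation_eventually[of "(i, j)" n "(i, k)"] n
      by (simp add: u_eq_wpoly)
  qed
qed

lemma qsym_ideal_eventually:
  assumes n: "n \<ge> 1" and f: "f \<in> qsym_ideal n"
  shows "in_hideal_eventually n f"
proof -
  interpret ring "free_algebra (generators n) :: (nat \<times> nat, complex) ncpoly ring" by (rule ring_free_algebra)
  have "qsym_ideal n \<subseteq> {f. in_hideal_eventually n f}"
    unfolding qsym_ideal_def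
    by (rule genideal_minimal[OF ideal_in_hideal_eventually[OF n]]) (use qsym_relations_eventually[OF n] in blast)
  then show ?thesis using f by blast
qed

text \<open>On the way down from degree \<open>k + k0\<close> to \<open>k\<close>, each step cancels
  one factor \<open>s\<close> by \<open>rowsum_regular\<close>. This replaces an unknown large
  degree by one that can be read off from the terms.\<close>

lemma hom_terms_of_eventually:
  assumes n: "n \<ge> 1" and ts: "\<forall>(a, w)\<in>set ts. set w \<subseteq> generators n \<and> length w \<le> k"
    and f: "in_hideal_eventually n (poly_of_terms ts)"
  shows "hom_terms n k ts \<in> hideal n k"
proof -
  from f obtain us k0 where "presents (generators n) us (poly_of_terms ts)"
    and us: "\<And>k. k \<ge> k0 \<Longrightarrow> hom_terms n k us \<in> hideal n k"
    unfolding in_hideal_eventually_def by blast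
  then have eq: "hom_terms n k us = hom_terms n k ts" for k
    by (intro hom_terms_unique) (simp add: presents_def)
  have "hom_terms n (k + k0) ts \<in> hideal n (k + k0)" using us[of "k + k0"] eq by simp
  then show ?thesis
  proof (induction k0)
    case (Suc m)
    have b: "\<forall>(a, w)\<in>set ts. length w \<le> k + m" "\<forall>(a, w)\<in>set ts. set w \<subseteq> generators n \<and> length w \<le> k + m"
      using ts by fastforce+
    show ?case
      using Suc hom_terms_Suc[OF b(1), of n] rowsum_regular[OF n hom_terms_level[OF n b(2)]] by simp
  qed simp
qed

section \<open>From the homogeneous ideal back to the quantum symmetric ideal\<close>

lemma qsym_relations_carrier: "qsym_relations n \<subseteq> carrier (free_algebra (generators n))"
proof (cases "n \<ge> 1")
  case True
  \<comment> \<open>The presentations contained in \<open>in_hideal_eventually\<close> already show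
    membership in the carrier.\<close>
  then show ?thesis
    using qsym_relations_eventually presents_carrier unfolding in_hideal_eventually_def by blast
next
  case False
  then show ?thesis by (simp add: qsym_relations_def)
qed

lemma ideal_qsym_ideal: "ideal (qsym_ideal n) (free_algebra (generators n))"
proof -
  interpret ring "free_algebra (generators n) :: (nat \<times> nat, complex) ncpoly ring" by (rule ring_free_algebra)
  show ?thesis unfolding qsym_ideal_def by (rule genideal_ideal[OF qsym_relations_carrier])
qed

lemma qsym_relations_in_ideal: "r \<in> qsym_relations n \<Longrightarrow> r \<in> qsym_ideal n"
proof -
  interpret ring "free_algebra (generators n) :: (nat \<times> nat, complex) ncpoly ring" by (rule ring_free_algebra)
  show "r \<in> qsym_relations n \<Longrightarrow> r \<in> qsym_ideal n"
    unfolding qsym_ideal_def using genideal_self[OF qsym_relations_carrier] by blast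
qed

lemma wpoly_carrier: "set w \<subseteq> X \<Longrightarrow> wpoly w \<in> carrier (free_algebra X)"
  by (simp add: wpoly_def free_algebra_def)

lemma scl_carrier: "f \<in> carrier (free_algebra X) \<Longrightarrow> scl c f \<in> carrier (free_algebra X)"
  unfolding free_algebra_def by (auto simp flip: lookup_not_eq_zero_eq_in_keys)

lemma qsym_ideal_zero: "0 \<in> qsym_ideal n"
  and qsym_ideal_add: "f \<in> qsym_ideal n \<Longrightarrow> g \<in> qsym_ideal n \<Longrightarrow> f + g \<in> qsym_ideal n"
  and qsym_ideal_left: "f \<in> qsym_ideal n \<Longrightarrow> h \<in> carrier (free_algebra (generators n)) \<Longrightarrow> h * f \<in> qsym_ideal n"
  and qsym_ideal_right: "f \<in> qsym_ideal n \<Longrightarrow> h \<in> carrier (free_algebra (generators n)) \<Longrightarrow> f * h \<in> qsym_ideal n"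
proof -
  interpret ideal "qsym_ideal n" "free_algebra (generators n)" by (rule ideal_qsym_ideal)
  show "0 \<in> qsym_ideal n"
    and "f \<in> qsym_ideal n \<Longrightarrow> g \<in> qsym_ideal n \<Longrightarrow> f + g \<in> qsym_ideal n"
    and "f \<in> qsym_ideal n \<Longrightarrow> h \<in> carrier (free_algebra (generators n)) \<Longrightarrow> h * f \<in> qsym_ideal n"
    and "f \<in> qsym_ideal n \<Longrightarrow> h \<in> carrier (free_algebra (generators n)) \<Longrightarrow> f * h \<in> qsym_ideal n"
    using I_l_closed I_r_closed additive_subgroup.zero_closed[OF is_additive_subgroup]
      additive_subgroup.a_closed[OF is_additive_subgroup] by auto
qed

lemma qsym_ideal_scl: "f \<in> qsym_ideal n \<Longrightarrow> scl c f \<in> qsym_ideal n"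
  using qsym_ideal_left[of f n "scl c (wpoly [])"] scl_carrier[OF wpoly_carrier[of "[]" "generators n"], of c]
  by simp

lemma qsym_ideal_diff: "f \<in> qsym_ideal n \<Longrightarrow> g \<in> qsym_ideal n \<Longrightarrow> f - g \<in> qsym_ideal n"
  using qsym_ideal_add[of f n "scl (- 1) g"] qsym_ideal_scl[of g n "- 1"] by (simp add: nc.scale_minus_left)

lemma rowsum_minus_1: "i \<in> {1..n} \<Longrightarrow> rowsum n i - 1 \<in> qsym_ideal n"
  unfolding rowsum_def
  by (rule qsym_relations_in_ideal, unfold qsym_relations_def, rule UnI1, rule UnI1, rule UnI1, rule UnI1) blast

lemma colsum_minus_1: "i \<in> {1..n} \<Longrightarrow> colsum n i - 1 \<in> qsym_ideal n"
  unfolding colsum_def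
  by (rule qsym_relations_in_ideal, unfold qsym_relations_def, rule UnI1, rule UnI1, rule UnI1, rule UnI2) blast

lemma quadratic_in_qsym_ideal:
  assumes "x \<in> generators n" "y \<in> generators n" "(fst x = fst y) \<noteq> (snd x = snd y)"
  shows "wpoly [x, y] \<in> qsym_ideal n"
proof -
  obtain i j k l where xy: "x = (i, j)" "y = (k, l)" by force
  have "u i j * u k l \<in> qsym_relations n"
  proof (cases "i = k")
    case True
    then have "i \<in> {1..n}" "j \<in> {1..n}" "l \<in> {1..n}" "j \<noteq> l" "k = i" using assms xy by auto
    then show ?thesis unfolding qsym_relations_def by (intro UnI2) blast
  next
    case False
    then have "j \<in> {1..n}" "i \<in> {1..n}" "k \<in> {1..n}" "i \<noteq> k" "l = j" using assms xy by auto
    then show ?thesis unfolding qsym_relations_def by (intro UnI1[OF UnI2]) blast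
  qed
  from qsym_relations_in_ideal[OF this] show ?thesis
    by (simp add: xy u_eq_wpoly wpoly_Cons[of _ "[_]"])
qed

lemma level_words_carrier: "w \<in> set (level_words n k) \<Longrightarrow> wpoly w \<in> carrier (free_algebra (generators n))"
  by (intro wpoly_carrier) (simp only: set_level_words mem_Collect_eq)

text \<open>A linear relation is the difference of two generators of the ideal, whose constants
  cancel; the quadratic relations are generators themselves.\<close>

lemma level_rels_in_qsym_ideal: "g \<in> set (level_rels n k) \<Longrightarrow> poly_of_terms g \<in> qsym_ideal n"
proof (induction k arbitrary: g)
  case (Suc k)
  from Suc.prems show ?case
  proof (cases rule: level_rels_cases)
    case (letter x h)
    have "wpoly [x] \<in> carrier (free_algebra (generators n))"
      by (rule wpoly_carrier) (use letter(1) in simp)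
    then show ?thesis unfolding letter(3) by (intro qsym_ideal_left Suc.IH letter(2))
  next
    case (linear i j w)
    have "colsum n j - rowsum n i \<in> qsym_ideal n"
      using qsym_ideal_diff[OF colsum_minus_1[of j n] rowsum_minus_1[of i n]] linear by simp
    then show ?thesis unfolding linear(4) by (intro qsym_ideal_right level_words_carrier[OF linear(3)])
  next
    case (quadratic x y w k')
    show ?thesis unfolding quadratic(6)
      by (intro qsym_ideal_right level_words_carrier[OF quadratic(5)] quadratic_in_qsym_ideal quadratic(1-3))
  qed
qed (simp add: level_rels.simps)

lemma hideal_qsym_ideal: "f \<in> hideal n k \<Longrightarrow> f \<in> qsym_ideal n"
  by (induction rule: hideal_induct)
     (auto intro: qsym_ideal_zero qsym_ideal_add qsym_ideal_scl level_rels_in_qsym_ideal)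

text \<open>Modulo the ideal \<open>s\<close> is 1: each further factor \<open>s\<close> changes the
  product by a multiple of \<open>s - 1\<close>.\<close>

lemma padded_congruent:
  assumes n: "n \<ge> 1" and w: "set w \<subseteq> generators n"
  shows "padded n k w - wpoly w \<in> qsym_ideal n"
proof -
  interpret ring "free_algebra (generators n) :: (nat \<times> nat, complex) ncpoly ring" by (rule ring_free_algebra)
  have "rowsum n 1 ^ m * wpoly w - wpoly w \<in> qsym_ideal n" for m
  proof (induction m)
    case (Suc m)
    have "padded n (length w + m) w \<in> level_polys n (length w + m)"
      by (rule padded_level[OF n w]) simp
    moreover have "f \<in> carrier (free_algebra (generators n))" if "f \<in> level_polys n l" for f l
      using that
    proof (induction rule: level_polys_induct)
      case zero
      then show ?case using zero_closed by simp
    next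
      case (step c v f)
      then show ?case using a_closed[OF scl_carrier[OF level_words_carrier]] by simp
    qed
    ultimately have "rowsum n 1 ^ m * wpoly w \<in> carrier (free_algebra (generators n))"
      by (simp add: padded_def)
    then have "(rowsum n 1 - 1) * (rowsum n 1 ^ m * wpoly w) \<in> qsym_ideal n"
      using n by (intro qsym_ideal_right rowsum_minus_1) auto
    from qsym_ideal_add[OF this Suc] show ?case by (simp add: left_diff_distrib mult.assoc)
  qed (simp add: qsym_ideal_zero)
  then show ?thesis by (simp add: padded_def)
qed

lemma hom_terms_congruent:
  assumes n: "n \<ge> 1"
  shows "\<forall>(a, w)\<in>set ts. set w \<subseteq> generators n \<Longrightarrow> hom_terms n k ts - poly_of_terms ts \<in> qsym_ideal n"
proof (induction ts)
  case (Cons t ts)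
  obtain a w where t: "t = (a, w)" by force
  have w: "set w \<subseteq> generators n" and ts: "\<forall>(a, w)\<in>set ts. set w \<subseteq> generators n"
    using Cons.prems by (simp_all add: t)
  from qsym_ideal_add[OF qsym_ideal_scl[OF padded_congruent[OF n w]] Cons.IH[OF ts]]
  show ?case by (simp add: t nc.scale_right_diff_distrib add_diff_add)
qed (simp add: qsym_ideal_zero)

lemma qsym_ideal_0: "qsym_ideal 0 = {0}"
proof
  interpret ring "free_algebra (generators 0) :: (nat \<times> nat, complex) ncpoly ring" by (rule ring_free_algebra)
  have "qsym_relations 0 = {}" by (simp add: qsym_relations_def)
  then show "qsym_ideal 0 \<subseteq> {0}"
    unfolding qsym_ideal_def using genideal_minimal[OF zeroideal, of "{}"] by simp
  show "{0} \<subseteq> qsym_ideal 0" using qsym_ideal_zero by simp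
qed

text \<open>Reduces membership to linear algebra in one finite-dimensional degree. One direction
  rests on cancelling \<open>s\<close>, the other on setting \<open>s = 1\<close>. For
  \<open>n = 0\<close> the row sum is 0 and a positive power of it would erase constants, so
  \<open>k\<close> has to be 0 there.\<close>

theorem qsym_ideal_iff:
  assumes ts: "\<forall>(a, w)\<in>set ts. set w \<subseteq> generators n \<and> length w \<le> k" and k: "n = 0 \<longrightarrow> k = 0"
  shows "poly_of_terms ts \<in> qsym_ideal n \<longleftrightarrow> hom_terms n k ts \<in> hideal n k"
proof (cases "n \<ge> 1")
  case True
  have W: "\<forall>(a, w)\<in>set ts. set w \<subseteq> generators n" using ts by fast
  show ?thesis
  proof
    assume "poly_of_terms ts \<in> qsym_ideal n"
    then show "hom_terms n k ts \<in> hideal n k"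
      by (intro hom_terms_of_eventually[OF True ts] qsym_ideal_eventually[OF True])
  next
    assume "hom_terms n k ts \<in> hideal n k"
    from qsym_ideal_diff[OF hideal_qsym_ideal[OF this] hom_terms_congruent[OF True W, of k]]
    show "poly_of_terms ts \<in> qsym_ideal n" by simp
  qed
next
  case False
  then have 0: "n = 0" "k = 0" using k by auto
  have "hom_terms 0 0 ts = poly_of_terms ts"
    by (induction ts) (auto simp: padded_def)
  moreover have "hideal 0 0 = {0}" by (simp add: hideal_def level_rels.simps)
  ultimately show ?thesis by (simp add: 0 qsym_ideal_0)
qed

section \<open>Deciding membership in a span\<close>

text \<open>Like terms are not collected in the input, so the coefficient is a sum over the list,
  written as the fold that \<open>d_coef\<close> runs.\<close>

definition coef :: "('v, 'k :: field) terms \<Rightarrow> 'v list \<Rightarrow> 'k" where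
  "coef f v = foldl (\<lambda>acc (a, w). if w = v then acc + a else acc) 0 f"

lemma coef_eq_lookup: "coef f v = Poly_Mapping.lookup (poly_of_terms f) (NCWord v)"
proof -
  have "foldl (\<lambda>acc (a, w). if w = v then acc + a else acc) c f =
      c + Poly_Mapping.lookup (poly_of_terms f) (NCWord v)" for c
    by (induction f arbitrary: c) (auto simp: lookup_add lookup_wpoly)
  then show ?thesis by (simp add: coef_def)
qed

text \<open>Represents \<open>f\<close> minus the multiple of \<open>g\<close> that cancels its
  coefficient at \<open>v\<close>. The terms are merely appended, since \<open>coef\<close> collects
  them, and subtraction from 0 is negation in the form available to programs.\<close>

definition reduce :: "('v, 'k :: field) terms \<Rightarrow> 'v list \<Rightarrow> ('v, 'k) terms \<Rightarrow> ('v, 'k) terms" where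
  "reduce g v f = f @ map (\<lambda>(a, w). (0 - (coef f v / coef g v) * a, w)) g"

lemma poly_of_reduce:
  "poly_of_terms (reduce g v f) = poly_of_terms f - scl (coef f v / coef g v) (poly_of_terms g)"
proof -
  have scaled: "poly_of_terms (map (\<lambda>(a, w). (0 - c * a, w)) g) = - scl c (poly_of_terms g)" for c
    by (induction g) (auto simp: nc.scale_right_distrib nc.scale_minus_left)
  show ?thesis unfolding reduce_def poly_of_terms_simps(3) scaled by simp
qed

text \<open>The collected coefficient is tested, not the listed one, so terms that cancel each other
  yield no pivot.\<close>

definition pivot :: "('v, 'k :: field) terms \<Rightarrow> 'v list option" where
  "pivot g = foldl (\<lambda>acc (a, w). if coef g w = 0 then acc else Some w) None g"

lemma pivot_Some:
  fixes g :: "('v, 'k :: field) terms"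
  assumes "pivot g = Some v"
  shows "coef g v \<noteq> 0"
proof -
  \<comment> \<open>For the induction the fold runs over an arbitrary \<open>h\<close>, while
    coefficients are still taken in \<open>g\<close>.\<close>
  have "foldl (\<lambda>acc (a, w). if coef g w = 0 then acc else Some w) None h = Some v \<Longrightarrow> coef g v \<noteq> 0"
    for h :: "('v, 'k) terms"
    by (induction h rule: rev_induct) (auto split: if_splits)
  then show ?thesis using assms unfolding pivot_def by blast
qed

lemma pivot_None_iff:
  fixes g :: "('v, 'k :: field) terms"
  shows "pivot g = None \<longleftrightarrow> poly_of_terms g = 0"
proof
  have "foldl (\<lambda>acc (a, w). if coef g w = 0 then acc else Some w) None h = None \<Longrightarrow>
      \<forall>(a, w)\<in>set h. coef g w = 0" for h :: "('v, 'k) terms"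
    by (induction h rule: rev_induct) (auto split: if_splits)
  moreover assume "pivot g = None"
  ultimately have zero: "\<forall>(a, w)\<in>set g. coef g w = 0" unfolding pivot_def by blast
  have "Poly_Mapping.lookup (poly_of_terms h) (NCWord v) = 0" if "v \<notin> snd ` set h" for h :: "('v, 'k) terms" and v
    using that by (induction h) (auto simp: lookup_add lookup_wpoly)
  then have "Poly_Mapping.lookup (poly_of_terms g) (NCWord v) = 0" for v
    using zero unfolding coef_eq_lookup by (cases "v \<in> snd ` set g") force+
  then have "Poly_Mapping.lookup (poly_of_terms g) v = 0" for v by (cases v) blast
  then show "poly_of_terms g = 0" by (intro poly_mapping_eqI) simp
next
  assume "poly_of_terms g = 0"
  then show "pivot g = None" using pivot_Some[of g] by (cases "pivot g") (auto simp: coef_eq_lookup)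
qed

definition eliminate_step :: "('v, 'k :: field) terms \<times> ('v, 'k) terms list \<Rightarrow> ('v, 'k) terms \<times> ('v, 'k) terms list" where
  "eliminate_step st = (case pivot (hd (snd st)) of
     None \<Rightarrow> (fst st, tl (snd st))
   | Some v \<Rightarrow> (reduce (hd (snd st)) v (fst st), map (reduce (hd (snd st)) v) (tl (snd st))))"

text \<open>Each step consumes one generator, so \<open>length gs\<close> steps leave only the
  reduced \<open>f\<close>, which has to be zero.\<close>

definition span_member :: "('v, 'k :: field) terms \<Rightarrow> ('v, 'k) terms list \<Rightarrow> bool" where
  "span_member f gs \<longleftrightarrow> pivot (fst ((eliminate_step ^^ length gs) (f, gs))) = None"

text \<open>Reducing modulo \<open>g\<close> is linear and kills \<open>g\<close>.\<close>

lemma span_member_iff: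
  "span_member f gs \<longleftrightarrow> poly_of_terms f \<in> nc.span (poly_of_terms ` set gs)"
proof (induction "length gs" arbitrary: f gs)
  case 0
  then show ?case by (simp add: span_member_def pivot_None_iff)
next
  case (Suc m)
  then obtain g hs where gs: "gs = g # hs" "m = length hs" by (cases gs) auto
  have step: "span_member f gs = span_member f' hs'"
    if "eliminate_step (f, gs) = (f', hs')" "length hs' = m" for f' hs'
    using that gs by (simp add: span_member_def funpow_swap1 flip: funpow.simps(2) del: funpow.simps)
       (simp add: funpow_Suc_right del: funpow.simps)
  show ?case
  proof (cases "pivot g")
    case None
    then have "span_member f gs \<longleftrightarrow> span_member f hs" using gs by (intro step) (simp_all add: eliminate_step_def)
    also have "\<dots> \<longleftrightarrow> poly_of_terms f \<in> nc.span (poly_of_terms ` set hs)" by (rule Suc.hyps(1)) (rule gs)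
    also have "nc.span (poly_of_terms ` set hs) = nc.span (poly_of_terms ` set gs)"
      using None by (simp add: gs pivot_None_iff nc.span_insert_0)
    finally show ?thesis .
  next
    case (Some v)
    have gv: "coef g v \<noteq> 0" by (rule pivot_Some[OF Some])
    define R where "R h = h - scl (Poly_Mapping.lookup h (NCWord v) / coef g v) (poly_of_terms g)" for h
    have R_red: "poly_of_terms (reduce g v h) = R (poly_of_terms h)" for h
      by (simp add: poly_of_reduce R_def coef_eq_lookup)
    have "span_member f gs \<longleftrightarrow> span_member (reduce g v f) (map (reduce g v) hs)"
      using gs Some by (intro step) (simp_all add: eliminate_step_def)
    also have "\<dots> \<longleftrightarrow> poly_of_terms (reduce g v f) \<in> nc.span (poly_of_terms ` set (map (reduce g v) hs))"
      by (rule Suc.hyps(1)) (simp add: gs)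
    also have "\<dots> \<longleftrightarrow> R (poly_of_terms f) \<in> nc.span (R ` poly_of_terms ` set hs)"
      by (simp add: R_red image_image)
    also have "\<dots> \<longleftrightarrow> poly_of_terms f \<in> nc.span (poly_of_terms ` set gs)"
    proof
      assume "poly_of_terms f \<in> nc.span (poly_of_terms ` set gs)"
      then show "R (poly_of_terms f) \<in> nc.span (R ` poly_of_terms ` set hs)"
      proof (rule span_linear_image)
        show "R (p + q) = R p + R q" for p q
          by (simp add: R_def lookup_add add_divide_distrib nc.scale_left_distrib)
        show "R (scl c p) = scl c (R p)" for c p
          by (simp add: R_def nc.scale_right_diff_distrib)
        have "R (poly_of_terms g) = 0" using gv by (simp add: R_def coef_eq_lookup)
        then show "R p \<in> nc.span (R ` poly_of_terms ` set hs)" if "p \<in> poly_of_terms ` set gs" for p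
          using that by (auto simp: gs nc.span_zero intro: nc.span_base)
      qed
    next
      \<comment> \<open>For the converse, \<open>R\<close> changes a polynomial only by a multiple
        of \<open>g\<close>, so nothing leaves the span and \<open>f\<close> can be recovered from
        its image.\<close>
      let ?S = "nc.span (poly_of_terms ` set gs)"
      have g: "poly_of_terms g \<in> ?S" by (simp add: gs nc.span_base)
      assume "R (poly_of_terms f) \<in> nc.span (R ` poly_of_terms ` set hs)"
      moreover have "R ` poly_of_terms ` set hs \<subseteq> ?S"
      proof (rule image_subsetI)
        fix p assume "p \<in> poly_of_terms ` set hs"
        then have "p \<in> ?S" by (intro nc.span_base) (simp add: gs)
        then show "R p \<in> ?S" unfolding R_def by (intro nc.span_diff nc.span_scale g)
      qed
      ultimately have "R (poly_of_terms f) \<in> ?S"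
        by (meson nc.span_minimal nc.subspace_span subsetD)
      from nc.span_add[OF this nc.span_scale[OF g]]
      show "poly_of_terms f \<in> ?S" by (metis R_def diff_add_cancel)
    qed
    finally show ?thesis .
  qed
qed

section \<open>Homogenization of term lists\<close>

definition prefix_row :: "nat \<Rightarrow> (nat \<times> nat, 'k :: field) terms \<Rightarrow> (nat \<times> nat, 'k) terms" where
  "prefix_row n P = concat (map (\<lambda>(a, w). map (\<lambda>b. (a, (1, b) # w)) [1..<Suc n]) P)"

definition hom_list :: "nat \<Rightarrow> nat \<Rightarrow> (nat \<times> nat, 'k :: field) terms \<Rightarrow> (nat \<times> nat, 'k) terms" where
  "hom_list n k ts = concat (map (\<lambda>(a, w). (prefix_row n ^^ (k - length w)) [(a, w)]) ts)"

lemma poly_of_prefix_row: "poly_of_terms (prefix_row n P) = rowsum n 1 * poly_of_terms P"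
proof (induction P)
  case (Cons t P)
  obtain a w where t: "t = (a, w)" by force
  have "poly_of_terms (map (\<lambda>b. (a, (1, b) # w)) [1..<Suc n]) = (\<Sum>b=1..n. scl a (wpoly ((1, b) # w)))"
    by (simp add: poly_of_terms_def scl_wpoly comp_def sum_list_distinct_conv_sum_set
        atLeastLessThanSuc_atLeastAtMost del: upt_Suc)
  also have "\<dots> = rowsum n 1 * scl a (wpoly w)"
    by (simp add: rowsum_def u_eq_wpoly sum_distrib_right nc.scale_sum_right wpoly_Cons[of _ w])
  finally show ?case using Cons by (simp add: t prefix_row_def distrib_left del: upt_Suc)
qed (simp add: prefix_row_def)

lemma poly_of_hom_list: "poly_of_terms (hom_list n k ts) = hom_terms n k ts"
proof (induction ts)
  case (Cons t ts)
  obtain a w where t: "t = (a, w)" by force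
  have "poly_of_terms ((prefix_row n ^^ m) P) = rowsum n 1 ^ m * poly_of_terms P" for m P
    by (induction m) (simp_all add: poly_of_prefix_row mult.assoc)
  then show ?case using Cons by (simp add: t hom_list_def padded_def)
qed (simp add: hom_list_def)

section \<open>Programs\<close>

text \<open>The calling convention of all programs below: argument and result share register
  \<open>m\<close>, lower registers are preserved, higher ones are scratch space with arbitrary
  initial contents. As \<open>m\<close> is arbitrary, programs can be nested at increasing
  registers.\<close>

definition computable :: "('k :: field data \<Rightarrow> 'k data) \<Rightarrow> bool" where
  "computable F \<longleftrightarrow> (\<forall>m. \<exists>c. \<forall>s. \<exists>t. exec c s t \<and> t m = F (s m) \<and> (\<forall>i<m. t i = s i))"

lemma computableE:
  assumes "computable F"
  obtains c where "\<And>s. \<exists>t. exec c s t \<and> t m = F (s m) \<and> (\<forall>i<m. t i = s i)"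
  using assms unfolding computable_def by blast

lemma computable_computes: "computable F \<Longrightarrow> \<exists>c. \<forall>x. computes c x (F x)"
  unfolding computable_def computes_def by (metis fun_upd_same)

section \<open>Building blocks: expressions, composition, branching and folds\<close>

lemma computable_expr:
  assumes "\<And>m (s :: 'k :: field store). eval_expr (e m) s = F (s m)"
  shows "computable F"
  unfolding computable_def
proof (intro allI exI conjI impI)
  fix m :: nat and s :: "'k store"
  show "exec (Assign m (e m)) s (s(m := F (s m)))" using exec.Assign[of m "e m" s] by (simp add: assms)
qed auto

lemma computable_id: "computable (\<lambda>x. x)"
  by (rule computable_expr[of Var]) simp

lemma computable_DNil: "computable (\<lambda>_. DNil)"
  by (rule computable_expr[of "\<lambda>_. NilE"]) simp

lemma computable_zero: "computable (\<lambda>_. Scalar 0)"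
  by (rule computable_expr[of "\<lambda>_. ZeroE"]) simp

lemma computable_one: "computable (\<lambda>_. Scalar 1)"
  by (rule computable_expr[of "\<lambda>_. OneE"]) simp

lemma computable_compose:
  assumes "computable F" "computable G"
  shows "computable (\<lambda>x. G (F x))"
  unfolding computable_def
proof
  fix m
  obtain c where c: "\<And>s. \<exists>t. exec c s t \<and> t m = F (s m) \<and> (\<forall>i<m. t i = s i)"
    using computableE[OF assms(1)] by blast
  obtain d where d: "\<And>s. \<exists>t. exec d s t \<and> t m = G (s m) \<and> (\<forall>i<m. t i = s i)"
    using computableE[OF assms(2)] by blast
  show "\<exists>c. \<forall>s. \<exists>t. exec c s t \<and> t m = G (F (s m)) \<and> (\<forall>i<m. t i = s i)"
  proof (intro exI[of _ "Seq c d"] allI)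
    fix s
    obtain t where t: "exec c s t" "t m = F (s m)" "\<forall>i<m. t i = s i" using c by blast
    obtain r where r: "exec d t r" "r m = G (t m)" "\<forall>i<m. r i = t i" using d by blast
    show "\<exists>t. exec (Seq c d) s t \<and> t m = G (F (s m)) \<and> (\<forall>i<m. t i = s i)"
      using exec.Seq[OF t(1) r(1)] t r by auto
  qed
qed

lemma computable_head: "computable F \<Longrightarrow> computable (\<lambda>x. head (F x))"
  by (erule computable_compose) (rule computable_expr[of "\<lambda>m. HeadE (Var m)"], simp)

lemma computable_tail: "computable F \<Longrightarrow> computable (\<lambda>x. tail (F x))"
  by (erule computable_compose) (rule computable_expr[of "\<lambda>m. TailE (Var m)"], simp)

text \<open>The arguments are computed on copies of the input in registers \<open>Suc m\<close> and
  \<open>Suc (Suc m)\<close>, so the second computation leaves the first result intact.\<close>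

lemma computable_binary:
  assumes e: "\<And>i j (s :: 'k :: field store). eval_expr (e i j) s = H (s i) (s j)"
    and "computable F" "computable G"
  shows "computable (\<lambda>x. H (F x) (G x))"
  unfolding computable_def
proof
  fix m
  obtain c where c: "\<And>s. \<exists>t. exec c s t \<and> t (Suc m) = F (s (Suc m)) \<and> (\<forall>i<Suc m. t i = s i)"
    using computableE[OF assms(2)] by blast
  obtain d where d: "\<And>s. \<exists>t. exec d s t \<and> t (Suc (Suc m)) = G (s (Suc (Suc m))) \<and> (\<forall>i<Suc (Suc m). t i = s i)"
    using computableE[OF assms(3)] by blast
  show "\<exists>c. \<forall>s. \<exists>t. exec c s t \<and> t m = H (F (s m)) (G (s m)) \<and> (\<forall>i<m. t i = s i)"
  proof (intro exI[of _ "Seq (Assign (Suc m) (Var m)) (Seq c (Seq (Assign (Suc (Suc m)) (Var m)) (Seq d (Assign m (e (Suc m) (Suc (Suc m)))))))"] allI)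
    fix s :: "'k store"
    define s1 where "s1 = s(Suc m := eval_expr (Var m) s)"
    have 1: "exec (Assign (Suc m) (Var m)) s s1" unfolding s1_def by (rule exec.Assign)
    obtain s2 where s2: "exec c s1 s2" "s2 (Suc m) = F (s1 (Suc m))" "\<forall>i<Suc m. s2 i = s1 i" using c by blast
    define s3 where "s3 = s2(Suc (Suc m) := eval_expr (Var m) s2)"
    have 3: "exec (Assign (Suc (Suc m)) (Var m)) s2 s3" unfolding s3_def by (rule exec.Assign)
    obtain s4 where s4: "exec d s3 s4" "s4 (Suc (Suc m)) = G (s3 (Suc (Suc m)))" "\<forall>i<Suc (Suc m). s4 i = s3 i"
      using d by blast
    define s5 where "s5 = s4(m := eval_expr (e (Suc m) (Suc (Suc m))) s4)"
    have 5: "exec (Assign m (e (Suc m) (Suc (Suc m)))) s4 s5" unfolding s5_def by (rule exec.Assign)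
    have "s5 m = H (F (s m)) (G (s m))" "\<forall>i<m. s5 i = s i"
      using s2(2,3) s4(2,3) by (auto simp: s5_def e s3_def s1_def)
    then show "\<exists>t. exec (Seq (Assign (Suc m) (Var m)) (Seq c (Seq (Assign (Suc (Suc m)) (Var m)) (Seq d (Assign m (e (Suc m) (Suc (Suc m)))))))) s t
        \<and> t m = H (F (s m)) (G (s m)) \<and> (\<forall>i<m. t i = s i)"
      using 1 3 5 s2(1) s4(1) by (intro exI[of _ s5] conjI exec.Seq)
  qed
qed

lemma computable_DPair: "computable F \<Longrightarrow> computable G \<Longrightarrow> computable (\<lambda>x. DPair (F x) (G x))"
  by (rule computable_binary[of "\<lambda>i j. ConsE (Var i) (Var j)"]) simp_all

lemma computable_eq: "computable F \<Longrightarrow> computable G \<Longrightarrow> computable (\<lambda>x. truth (F x = G x))"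
  by (rule computable_binary[of "\<lambda>i j. EqE (Var i) (Var j)"]) simp_all

lemma computable_minus: "computable F \<Longrightarrow> computable G \<Longrightarrow> computable (\<lambda>x. lift_op (-) (F x) (G x))"
  by (rule computable_binary[of "\<lambda>i j. MinusE (Var i) (Var j)"]) simp_all

lemma computable_plus: "computable F \<Longrightarrow> computable G \<Longrightarrow> computable (\<lambda>x. lift_op (+) (F x) (G x))"
  by (rule computable_binary[of "\<lambda>i j. PlusE (Var i) (Var j)"]) simp_all

lemma computable_times: "computable F \<Longrightarrow> computable G \<Longrightarrow> computable (\<lambda>x. lift_op (*) (F x) (G x))"
  by (rule computable_binary[of "\<lambda>i j. TimesE (Var i) (Var j)"]) simp_all

lemma computable_divide: "computable F \<Longrightarrow> computable G \<Longrightarrow> computable (\<lambda>x. lift_op (/) (F x) (G x))"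
  by (rule computable_binary[of "\<lambda>i j. DivideE (Var i) (Var j)"]) simp_all

text \<open>A function of two arguments is treated as a function of a pair, so its computability is
  shown once and then used for arbitrary computable arguments.\<close>

lemma computable_apply2:
  assumes "computable (\<lambda>z. H (head z) (tail z))" "computable F" "computable G"
  shows "computable (\<lambda>x. H (F x) (G x))"
  using computable_compose[OF computable_DPair[OF assms(2,3)] assms(1)] by simp

lemma computable_if:
  assumes "computable B" "computable F" "computable G"
  shows "computable (\<lambda>x. if B x \<noteq> DNil then F x else G x)"
  unfolding computable_def
proof
  fix m
  obtain b where b: "\<And>s. \<exists>t. exec b s t \<and> t (Suc m) = B (s (Suc m)) \<and> (\<forall>i<Suc m. t i = s i)"
    using computableE[OF assms(1)] by blast
  obtain c where c: "\<And>s. \<exists>t. exec c s t \<and> t m = F (s m) \<and> (\<forall>i<m. t i = s i)"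
    using computableE[OF assms(2)] by blast
  obtain d where d: "\<And>s. \<exists>t. exec d s t \<and> t m = G (s m) \<and> (\<forall>i<m. t i = s i)"
    using computableE[OF assms(3)] by blast
  \<comment> \<open>The test overwrites only a copy of the input, which both branches still find in
    register \<open>m\<close>.\<close>
  let ?c = "Seq (Assign (Suc m) (Var m)) (Seq b (Cond (Var (Suc m)) c d))"
  show "\<exists>c. \<forall>s. \<exists>t. exec c s t \<and> t m = (if B (s m) \<noteq> DNil then F (s m) else G (s m)) \<and> (\<forall>i<m. t i = s i)"
  proof (intro exI[of _ ?c] allI)
    fix s :: "'a store"
    define s1 where "s1 = s(Suc m := eval_expr (Var m) s)"
    have 1: "exec (Assign (Suc m) (Var m)) s s1" unfolding s1_def by (rule exec.Assign)
    obtain s2 where s2: "exec b s1 s2" "s2 (Suc m) = B (s m)" "\<forall>i<Suc m. s2 i = s1 i"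
      using b[of s1] by (auto simp: s1_def)
    have eq: "s2 m = s m" "\<forall>i<m. s2 i = s i" using s2(3) by (auto simp: s1_def)
    show "\<exists>t. exec ?c s t \<and> t m = (if B (s m) \<noteq> DNil then F (s m) else G (s m)) \<and> (\<forall>i<m. t i = s i)"
    proof (cases "B (s m) = DNil")
      case True
      obtain t where "exec d s2 t" "t m = G (s2 m)" "\<forall>i<m. t i = s2 i" using d by blast
      then show ?thesis using True s2 eq
        by (intro exI[of _ t] conjI exec.Seq[OF 1] exec.Seq[OF s2(1)] exec.CondFalse) auto
    next
      case False
      obtain t where "exec c s2 t" "t m = F (s2 m)" "\<forall>i<m. t i = s2 i" using c by blast
      then show ?thesis using False s2 eq
        by (intro exI[of _ t] conjI exec.Seq[OF 1] exec.Seq[OF s2(1)] exec.CondTrue) auto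
    qed
  qed
qed

text \<open>
  The elements that a loop walking down the tails visits: it also makes one round on a
  scalar, whose head and tail are \<^const>\<open>DNil\<close>.
\<close>

fun spine :: "'k data \<Rightarrow> 'k data list" where
  "spine DNil = []"
| "spine (Scalar a) = [DNil]"
| "spine (DPair x y) = x # spine y"

text \<open>The only place where a \<open>While\<close> loop is built: all later iteration over data
  is expressed as a fold. The body also receives the input \<open>x\<close>, packed with accumulator
  and element into one argument.\<close>

lemma computable_foldl:
  assumes "computable (\<lambda>z. S (head z) (head (tail z)) (tail (tail z)))" "computable A" "computable L"
  shows "computable (\<lambda>x. foldl (\<lambda>acc e. S x acc e) (A x) (spine (L x)))"
  unfolding computable_def
proof
  fix m
  \<comment> \<open>\<open>m\<close> keeps the input, \<open>l\<close> the rest of the list,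
    \<open>a\<close> the accumulator, and \<open>r\<close> the packed argument of the body and then
    its result.\<close>
  define l a r where "l = Suc m" and "a = Suc l" and "r = Suc a"
  note regs = r_def a_def l_def
  obtain cL where cL: "\<And>s. \<exists>t. exec cL s t \<and> t l = L (s l) \<and> (\<forall>i<l. t i = s i)"
    using computableE[OF assms(3)] by blast
  obtain cA where cA: "\<And>s. \<exists>t. exec cA s t \<and> t a = A (s a) \<and> (\<forall>i<a. t i = s i)"
    using computableE[OF assms(2)] by blast
  obtain cS where cS: "\<And>s. \<exists>t. exec cS s t \<and>
      t r = S (head (s r)) (head (tail (s r))) (tail (tail (s r))) \<and> (\<forall>i<r. t i = s i)"
    using computableE[OF assms(1)] by blast
  let ?body = "Seq (Assign r (ConsE (Var m) (ConsE (Var a) (HeadE (Var l)))))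
    (Seq cS (Seq (Assign a (Var r)) (Assign l (TailE (Var l)))))"
  let ?loop = "While (Var l) ?body"
  have body: "\<exists>t. exec ?body s t \<and> t a = S (s m) (s a) (head (s l)) \<and> t l = tail (s l) \<and> (\<forall>i\<le>m. t i = s i)" for s
  proof -
    define s1 where "s1 = s(r := eval_expr (ConsE (Var m) (ConsE (Var a) (HeadE (Var l)))) s)"
    have 1: "exec (Assign r (ConsE (Var m) (ConsE (Var a) (HeadE (Var l))))) s s1"
      unfolding s1_def by (rule exec.Assign)
    obtain s2 where s2: "exec cS s1 s2" "s2 r = S (s m) (s a) (head (s l))" "\<forall>i<r. s2 i = s1 i"
      using cS[of s1] by (auto simp: s1_def)
    define s3 where "s3 = s2(a := eval_expr (Var r) s2)"
    have 3: "exec (Assign a (Var r)) s2 s3" unfolding s3_def by (rule exec.Assign)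
    define s4 where "s4 = s3(l := eval_expr (TailE (Var l)) s3)"
    have 4: "exec (Assign l (TailE (Var l))) s3 s4" unfolding s4_def by (rule exec.Assign)
    have "s4 a = S (s m) (s a) (head (s l)) \<and> s4 l = tail (s l) \<and> (\<forall>i\<le>m. s4 i = s i)"
      using s2(2,3) by (auto simp: s4_def s3_def s1_def regs)
    then show ?thesis using 1 s2(1) 3 4 by (intro exI[of _ s4] conjI exec.Seq) auto
  qed
  have loop: "\<exists>t. exec ?loop s t \<and> t a = foldl (\<lambda>acc e. S (s m) acc e) (s a) (spine d) \<and> (\<forall>i\<le>m. t i = s i)"
    if "s l = d" for s d
    using that
  proof (induction d arbitrary: s rule: spine.induct)
    case 1
    then show ?case by (intro exI[of _ s]) (auto intro: exec.WhileFalse)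
  next
    case (2 b)
    obtain t where t: "exec ?body s t" "t a = S (s m) (s a) (head (s l))" "t l = tail (s l)" "\<forall>i\<le>m. t i = s i"
      using body by blast
    have "exec ?loop t t" using t(3) 2 by (intro exec.WhileFalse) simp
    with t 2 show ?case by (intro exI[of _ t] conjI exec.WhileTrue[OF _ t(1)]) auto
  next
    case (3 x y)
    obtain t where t: "exec ?body s t" "t a = S (s m) (s a) (head (s l))" "t l = tail (s l)" "\<forall>i\<le>m. t i = s i"
      using body by blast
    obtain q where q: "exec ?loop t q" "q a = foldl (\<lambda>acc e. S (t m) acc e) (t a) (spine y)" "\<forall>i\<le>m. q i = t i"
      using "3.IH"[of t] t(3) "3.prems" by auto
    have "t m = s m" using t(4) by simp
    with t q 3 show ?case by (intro exI[of _ q] conjI exec.WhileTrue[OF _ t(1) q(1)]) auto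
  qed
  let ?c = "Seq (Assign l (Var m)) (Seq cL (Seq (Assign a (Var m)) (Seq cA (Seq ?loop (Assign m (Var a))))))"
  show "\<exists>c. \<forall>s. \<exists>t. exec c s t \<and> t m = foldl (\<lambda>acc e. S (s m) acc e) (A (s m)) (spine (L (s m))) \<and> (\<forall>i<m. t i = s i)"
  proof (intro exI[of _ ?c] allI)
    fix s :: "'a store"
    define s1 where "s1 = s(l := eval_expr (Var m) s)"
    have 1: "exec (Assign l (Var m)) s s1" unfolding s1_def by (rule exec.Assign)
    obtain s2 where s2: "exec cL s1 s2" "s2 l = L (s m)" "\<forall>i<l. s2 i = s1 i"
      using cL[of s1] by (auto simp: s1_def)
    define s3 where "s3 = s2(a := eval_expr (Var m) s2)"
    have 3: "exec (Assign a (Var m)) s2 s3" unfolding s3_def by (rule exec.Assign)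
    have m: "s2 m = s m" using s2(3) by (simp add: s1_def regs)
    obtain s4 where s4: "exec cA s3 s4" "s4 a = A (s m)" "\<forall>i<a. s4 i = s3 i"
      using cA[of s3] by (auto simp: s3_def m)
    have "s4 l = L (s m)" "s4 m = s m" "\<forall>i<m. s4 i = s i"
      using s4(3) s2(2,3) m by (auto simp: s3_def s1_def regs)
    then obtain s5 where s5: "exec ?loop s4 s5"
      "s5 a = foldl (\<lambda>acc e. S (s m) acc e) (A (s m)) (spine (L (s m)))" "\<forall>i\<le>m. s5 i = s4 i"
      using loop[of s4 "L (s m)"] s4(2) by auto
    define s6 where "s6 = s5(m := eval_expr (Var a) s5)"
    have 6: "exec (Assign m (Var a)) s5 s6" unfolding s6_def by (rule exec.Assign)
    have "s6 m = foldl (\<lambda>acc e. S (s m) acc e) (A (s m)) (spine (L (s m)))" "\<forall>i<m. s6 i = s i"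
      using s5(2,3) \<open>\<forall>i<m. s4 i = s i\<close> by (auto simp: s6_def)
    then show "\<exists>t. exec ?c s t \<and> t m = foldl (\<lambda>acc e. S (s m) acc e) (A (s m)) (spine (L (s m))) \<and> (\<forall>i<m. t i = s i)"
      using 1 s2(1) 3 s4(1) s5(1) 6 by (intro exI[of _ s6] conjI exec.Seq)
  qed
qed

section \<open>Lists of data and the operations obtained from folds\<close>

definition dlist :: "'k data list \<Rightarrow> 'k data" where
  "dlist = data_of_list (\<lambda>x. x)"

lemma dlist_simps [simp]: "dlist [] = DNil" "dlist (x # xs) = DPair x (dlist xs)"
  by (simp_all add: dlist_def)

lemma spine_dlist [simp]: "spine (dlist xs) = xs"
  by (induction xs) auto

lemma foldl_DPair: "foldl (\<lambda>acc e. DPair (F e) acc) (dlist ys) xs = dlist (rev (map F xs) @ ys)"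
  by (induction xs arbitrary: ys) (simp_all flip: dlist_simps)

lemma foldl_DPair_DNil: "foldl (\<lambda>acc e. DPair (F e) acc) DNil xs = dlist (rev (map F xs))"
  using foldl_DPair[of F "[]" xs] by simp

lemma computable_rev: "computable L \<Longrightarrow> computable (\<lambda>x. dlist (rev (spine (L x))))"
proof -
  assume "computable L"
  then have "computable (\<lambda>x. foldl (\<lambda>acc e. DPair e acc) DNil (spine (L x)))"
    by (intro computable_foldl computable_DPair computable_head computable_tail computable_id computable_DNil)
  then show ?thesis by (simp add: foldl_DPair_DNil[of "\<lambda>e. e"])
qed

text \<open>Adding elements at the front during a fold reverses the list, so the input list is
  reversed first.\<close>

lemma computable_map:
  assumes "computable (\<lambda>z. F (head z) (tail z))" "computable L"
  shows "computable (\<lambda>x. dlist (map (\<lambda>e. F x e) (spine (L x))))"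
proof -
  have "computable (\<lambda>x. foldl (\<lambda>acc e. DPair (F x e) acc) DNil (spine (dlist (rev (spine (L x))))))"
    by (intro computable_foldl computable_DPair computable_apply2[OF assms(1)] computable_head
        computable_tail computable_id computable_DNil computable_rev assms(2))
  then show ?thesis by (simp add: foldl_DPair_DNil rev_map)
qed

lemma computable_append:
  assumes "computable F" "computable G"
  shows "computable (\<lambda>x. dlist (spine (F x) @ spine (G x)))"
proof -
  have "computable (\<lambda>x. foldl (\<lambda>acc e. DPair e acc) (dlist (map (\<lambda>e. e) (spine (G x)))) (spine (dlist (rev (spine (F x))))))"
    by (intro computable_foldl computable_DPair computable_head computable_tail computable_id
        computable_rev computable_map assms)
  then show ?thesis by (simp add: foldl_DPair[of "\<lambda>e. e"])
qed

lemma computable_concat_map: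
  assumes "computable (\<lambda>z. F (head z) (tail z))" "computable L"
  shows "computable (\<lambda>x. dlist (concat (map (\<lambda>e. spine (F x e)) (spine (L x)))))"
proof -
  have "computable (\<lambda>x. foldl (\<lambda>acc e. dlist (spine (F x e) @ spine acc)) DNil (spine (dlist (rev (spine (L x))))))"
    by (intro computable_foldl computable_append computable_apply2[OF assms(1)] computable_head
        computable_tail computable_id computable_DNil computable_rev assms(2))
  moreover have "foldl (\<lambda>acc e. dlist (spine (F x e) @ spine acc)) (dlist ys) (rev xs) =
      dlist (concat (map (\<lambda>e. spine (F x e)) xs) @ ys)" for x xs ys
    by (induction xs arbitrary: ys rule: rev_induct) simp_all
  from this[of _ "[]"] have "foldl (\<lambda>acc e. dlist (spine (F x e) @ spine acc)) DNil (rev xs) =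
      dlist (concat (map (\<lambda>e. spine (F x e)) xs))" for x xs by simp
  ultimately show ?thesis by simp
qed

text \<open>The list \<open>as\<close> is fixed when the program is built, so this iteration is
  unrolled; it serves for generators and relations, which depend on \<open>n\<close> only.\<close>

lemma computable_const_map:
  assumes "\<And>a. a \<in> set as \<Longrightarrow> computable (\<lambda>x. F x a)"
  shows "computable (\<lambda>x. dlist (map (F x) as))"
  using assms by (induction as) (auto intro: computable_DPair computable_DNil)

section \<open>Encodings of letters, words and terms\<close>

lemma data_of_list_dlist: "data_of_list enc xs = dlist (map enc xs)"
  by (induction xs) auto

definition enc_letter :: "nat \<times> nat \<Rightarrow> 'k data" where
  "enc_letter x = DPair (data_of_nat (fst x)) (data_of_nat (snd x))"

definition enc_term :: "'k \<times> (nat \<times> nat) list \<Rightarrow> 'k data" where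
  "enc_term t = DPair (Scalar (fst t)) (data_of_word (snd t))"

lemma data_of_word_dlist: "data_of_word w = dlist (map enc_letter w)"
  by (simp add: data_of_word_def data_of_list_dlist enc_letter_def[abs_def] case_prod_unfold)

lemma data_of_terms_dlist: "data_of_terms ts = dlist (map enc_term ts)"
  by (simp add: data_of_terms_def data_of_list_dlist enc_term_def[abs_def] case_prod_unfold)

lemma data_of_word_Nil: "data_of_word [] = DNil"
  by (simp add: data_of_word_dlist)

lemma data_of_word_Cons: "data_of_word (x # w) = DPair (enc_letter x) (data_of_word w)"
  by (simp add: data_of_word_dlist)

lemma head_enc_term [simp]: "head (enc_term t) = Scalar (fst t)"
  and tail_enc_term [simp]: "tail (enc_term t) = data_of_word (snd t)"
  by (simp_all add: enc_term_def)

lemma data_of_nat_inject [simp]: "data_of_nat i = data_of_nat j \<longleftrightarrow> i = j"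
proof (induction i arbitrary: j)
  case 0
  show ?case by (cases j) auto
next
  case (Suc i)
  then show ?case by (cases j) auto
qed

lemma enc_letter_inject [simp]: "enc_letter x = enc_letter y \<longleftrightarrow> x = y"
  by (simp add: enc_letter_def prod_eq_iff)

lemma data_of_word_inject [simp]: "data_of_word v = data_of_word w \<longleftrightarrow> v = w"
proof (induction v arbitrary: w)
  case Nil
  show ?case by (cases w) (simp_all add: data_of_word_Nil data_of_word_Cons)
next
  case (Cons x v)
  then show ?case by (cases w) (simp_all add: data_of_word_Nil data_of_word_Cons)
qed

lemma truth_neq_DNil [simp]: "truth b \<noteq> DNil \<longleftrightarrow> b" "truth b = DNil \<longleftrightarrow> \<not> b"
  by (auto simp: truth_def)

section \<open>The decision procedure on encoded data\<close>

definition d_eq :: "'k data \<Rightarrow> 'k data \<Rightarrow> 'k data" where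
  "d_eq x y = truth (x = y)"

lemma d_eq_neq_DNil [simp]: "d_eq x y \<noteq> DNil \<longleftrightarrow> x = y" "d_eq x y = DNil \<longleftrightarrow> x \<noteq> y"
  by (simp_all add: d_eq_def)

text \<open>The first of the functions on data that imitate a function on term lists; the lemma of
  the same name states the agreement on encodings.\<close>

definition d_coef :: "'k :: field data \<Rightarrow> 'k data \<Rightarrow> 'k data" where
  "d_coef p w = foldl (\<lambda>acc t. if d_eq (tail t) w \<noteq> DNil then lift_op (+) acc (head t) else acc)
     (Scalar 0) (spine p)"

lemma d_coef: "d_coef (data_of_terms f) (data_of_word v) = Scalar (coef f v)"
proof -
  have "foldl (\<lambda>acc t. if d_eq (tail t) (data_of_word v) \<noteq> DNil then lift_op (+) acc (head t) else acc)
      (Scalar c) (map enc_term f) = Scalar (foldl (\<lambda>acc (a, w). if w = v then acc + a else acc) c f)" for c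
    by (induction f arbitrary: c) auto
  then show ?thesis by (simp add: d_coef_def coef_def data_of_terms_dlist)
qed

definition d_reduce :: "'k :: field data \<Rightarrow> 'k data \<Rightarrow> 'k data \<Rightarrow> 'k data" where
  "d_reduce g v f = dlist (spine f @ spine (dlist (map (\<lambda>t. DPair
     (lift_op (-) (Scalar 0) (lift_op (*) (lift_op (/) (d_coef f v) (d_coef g v)) (head t))) (tail t)) (spine g))))"

lemma d_reduce: "d_reduce (data_of_terms g) (data_of_word v) (data_of_terms f) = data_of_terms (reduce g v f)"
  unfolding d_reduce_def d_coef unfolding data_of_terms_dlist reduce_def
  by (simp add: enc_term_def comp_def case_prod_unfold)

definition d_pivot :: "'k :: field data \<Rightarrow> 'k data" where
  "d_pivot g = foldl (\<lambda>acc t. if d_eq (d_coef g (tail t)) (Scalar 0) \<noteq> DNil then acc else DPair DNil (tail t))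
     DNil (spine g)"

text \<open>The extra pair keeps \<open>Some []\<close> apart from \<open>None\<close>, as the empty
  word is itself encoded by \<open>DNil\<close>.\<close>

definition enc_option :: "(nat \<times> nat) list option \<Rightarrow> 'k data" where
  "enc_option p = (case p of None \<Rightarrow> DNil | Some w \<Rightarrow> DPair DNil (data_of_word w))"

lemma d_pivot: "d_pivot (data_of_terms g) = enc_option (pivot g)"
proof -
  have "foldl (\<lambda>acc t. if d_eq (d_coef (data_of_terms g) (tail t)) (Scalar 0) \<noteq> DNil then acc else DPair DNil (tail t))
      (enc_option p) (map enc_term h) = enc_option (foldl (\<lambda>acc (a, w). if coef g w = 0 then acc else Some w) p h)" for p h
  proof (induction h arbitrary: p)
    case (Cons t h)
    show ?case
      using Cons[of p] Cons[of "Some (snd t)"] by (auto simp: d_coef enc_option_def case_prod_unfold)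
  qed simp
  from this[of None g] show ?thesis
    by (simp add: d_pivot_def pivot_def data_of_terms_dlist enc_option_def)
qed

definition d_eliminate_step :: "'k :: field data \<Rightarrow> 'k data" where
  "d_eliminate_step st =
     (if d_pivot (head (tail st)) \<noteq> DNil then
        DPair (d_reduce (head (tail st)) (tail (d_pivot (head (tail st)))) (head st))
          (dlist (map (\<lambda>h. d_reduce (head (tail st)) (tail (d_pivot (head (tail st)))) h) (spine (tail (tail st)))))
      else DPair (head st) (tail (tail st)))"

definition enc_system :: "(nat \<times> nat, 'k) terms \<times> (nat \<times> nat, 'k) terms list \<Rightarrow> 'k data" where
  "enc_system st = DPair (data_of_terms (fst st)) (dlist (map data_of_terms (snd st)))"

lemma d_eliminate_step:
  "snd st \<noteq> [] \<Longrightarrow> d_eliminate_step (enc_system st) = enc_system (eliminate_step st)"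
  by (cases "snd st"; cases "pivot (hd (snd st))")
     (auto simp: d_eliminate_step_def enc_system_def eliminate_step_def d_pivot enc_option_def d_reduce comp_def)

text \<open>The list \<open>gs\<close> doubles as loop counter: the elements are ignored, only their
  number matters.\<close>

definition d_span_member :: "'k :: field data \<Rightarrow> 'k data \<Rightarrow> 'k data" where
  "d_span_member f gs =
     d_eq (d_pivot (head (foldl (\<lambda>st _. d_eliminate_step st) (DPair f gs) (spine gs)))) DNil"

lemma foldl_funpow: "foldl (\<lambda>st _. F st) a xs = (F ^^ length xs) a"
  by (induction xs arbitrary: a) (simp_all add: funpow_swap1)

lemma d_span_member:
  "d_span_member (data_of_terms f) (dlist (map data_of_terms gs)) = truth (span_member f gs)"
proof -
  \<comment> \<open>The length is tracked because \<open>d_eliminate_step\<close> is applied as a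
    lemma only while generators remain.\<close>
  have "(d_eliminate_step ^^ m) (enc_system st) = enc_system ((eliminate_step ^^ m) st) \<and>
      length (snd ((eliminate_step ^^ m) st)) = length (snd st) - m"
    if "m \<le> length (snd st)" for m and st :: "(nat \<times> nat, 'a) terms \<times> (nat \<times> nat, 'a) terms list"
    using that
  proof (induction m)
    case (Suc m)
    have "length (snd (eliminate_step st)) = length (snd st) - 1" for st :: "(nat \<times> nat, 'a) terms \<times> (nat \<times> nat, 'a) terms list"
      by (auto simp: eliminate_step_def split: option.split)
    moreover have "snd ((eliminate_step ^^ m) st) \<noteq> []" using Suc by auto
    ultimately show ?case using Suc by (simp add: d_eliminate_step)
  qed simp
  from this[of "length gs" "(f, gs)"]
  have "(d_eliminate_step ^^ length gs) (enc_system (f, gs)) = enc_system ((eliminate_step ^^ length gs) (f, gs))"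
    by simp
  then show ?thesis
    by (simp add: d_span_member_def foldl_funpow enc_system_def d_pivot span_member_def enc_option_def d_eq_def split: option.split)
qed

definition d_prefix :: "(nat \<times> nat) list \<Rightarrow> 'k data \<Rightarrow> 'k data" where
  "d_prefix v w = foldr (\<lambda>x. DPair (enc_letter x)) v w"

lemma d_prefix: "d_prefix v (data_of_word w) = data_of_word (v @ w)"
  by (induction v) (auto simp: d_prefix_def data_of_word_Cons)

text \<open>The relations \<open>rs\<close> are built into the program and stand to the left of the
  words \<open>ws\<close>, which are data.\<close>

definition d_left_mult :: "(nat \<times> nat, 'k) terms list \<Rightarrow> 'k data \<Rightarrow> 'k data" where
  "d_left_mult rs ws = dlist (concat (map (\<lambda>w. spine (dlist (map (\<lambda>r. dlist (map (\<lambda>t.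
     DPair (Scalar (fst t)) (d_prefix (snd t) w)) r)) rs))) (spine ws)))"

lemma d_left_mult: "d_left_mult rs (dlist (map data_of_word ws)) =
    dlist (map data_of_terms (concat (map (\<lambda>w. map (map (\<lambda>(a, v). (a, v @ w))) rs) ws)))"
  by (simp add: d_left_mult_def d_prefix map_concat comp_def data_of_terms_dlist enc_term_def case_prod_unfold)

text \<open>The state holds the words of the current length, those of the previous length and the
  relations, in this order; the next degree needs all three.\<close>

definition d_level_step :: "nat \<Rightarrow> 'k :: field data \<Rightarrow> 'k data" where
  "d_level_step n st = DPair
     (dlist (concat (map (\<lambda>w. spine (dlist (map (\<lambda>x. DPair (enc_letter x) w) (gen_list n)))) (spine (head st)))))
     (DPair (head st)
       (dlist (spine (dlist (concat (map (\<lambda>g. spine (dlist (map (\<lambda>x. dlist (map (\<lambda>t.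
            DPair (head t) (DPair (enc_letter x) (tail t))) (spine g))) (gen_list n)))) (spine (tail (tail st))))))
        @ spine (dlist (spine (d_left_mult (linear_rels n) (head st))
        @ spine (d_left_mult (quadratic_rels n) (head (tail st))))))))"

definition enc_level :: "nat \<Rightarrow> nat \<Rightarrow> 'k :: field data" where
  "enc_level n k = DPair (dlist (map data_of_word (level_words n k)))
     (DPair (dlist (map data_of_word (prev_words n k))) (dlist (map data_of_terms (level_rels n k))))"

lemma d_level_step: "d_level_step n (enc_level n k) = enc_level n (Suc k)"
  by (simp add: d_level_step_def enc_level_def d_left_mult prev_words_def level_rels.simps map_concat comp_def
      data_of_word_Cons data_of_terms_dlist enc_term_def case_prod_unfold)

definition d_prefix_row :: "nat \<Rightarrow> 'k :: field data \<Rightarrow> 'k data" where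
  "d_prefix_row n P = dlist (concat (map (\<lambda>t. spine (dlist (map (\<lambda>b.
     DPair (head t) (DPair (enc_letter (1, b)) (tail t))) [1..<Suc n]))) (spine P)))"

lemma d_prefix_row: "d_prefix_row n (data_of_terms P) = data_of_terms (prefix_row n P)"
  by (simp add: d_prefix_row_def prefix_row_def data_of_terms_dlist map_concat comp_def enc_term_def
      data_of_word_Cons case_prod_unfold del: upt_Suc)

text \<open>\<open>cnt\<close> is the degree in unary, a list of that length. Removing one cell per
  letter leaves the number of paddings; \<open>tail DNil = DNil\<close> reproduces truncated
  subtraction.\<close>

definition d_hom :: "nat \<Rightarrow> 'k :: field data \<Rightarrow> 'k data \<Rightarrow> 'k data" where
  "d_hom n cnt ts = dlist (concat (map (\<lambda>t. spine (foldl (\<lambda>P _. d_prefix_row n P) (DPair t DNil)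
     (spine (foldl (\<lambda>acc _. tail acc) cnt (spine (tail t)))))) (spine ts)))"

lemma d_hom: "d_hom n (dlist cs) (data_of_terms ts) = data_of_terms (hom_list n (length cs) ts)"
proof -
  have 1: "(d_prefix_row n ^^ m) (data_of_terms P) = data_of_terms ((prefix_row n ^^ m) P)" for m and P :: "(nat \<times> nat, 'a) terms"
    by (induction m) (simp_all add: d_prefix_row)
  have 2: "(tail ^^ m) (dlist cs) = dlist (drop m cs)" for m
  proof (induction m)
    case (Suc m)
    have "tail (dlist xs) = dlist (tl xs)" for xs :: "'a data list" by (cases xs) simp_all
    then show ?case using Suc by (simp add: drop_Suc tl_drop)
  qed simp
  have 3: "DPair (enc_term t) DNil = data_of_terms [t]" for t :: "'a \<times> (nat \<times> nat) list"
    by (simp add: data_of_terms_dlist)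
  have "d_hom n (dlist cs) (data_of_terms ts) = dlist (concat (map (\<lambda>t. spine (data_of_terms
      ((prefix_row n ^^ (length cs - length (snd t))) [t]))) ts))"
    unfolding d_hom_def foldl_funpow
    by (simp add: data_of_terms_dlist[of ts] comp_def 3 1 2 data_of_word_dlist)
  then show ?thesis
    by (simp add: data_of_terms_dlist hom_list_def map_concat comp_def case_prod_unfold)
qed

definition d_difference :: "'k :: field data \<Rightarrow> 'k data \<Rightarrow> 'k data" where
  "d_difference ts us = dlist (spine ts @ spine (dlist (map (\<lambda>t.
     DPair (lift_op (-) (Scalar 0) (head t)) (tail t)) (spine us))))"

text \<open>The total number of letters bounds the length of every word without a maximum being
  computed; for \<open>n = 0\<close> it is 0, as \<open>qsym_ideal_iff\<close> demands.\<close>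

definition d_counter :: "'k data \<Rightarrow> 'k data" where
  "d_counter ts = dlist (concat (map (\<lambda>t. spine (tail t)) (spine ts)))"

text \<open>The start value encodes degree 0: just the empty word, no shorter words, no
  relations.\<close>

definition d_rels :: "nat \<Rightarrow> 'k :: field data \<Rightarrow> 'k data" where
  "d_rels n cnt = tail (tail (foldl (\<lambda>st _. d_level_step n st) (DPair (DPair DNil DNil) (DPair DNil DNil)) (spine cnt)))"

lemma d_rels: "d_rels n (dlist cs) = dlist (map data_of_terms (level_rels n (length cs)))"
proof -
  have "DPair (DPair DNil DNil) (DPair DNil DNil) = (enc_level n 0 :: 'a data)"
    by (simp add: enc_level_def prev_words_def data_of_word_dlist level_rels.simps)
  moreover have "(d_level_step n ^^ m) (enc_level n 0) = (enc_level n m :: 'a data)" for m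
    by (induction m) (simp_all add: d_level_step)
  ultimately show ?thesis unfolding d_rels_def foldl_funpow spine_dlist by (simp add: enc_level_def)
qed

definition d_decide_difference :: "nat \<Rightarrow> 'k :: field data \<Rightarrow> 'k data" where
  "d_decide_difference n ts = d_span_member (d_hom n (d_counter ts) ts) (d_rels n (d_counter ts))"

definition d_decide :: "nat \<Rightarrow> 'k :: field data \<Rightarrow> 'k data" where
  "d_decide n x = d_decide_difference n (d_difference (head x) (tail x))"

lemma d_decide:
  assumes "presents (generators n) ts f" "presents (generators n) us g"
  shows "d_decide n (DPair (data_of_terms ts) (data_of_terms us)) = truth (f - g \<in> qsym_ideal n)"
proof -
  define ds where "ds = ts @ map (\<lambda>(a, w). (0 - a, w)) us"
  have ds: "d_difference (data_of_terms ts) (data_of_terms us) = data_of_terms ds"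
    by (simp add: d_difference_def ds_def data_of_terms_dlist comp_def case_prod_unfold enc_term_def)
  define cs :: "complex data list" where "cs = concat (map (\<lambda>t. map enc_letter (snd t)) ds)"
  have cnt: "d_counter (data_of_terms ds) = dlist cs"
    by (simp add: d_counter_def cs_def data_of_terms_dlist comp_def data_of_word_dlist)
  have gens: "set w \<subseteq> generators n" if "(a, w) \<in> set ds" for a w
    using assms that unfolding ds_def presents_def by fastforce
  have len: "length w \<le> length cs" if "(a, w) \<in> set ds" for a w
  proof -
    have "length w \<in> set (map (\<lambda>t. length (snd t)) ds)" using that by force
    then show ?thesis unfolding cs_def length_concat by (simp add: comp_def member_le_sum_list)
  qed
  have "length cs = 0" if "n = 0"
  proof -
    have "snd t = []" if "t \<in> set ds" for t
      using gens[of "fst t" "snd t"] that \<open>n = 0\<close> by simp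
    then show ?thesis unfolding cs_def by simp
  qed
  moreover have "\<forall>(a, w)\<in>set ds. set w \<subseteq> generators n \<and> length w \<le> length cs"
    using gens len by blast
  ultimately have "poly_of_terms ds \<in> qsym_ideal n \<longleftrightarrow> hom_terms n (length cs) ds \<in> hideal n (length cs)"
    by (intro qsym_ideal_iff impI)
  moreover have "poly_of_terms ds = f - g"
  proof -
    have "poly_of_terms (map (\<lambda>(a, w). (0 - a, w)) us) = - poly_of_terms us"
      by (induction us) (auto simp: nc.scale_minus_left)
    then show ?thesis using assms unfolding ds_def poly_of_terms_simps(3) presents_def by simp
  qed
  moreover have "d_decide n (DPair (data_of_terms ts) (data_of_terms us)) =
      truth (span_member (hom_list n (length cs) ds) (level_rels n (length cs)))"
    by (simp add: d_decide_def d_decide_difference_def ds cnt d_hom d_rels d_span_member)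
  ultimately show ?thesis
    by (simp add: span_member_iff poly_of_hom_list hideal_def)
qed

section \<open>The decision procedure is carried out by a program\<close>

lemma computable_data_of_nat: "computable (\<lambda>_. data_of_nat i)"
  by (induction i) (auto intro: computable_DNil computable_DPair)

lemma computable_enc_letter: "computable (\<lambda>_. enc_letter x)"
  unfolding enc_letter_def by (intro computable_DPair computable_data_of_nat)

lemma computable_d_prefix: "computable F \<Longrightarrow> computable (\<lambda>x. d_prefix v (F x))"
  unfolding d_prefix_def by (induction v) (auto intro: computable_DPair computable_enc_letter)

lemma computable_d_eq: "computable F \<Longrightarrow> computable G \<Longrightarrow> computable (\<lambda>x. d_eq (F x) (G x))"
  unfolding d_eq_def by (rule computable_eq)

lemmas computable_intros = computable_id computable_DNil computable_zero computable_head computable_tail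
  computable_DPair computable_d_eq computable_minus computable_plus computable_times computable_divide
  computable_if computable_map computable_append computable_concat_map computable_const_map
  computable_enc_letter computable_d_prefix computable_foldl

lemma computable_d_coef: "computable F \<Longrightarrow> computable G \<Longrightarrow> computable (\<lambda>x. d_coef (F x) (G x))"
  by (rule computable_apply2[of d_coef]) (unfold d_coef_def, intro computable_intros)

lemma computable_d_reduce:
  assumes "computable F" "computable G" "computable H"
  shows "computable (\<lambda>x. d_reduce (F x) (G x) (H x))"
proof -
  have "computable (\<lambda>z. d_reduce (head z) (head (tail z)) (tail (tail z)))"
    unfolding d_reduce_def by (intro computable_intros computable_d_coef)
  from computable_compose[OF computable_DPair[OF assms(1) computable_DPair[OF assms(2,3)]] this]
  show ?thesis by simp
qed

lemma computable_d_pivot: "computable F \<Longrightarrow> computable (\<lambda>x. d_pivot (F x))"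
  by (erule computable_compose) (unfold d_pivot_def, intro computable_intros computable_d_coef)

lemma computable_d_eliminate_step: "computable F \<Longrightarrow> computable (\<lambda>x. d_eliminate_step (F x))"
  by (erule computable_compose)
     (unfold d_eliminate_step_def, intro computable_intros computable_d_pivot computable_d_reduce)

lemma computable_d_span_member:
  "computable F \<Longrightarrow> computable G \<Longrightarrow> computable (\<lambda>x. d_span_member (F x) (G x))"
  by (rule computable_apply2[of d_span_member])
     (unfold d_span_member_def, intro computable_intros computable_d_pivot computable_d_eliminate_step)

text \<open>Programs contain no field constants except 0 and 1, so the built-in coefficients must be
  obtainable from these; \<open>- 1\<close> is computed as \<open>0 - 1\<close>.\<close>

lemma computable_d_left_mult:
  assumes "\<And>r a w. r \<in> set rs \<Longrightarrow> (a, w) \<in> set r \<Longrightarrow> a = 1 \<or> a = - 1" "computable F"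
  shows "computable (\<lambda>x. d_left_mult rs (F x))"
  using assms(2)
proof (rule computable_compose)
  have "computable (\<lambda>_. Scalar (fst t))" if "r \<in> set rs" "t \<in> set r" for r t
  proof -
    have "computable (\<lambda>_. lift_op (-) (Scalar 0) (Scalar 1))"
      by (intro computable_minus computable_zero computable_one)
    then have "computable (\<lambda>_. Scalar (- 1))" by simp
    then show ?thesis using assms(1)[of r "fst t" "snd t"] that computable_one by auto
  qed
  then show "computable (\<lambda>x. d_left_mult rs x)"
    unfolding d_left_mult_def by (intro computable_intros)
qed

lemma computable_d_level_step: "computable F \<Longrightarrow> computable (\<lambda>x. d_level_step n (F x))"
  by (erule computable_compose)
     (unfold d_level_step_def, intro computable_intros computable_d_left_mult,
      auto simp: linear_rels_def linear_rel_def quadratic_rels_def)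

lemma computable_d_hom: "computable F \<Longrightarrow> computable G \<Longrightarrow> computable (\<lambda>x. d_hom n (F x) (G x))"
  by (rule computable_apply2[of "d_hom n"])
     (unfold d_hom_def d_prefix_row_def, intro computable_intros)

lemma computable_d_rels: "computable F \<Longrightarrow> computable (\<lambda>x. d_rels n (F x))"
  by (erule computable_compose) (unfold d_rels_def, intro computable_intros computable_d_level_step)

lemma computable_d_counter: "computable F \<Longrightarrow> computable (\<lambda>x. d_counter (F x))"
  by (erule computable_compose) (unfold d_counter_def, intro computable_intros)

lemma computable_d_decide: "computable (d_decide n)"
proof -
  have "computable (\<lambda>x. d_difference (head x) (tail x))"
    unfolding d_difference_def by (intro computable_intros)
  moreover have "computable (d_decide_difference n)"
    unfolding d_decide_difference_def
    by (intro computable_d_span_member computable_d_hom computable_d_rels computable_d_counter computable_id)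
  ultimately show ?thesis unfolding d_decide_def by (rule computable_compose)
qed

theorem corollary1p3:
  fixes n :: nat
  shows "word_problem_decidable (generators n) (qsym_ideal n)"
proof -
  \<comment> \<open>The program is fixed by \<open>n\<close> alone, before any input is
    given.\<close>
  obtain c where "\<And>x :: complex data. computes c x (d_decide n x)"
    using computable_computes[OF computable_d_decide[of n]] by blast
  then show ?thesis unfolding word_problem_decidable_def by (metis d_decide)
qed

end
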